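(* Let $k$ be a commutative unital ring and let $\mathcal C$ be an ordinary quasi-category (a simplicial set with fillers for all inner horns). Then the templicial $k$-module $\tilde F(\mathcal C)$ is a quasi-category in modules.
   Context: Quivers. For a set $S$, $k\mathrm{Quiv}_S$ is the category of families $Q=(Q(a,b))_{a,b\in S}$ of $k$-modules with componentwise morphisms; it is monoidal with $(Q\otimes_S P)(a,b)=\bigoplus_{c\in S}Q(a,c)\otimes P(c,b)$ and unit $k_S$, where $k_S(a,b)=k$ if $a=b$ and $0$ otherwise. Finite intervals. $\mathbf{\Delta}_f$ has objects $[n]=\{0,\dots,n\}$, $n\ge 0$, and morphisms the order-preserving maps $f:[m]\to[n]$ with $f(0)=0$, $f(m)=n$; it is monoidal with $[m]+[n]=[m+n]$, unit $[0]$, $(f+g)(i)=f(i)$ for $i\le m$ and $m'+g(i-m)$ for $i\ge m$ (where $f:[m]\to[m']$). Templicial modules. A templicial $k$-module is a pair $(X,S)$ with $S$ a set and $X:\mathbf{\Delta}_f^{op}\to k\mathrm{Quiv}_S$ a colax monoidal functor, with comultiplications $\mu_{p,q}:X_{p+q}\to X_p\otimes_S X_q$ and counit $\epsilon:X_0\to k_S$ an isomorphism. For a simplicial set $K$, $\tilde F(K)$ is the templicial $k$-module with vertex set $K_0$, $\tilde F(K)_n(a,b)$ the free $k$-module on the $n$-simplices of $K$ with first vertex $a$ and last vertex $b$, inner faces and degeneracies those of $K$, and $\mu_{p,q}$ induced by $x\mapsto x|_{\{0,\dots,p\}}\otimes x|_{\{p,\dots,p+q\}}$. Necklaces. $\mathcal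 Nec$ has objects $(T,p)$ with $p\ge0$ and $T\subseteq[p]$ containing $0$ and $p$; a morphism $(T,p)\to(U,q)$ is $f:[p]\to[q]$ in $\mathbf{\Delta}_f$ with $U\subseteq f(T)$. For $T=\{0=t_0<\dots<t_k=p\}$ put $X_T=X_{t_1}\otimes_S X_{t_2-t_1}\otimes_S\cdots\otimes_S X_{p-t_{k-1}}$ ($k_S$ if $p=0$), and let $\mu_T:X_p\to X_T$ be the iterated comultiplication ($\epsilon$ if $p=0$, identity if $k=1$). This extends to a functor $X_\bullet:\mathcal Nec^{op}\to k\mathrm{Quiv}_S$: each $f:(T,p)\to(U,q)$ factors uniquely as the active map $f:(T,p)\to(f(T),q)$ followed by the inert map $\mathrm{id}_{[q]}:(f(T),q)\to(U,q)$. For an inert map $(T,p)\to(U,p)$, $U=\{0=u_0<\dots<u_l=p\}\subseteq T$, $X_U\to X_T$ is $\mu_{T_1}\otimes\cdots\otimes\mu_{T_l}$ with $T_i=\{t-u_{i-1}: t\in T, u_{i-1}\le t\le u_i\}$. For an active map $f$, write uniquely $f=f_1+\dots+f_k$ with $f_i:[t_i-t_{i-1}]\to[f(t_i)-f(t_{i-1})]$ in $\mathbf{\Delta}_f$; then $X_{f(T)}\to X_T$ is $X_{f(T)}\simeq X_{f(t_1)}\otimes_S\cdots\otimes_S X_{q-f(t_{k-1})}\xrightarrow{X(f_1)\otimes\cdots\otimes X(f_k)}X_T$, the isomorphism using $X_0\simeq k_S$. Evaluating at $a,b\in S$ gives $X_\bullet(a,b):\mathcal Nec^{op}\to\mathrm{Mod}(k)$.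 Quasi-categories in modules. A functor $Y:\mathcal Nec^{op}\to\mathrm{Mod}(k)$ lifts inner horns if for all $0<j<n$ every natural transformation $\tilde F(\Lambda^n_j)_\bullet(0,n)\to Y$ extends along the map $\tilde F(\Lambda^n_j)_\bullet(0,n)\to\tilde F(\Delta^n)_\bullet(0,n)$ induced by the $j$th horn inclusion. A templicial $k$-module $(X,S)$ is a quasi-category in modules if $X_\bullet(a,b)$ lifts inner horns for all $a,b\in S$. *)

theory Defs
  imports "HOL-Algebra.Module" "HOL-Algebra.AbelCoset"
begin

section \<open>Modules\<close>

text \<open>The base ring is any \<open>R\<close> with \<open>cring R\<close>, so the zero ring is allowed. The
  library type of modules carries the fields \<open>mult\<close> and \<open>one\<close>, which play no role in
  \<^locale>\<open>module\<close>; they are left undefined below.\<close>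

definition mod_hom ::
    "('r, 'e) ring_scheme \<Rightarrow> ('r, 'm) module \<Rightarrow> ('r, 'n) module \<Rightarrow> ('m \<Rightarrow> 'n) set" where
  "mod_hom R M N = {h \<in> carrier M \<rightarrow> carrier N.
     (\<forall>x\<in>carrier M. \<forall>y\<in>carrier M. h (x \<oplus>\<^bsub>M\<^esub> y) = h x \<oplus>\<^bsub>N\<^esub> h y) \<and>
     (\<forall>r\<in>carrier R. \<forall>x\<in>carrier M. h (r \<odot>\<^bsub>M\<^esub> x) = r \<odot>\<^bsub>N\<^esub> h x)}"

definition free_mod :: "('r, 'e) ring_scheme \<Rightarrow> 'x set \<Rightarrow> ('r, 'x \<Rightarrow> 'r) module" where
  "free_mod R A =
    \<lparr>carrier = {f. (\<forall>x. f x \<in> carrier R) \<and> (\<forall>x. x \<notin> A \<longrightarrow> f x = \<zero>\<^bsub>R\<^esub>) \<and> finite {x. f x \<noteq> \<zero>\<^bsub>R\<^esub>}},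
     mult = undefined, one = undefined,
     zero = (\<lambda>x. \<zero>\<^bsub>R\<^esub>), add = (\<lambda>f g x. f x \<oplus>\<^bsub>R\<^esub> g x), smult = (\<lambda>r f x. r \<otimes>\<^bsub>R\<^esub> f x)\<rparr>"

definition single :: "('r, 'e) ring_scheme \<Rightarrow> 'x \<Rightarrow> 'x \<Rightarrow> 'r" where
  "single R x = (\<lambda>y. if y = x then \<one>\<^bsub>R\<^esub> else \<zero>\<^bsub>R\<^esub>)"

text \<open>The linear extension to a free module of a map \<open>g\<close> given on basis elements.\<close>

definition free_lift ::
    "('r, 'e) ring_scheme \<Rightarrow> ('r, 'm) module \<Rightarrow> ('x \<Rightarrow> 'm) \<Rightarrow> ('x \<Rightarrow> 'r) \<Rightarrow> 'm" where
  "free_lift R N g f = (\<Oplus>\<^bsub>N\<^esub> x \<in> {x. f x \<noteq> \<zero>\<^bsub>R\<^esub>}. f x \<odot>\<^bsub>N\<^esub> g x)"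

definition submod_span :: "('r, 'e) ring_scheme \<Rightarrow> ('r, 'm) module \<Rightarrow> 'm set \<Rightarrow> 'm set" where
  "submod_span R M G = \<Inter>{H. submodule H R M \<and> G \<subseteq> H}"

definition quot_mod :: "('r, 'm) module \<Rightarrow> 'm set \<Rightarrow> ('r, 'm set) module" where
  "quot_mod M H =
    \<lparr>carrier = a_rcosets\<^bsub>M\<^esub> H, mult = undefined, one = undefined,
     zero = H, add = set_add M, smult = (\<lambda>r C. \<Union>x\<in>C. H +>\<^bsub>M\<^esub> (r \<odot>\<^bsub>M\<^esub> x))\<rparr>"


section \<open>Quivers and their tensor products\<close>

text \<open>A quiver on \<open>S\<close> is only looked at on pairs of elements of \<open>S\<close>.\<close>

type_synonym ('s, 'r, 'm) quiver = "'s \<Rightarrow> 's \<Rightarrow> ('r, 'm) module"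

text \<open>The types of iterated binary tensor products would depend on the number of factors.
  We therefore construct the tensor product of a list of quivers in one step,
  \[ (Q_1 \otimes_S \cdots \otimes_S Q_k)(a,b) = \bigoplus_{c_1,\dots,c_{k-1} \in S}
     Q_1(a,c_1) \otimes Q_2(c_1,c_2) \otimes \cdots \otimes Q_k(c_{k-1},b), \]
  by generators and multilinearity relations. The generator
  \<open>x\<^sub>1 \<otimes> \<dots> \<otimes> x\<^sub>k\<close> in the summand of \<open>c\<^sub>1, \<dots>, c\<^sub>k\<^sub>-\<^sub>1\<close> is the list
  \<open>[(x\<^sub>1, c\<^sub>1), \<dots>, (x\<^sub>k, c\<^sub>k)]\<close> with \<open>c\<^sub>k = b\<close>, so that concatenation of generators is
  concatenation of lists. Two factors give the binary \<open>\<otimes>\<^sub>S\<close>, no factors give (up to the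
  isomorphism \<open>unit_tens\<close> below) the unit \<open>k\<^sub>S\<close>, and one factor gives \<open>Q\<close> itself up to the
  isomorphism \<open>one_tens\<close>.\<close>

fun qpaths :: "'s set \<Rightarrow> ('s, 'r, 'm) quiver list \<Rightarrow> 's \<Rightarrow> 's \<Rightarrow> ('m \<times> 's) list set" where
  "qpaths S [] a b = (if a = b then {[]} else {})"
| "qpaths S (Q # Qs) a b =
     {(x, c) # p | x c p. c \<in> S \<and> x \<in> carrier (Q a c) \<and> p \<in> qpaths S Qs c b}"

type_synonym ('s, 'r, 'm) tens = "(('m \<times> 's) list \<Rightarrow> 'r) set"

definition tens_relators ::
    "('r, 'e) ring_scheme \<Rightarrow> 's set \<Rightarrow> ('s, 'r, 'm) quiver list \<Rightarrow> 's \<Rightarrow> 's \<Rightarrow>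
     (('m \<times> 's) list \<Rightarrow> 'r) set" where
  "tens_relators R S Qs a b = (let F = free_mod R (qpaths S Qs a b) in
     {single R (p @ (x \<oplus>\<^bsub>Q c d\<^esub> y, d) # q)
        \<ominus>\<^bsub>F\<^esub> (single R (p @ (x, d) # q) \<oplus>\<^bsub>F\<^esub> single R (p @ (y, d) # q)) | Ps Q Rs c d p q x y.
        Qs = Ps @ Q # Rs \<and> c \<in> S \<and> d \<in> S \<and> p \<in> qpaths S Ps a c \<and> q \<in> qpaths S Rs d b \<and>
        x \<in> carrier (Q c d) \<and> y \<in> carrier (Q c d)} \<union>
     {single R (p @ (r \<odot>\<^bsub>Q c d\<^esub> x, d) # q)
        \<ominus>\<^bsub>F\<^esub> (r \<odot>\<^bsub>F\<^esub> single R (p @ (x, d) # q)) | Ps Q Rs c d p q r x.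
        Qs = Ps @ Q # Rs \<and> c \<in> S \<and> d \<in> S \<and> p \<in> qpaths S Ps a c \<and> q \<in> qpaths S Rs d b \<and>
        r \<in> carrier R \<and> x \<in> carrier (Q c d)})"

definition tens_rel ::
    "('r, 'e) ring_scheme \<Rightarrow> 's set \<Rightarrow> ('s, 'r, 'm) quiver list \<Rightarrow> 's \<Rightarrow> 's \<Rightarrow>
     (('m \<times> 's) list \<Rightarrow> 'r) set" where
  "tens_rel R S Qs a b =
     submod_span R (free_mod R (qpaths S Qs a b)) (tens_relators R S Qs a b)"

definition qtensor ::
    "('r, 'e) ring_scheme \<Rightarrow> 's set \<Rightarrow> ('s, 'r, 'm) quiver list \<Rightarrow> 's \<Rightarrow> 's \<Rightarrow>
     ('r, ('s, 'r, 'm) tens) module" where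
  "qtensor R S Qs a b = quot_mod (free_mod R (qpaths S Qs a b)) (tens_rel R S Qs a b)"

definition pure ::
    "('r, 'e) ring_scheme \<Rightarrow> 's set \<Rightarrow> ('s, 'r, 'm) quiver list \<Rightarrow> 's \<Rightarrow> 's \<Rightarrow>
     ('m \<times> 's) list \<Rightarrow> ('s, 'r, 'm) tens" where
  "pure R S Qs a b p =
     tens_rel R S Qs a b +>\<^bsub>free_mod R (qpaths S Qs a b)\<^esub> single R p"

text \<open>The linear map out of a tensor product that takes prescribed values \<open>g p\<close> on pure
  tensors. The choice of a representative is immaterial when \<open>g\<close> is multilinear, which is
  the case in all uses below.\<close>

definition tens_lift ::
    "('r, 'e) ring_scheme \<Rightarrow> ('r, 'n) module \<Rightarrow> (('m \<times> 's) list \<Rightarrow> 'n) \<Rightarrow>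
     ('s, 'r, 'm) tens \<Rightarrow> 'n" where
  "tens_lift R N g C = free_lift R N g (SOME f. f \<in> C)"

text \<open>The canonical map
  \<open>(P\<^sub>1 \<otimes> \<dots> \<otimes> P\<^sub>k)(a,c) \<times> (Q\<^sub>1 \<otimes> \<dots> \<otimes> Q\<^sub>l)(c,b) \<rightarrow> (P\<^sub>1 \<otimes> \<dots> \<otimes> P\<^sub>k \<otimes> Q\<^sub>1 \<otimes> \<dots> \<otimes> Q\<^sub>l)(a,b)\<close>.\<close>

definition tens_cat ::
    "('r, 'e) ring_scheme \<Rightarrow> 's set \<Rightarrow> ('s, 'r, 'm) quiver list \<Rightarrow> 's \<Rightarrow> 's \<Rightarrow>
     ('s, 'r, 'm) tens \<Rightarrow> ('s, 'r, 'm) tens \<Rightarrow> ('s, 'r, 'm) tens" where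
  "tens_cat R S Qs a b C D =
     tens_lift R (qtensor R S Qs a b)
       (\<lambda>p. tens_lift R (qtensor R S Qs a b) (\<lambda>q. pure R S Qs a b (p @ q)) D) C"

text \<open>The tensor product \<open>\<phi>\<^sub>1 \<otimes> \<dots> \<otimes> \<phi>\<^sub>k\<close> of morphisms of quivers, where each \<open>\<phi>\<^sub>i\<close> takes values
  in the tensor product of a list of quivers; \<open>tens_path\<close> gives its values on pure tensors.\<close>

type_synonym ('s, 'r, 'm) qmaps =
  "(('s, 'r, 'm) quiver list \<times> ('s \<Rightarrow> 's \<Rightarrow> 'm \<Rightarrow> ('s, 'r, 'm) tens)) list"

fun tens_path ::
    "('r, 'e) ring_scheme \<Rightarrow> 's set \<Rightarrow> ('s, 'r, 'm) qmaps \<Rightarrow> 's \<Rightarrow> 's \<Rightarrow>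
     ('m \<times> 's) list \<Rightarrow> ('s, 'r, 'm) tens" where
  "tens_path R S ((Ps, \<phi>) # \<Phi>) a b ((x, c) # p) =
     tens_cat R S (Ps @ concat (map fst \<Phi>)) a b (\<phi> a c x) (tens_path R S \<Phi> c b p)"
| "tens_path R S \<Phi> a b p = pure R S [] a b []"

definition tens_map ::
    "('r, 'e) ring_scheme \<Rightarrow> 's set \<Rightarrow> ('s, 'r, 'm) qmaps \<Rightarrow> 's \<Rightarrow> 's \<Rightarrow>
     ('s, 'r, 'm) tens \<Rightarrow> ('s, 'r, 'm) tens" where
  "tens_map R S \<Phi> a b =
     tens_lift R (qtensor R S (concat (map fst \<Phi>)) a b) (tens_path R S \<Phi> a b)"

definition unit_quiver :: "('r, 'e) ring_scheme \<Rightarrow> ('s, 'r, 'r) quiver" where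
  "unit_quiver R a b =
    \<lparr>carrier = (if a = b then carrier R else {\<zero>\<^bsub>R\<^esub>}), mult = undefined, one = undefined,
     zero = \<zero>\<^bsub>R\<^esub>, add = add R, smult = mult R\<rparr>"

definition unit_tens ::
    "('r, 'e) ring_scheme \<Rightarrow> 's set \<Rightarrow> 's \<Rightarrow> 's \<Rightarrow> 'r \<Rightarrow> ('s, 'r, 'm) tens" where
  "unit_tens R S a b r =
     (if a = b then r \<odot>\<^bsub>qtensor R S [] a b\<^esub> pure R S [] a b [] else \<zero>\<^bsub>qtensor R S [] a b\<^esub>)"

definition one_tens ::
    "('r, 'e) ring_scheme \<Rightarrow> 's set \<Rightarrow> ('s, 'r, 'm) quiver \<Rightarrow> 's \<Rightarrow> 's \<Rightarrow> 'm \<Rightarrow>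
     ('s, 'r, 'm) tens" where
  "one_tens R S Q a b x = pure R S [Q] a b [(x, b)]"


section \<open>Simplices and finite intervals\<close>

text \<open>A map \<open>[m] \<rightarrow> [n]\<close> is represented by the function that is \<^const>\<open>undefined\<close> outside
  \<open>{..m}\<close>; composition is \<^const>\<open>compose\<close>.\<close>

definition Delta :: "nat \<Rightarrow> nat \<Rightarrow> (nat \<Rightarrow> nat) set" where
  "Delta m n = {f \<in> {..m} \<rightarrow>\<^sub>E {..n}. mono_on {..m} f}"

definition Delta_f :: "nat \<Rightarrow> nat \<Rightarrow> (nat \<Rightarrow> nat) set" where
  "Delta_f m n = {f \<in> Delta m n. f 0 = 0 \<and> f m = n}"

text \<open>\<open>f + g\<close> for \<open>f : [m] \<rightarrow> [m']\<close> and \<open>g : [n] \<rightarrow> [n']\<close> in \<open>\<Delta>\<^sub>f\<close>.\<close>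

definition dplus :: "nat \<Rightarrow> nat \<Rightarrow> nat \<Rightarrow> (nat \<Rightarrow> nat) \<Rightarrow> (nat \<Rightarrow> nat) \<Rightarrow> nat \<Rightarrow> nat" where
  "dplus m m' n f g = (\<lambda>i\<in>{..m + n}. if i \<le> m then f i else m' + g (i - m))"


section \<open>Simplicial sets\<close>

text \<open>\<open>sact K m n \<alpha> : K\<^sub>n \<rightarrow> K\<^sub>m\<close> is the action of \<open>\<alpha> : [m] \<rightarrow> [n]\<close>.\<close>

record 'x sset =
  cells :: "nat \<Rightarrow> 'x set"
  sact :: "nat \<Rightarrow> nat \<Rightarrow> (nat \<Rightarrow> nat) \<Rightarrow> 'x \<Rightarrow> 'x"

definition simplicial_set :: "'x sset \<Rightarrow> bool" where
  "simplicial_set K \<longleftrightarrow>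
     (\<forall>m n. \<forall>\<alpha>\<in>Delta m n. sact K m n \<alpha> \<in> cells K n \<rightarrow> cells K m) \<and>
     (\<forall>n. \<forall>x\<in>cells K n. sact K n n (\<lambda>i\<in>{..n}. i) x = x) \<and>
     (\<forall>l m n. \<forall>\<alpha>\<in>Delta l m. \<forall>\<beta>\<in>Delta m n. \<forall>x\<in>cells K n.
        sact K l n (compose {..l} \<beta> \<alpha>) x = sact K l m \<alpha> (sact K m n \<beta> x))"

definition simplicial_map :: "'x sset \<Rightarrow> 'y sset \<Rightarrow> (nat \<Rightarrow> 'x \<Rightarrow> 'y) \<Rightarrow> bool" where
  "simplicial_map K L g \<longleftrightarrow>
     (\<forall>n. g n \<in> cells K n \<rightarrow> cells L n) \<and>
     (\<forall>m n. \<forall>\<alpha>\<in>Delta m n. \<forall>x\<in>cells K n. g m (sact K m n \<alpha> x) = sact L m n \<alpha> (g n x))"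

definition simplex :: "nat \<Rightarrow> (nat \<Rightarrow> nat) sset" where
  "simplex n = \<lparr>cells = (\<lambda>m. Delta m n), sact = (\<lambda>l m \<alpha> x. compose {..l} x \<alpha>)\<rparr>"

definition horn :: "nat \<Rightarrow> nat \<Rightarrow> (nat \<Rightarrow> nat) sset" where
  "horn n j = \<lparr>cells = (\<lambda>m. {x \<in> Delta m n. \<exists>i\<in>{..n}. i \<noteq> j \<and> i \<notin> x ` {..m}}),
               sact = (\<lambda>l m \<alpha> x. compose {..l} x \<alpha>)\<rparr>"

definition quasi_category :: "'x sset \<Rightarrow> bool" where
  "quasi_category K \<longleftrightarrow> simplicial_set K \<and>
     (\<forall>n j. 0 < j \<and> j < n \<longrightarrow> (\<forall>g. simplicial_map (horn n j) K g \<longrightarrow>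
        (\<exists>h. simplicial_map (simplex n) K h \<and> (\<forall>m. \<forall>x\<in>cells (horn n j) m. h m x = g m x))))"

definition vertex :: "'x sset \<Rightarrow> nat \<Rightarrow> nat \<Rightarrow> 'x \<Rightarrow> 'x" where
  "vertex K n i x = sact K 0 n (\<lambda>_\<in>{..0}. i) x"

definition cells_between :: "'x sset \<Rightarrow> nat \<Rightarrow> 'x \<Rightarrow> 'x \<Rightarrow> 'x set" where
  "cells_between K n a b = {x \<in> cells K n. vertex K n 0 x = a \<and> vertex K n n x = b}"


section \<open>Templicial modules\<close>

text \<open>\<open>tact X m n f a b : X\<^sub>n(a,b) \<rightarrow> X\<^sub>m(a,b)\<close> is the action of \<open>f : [m] \<rightarrow> [n]\<close> in \<open>\<Delta>\<^sub>f\<close>, and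
  \<open>comult X p q a b : X\<^sub>p\<^sub>+\<^sub>q(a,b) \<rightarrow> (X\<^sub>p \<otimes>\<^sub>S X\<^sub>q)(a,b)\<close>.\<close>

record ('s, 'r, 'm) templicial =
  verts :: "'s set"
  tmod :: "nat \<Rightarrow> ('s, 'r, 'm) quiver"
  tact :: "nat \<Rightarrow> nat \<Rightarrow> (nat \<Rightarrow> nat) \<Rightarrow> 's \<Rightarrow> 's \<Rightarrow> 'm \<Rightarrow> 'm"
  comult :: "nat \<Rightarrow> nat \<Rightarrow> 's \<Rightarrow> 's \<Rightarrow> 'm \<Rightarrow> ('s, 'r, 'm) tens"
  counit :: "'s \<Rightarrow> 's \<Rightarrow> 'm \<Rightarrow> 'r"

text \<open>\<open>id_blk X n\<close> and \<open>tact_blk X m n f\<close> are \<open>id : X\<^sub>n \<rightarrow> X\<^sub>n\<close> and \<open>X(f) : X\<^sub>n \<rightarrow> X\<^sub>m\<close>, packaged as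
  factors of a \<^const>\<open>tens_map\<close>; similarly for the comultiplication and the counit.\<close>

definition id_blk where
  "id_blk R X n = ([tmod X n], one_tens R (verts X) (tmod X n))"

definition tact_blk where
  "tact_blk R X m n f =
     ([tmod X m], \<lambda>a b x. one_tens R (verts X) (tmod X m) a b (tact X m n f a b x))"

definition comult_blk where
  "comult_blk X p q = ([tmod X p, tmod X q], comult X p q)"

definition counit_blk where
  "counit_blk R X = ([], \<lambda>a b x. unit_tens R (verts X) a b (counit X a b x))"

definition templicial_module ::
    "('r, 'e) ring_scheme \<Rightarrow> ('s, 'r, 'm) templicial \<Rightarrow> bool" where
  "templicial_module R X \<longleftrightarrow> (let S = verts X in
     (\<forall>n. \<forall>a\<in>S. \<forall>b\<in>S. module R (tmod X n a b)) \<and>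
     \<comment> \<open>functoriality\<close>
     (\<forall>m n. \<forall>f\<in>Delta_f m n. \<forall>a\<in>S. \<forall>b\<in>S.
        tact X m n f a b \<in> mod_hom R (tmod X n a b) (tmod X m a b)) \<and>
     (\<forall>n. \<forall>a\<in>S. \<forall>b\<in>S. \<forall>x\<in>carrier (tmod X n a b). tact X n n (\<lambda>i\<in>{..n}. i) a b x = x) \<and>
     (\<forall>l m n. \<forall>f\<in>Delta_f l m. \<forall>g\<in>Delta_f m n. \<forall>a\<in>S. \<forall>b\<in>S. \<forall>x\<in>carrier (tmod X n a b).
        tact X l n (compose {..l} g f) a b x = tact X l m f a b (tact X m n g a b x)) \<and>
     \<comment> \<open>naturality of the comultiplications\<close>
     (\<forall>p q. \<forall>a\<in>S. \<forall>b\<in>S.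
        comult X p q a b \<in> mod_hom R (tmod X (p + q) a b) (qtensor R S [tmod X p, tmod X q] a b)) \<and>
     (\<forall>p p' q q'. \<forall>f\<in>Delta_f p p'. \<forall>g\<in>Delta_f q q'. \<forall>a\<in>S. \<forall>b\<in>S.
        \<forall>x\<in>carrier (tmod X (p' + q') a b).
        comult X p q a b (tact X (p + q) (p' + q') (dplus p p' q f g) a b x) =
        tens_map R S [tact_blk R X p p' f, tact_blk R X q q' g] a b (comult X p' q' a b x)) \<and>
     \<comment> \<open>the counit is an isomorphism\<close>
     (\<forall>a\<in>S. \<forall>b\<in>S. counit X a b \<in> mod_hom R (tmod X 0 a b) (unit_quiver R a b) \<and>
        bij_betw (counit X a b) (carrier (tmod X 0 a b)) (carrier (unit_quiver R a b))) \<and>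
     \<comment> \<open>coassociativity and counitality\<close>
     (\<forall>p q r. \<forall>a\<in>S. \<forall>b\<in>S. \<forall>x\<in>carrier (tmod X (p + q + r) a b).
        tens_map R S [comult_blk X p q, id_blk R X r] a b (comult X (p + q) r a b x) =
        tens_map R S [id_blk R X p, comult_blk X q r] a b (comult X p (q + r) a b x)) \<and>
     (\<forall>n. \<forall>a\<in>S. \<forall>b\<in>S. \<forall>x\<in>carrier (tmod X n a b).
        tens_map R S [counit_blk R X, id_blk R X n] a b (comult X 0 n a b x) =
          one_tens R S (tmod X n) a b x \<and>
        tens_map R S [id_blk R X n, counit_blk R X] a b (comult X n 0 a b x) =
          one_tens R S (tmod X n) a b x))"

definition ftilde :: "('r, 'e) ring_scheme \<Rightarrow> 'x sset \<Rightarrow> ('x, 'r, 'x \<Rightarrow> 'r) templicial" where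
  "ftilde R K = (let S = cells K 0; Q = (\<lambda>n a b. free_mod R (cells_between K n a b)) in
    \<lparr>verts = S,
     tmod = Q,
     tact = (\<lambda>m n f a b. free_lift R (Q m a b) (\<lambda>x. single R (sact K m n f x))),
     comult = (\<lambda>p q a b. free_lift R (qtensor R S [Q p, Q q] a b) (\<lambda>x.
       pure R S [Q p, Q q] a b
         [(single R (sact K p (p + q) (\<lambda>i\<in>{..p}. i) x), vertex K (p + q) p x),
          (single R (sact K q (p + q) (\<lambda>i\<in>{..q}. p + i) x), b)])),
     counit = (\<lambda>a b. free_lift R (unit_quiver R a b) (\<lambda>x. \<one>\<^bsub>R\<^esub>))\<rparr>)"

text \<open>The components of the morphism of templicial modules induced by a simplicial map.\<close>

definition ftilde_map ::
    "('r, 'e) ring_scheme \<Rightarrow> 'y sset \<Rightarrow> (nat \<Rightarrow> 'x \<Rightarrow> 'y) \<Rightarrow> nat \<Rightarrow> 'x \<Rightarrow> 'x \<Rightarrow>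
     ('x \<Rightarrow> 'r) \<Rightarrow> ('y \<Rightarrow> 'r)" where
  "ftilde_map R L g n a b =
     free_lift R (free_mod R (cells_between L n (g 0 a) (g 0 b))) (\<lambda>x. single R (g n x))"


section \<open>Necklaces\<close>

type_synonym necklace = "nat set \<times> nat"

definition is_necklace :: "necklace \<Rightarrow> bool" where
  "is_necklace = (\<lambda>(T, p). T \<subseteq> {..p} \<and> 0 \<in> T \<and> p \<in> T)"

definition nec_hom :: "necklace \<Rightarrow> necklace \<Rightarrow> (nat \<Rightarrow> nat) set" where
  "nec_hom = (\<lambda>(T, p) (U, q). {f \<in> Delta_f p q. U \<subseteq> f ` T})"

text \<open>For \<open>T = {0 = t\<^sub>0 < \<dots> < t\<^sub>k = p}\<close> these are the pairs \<open>(t\<^sub>i\<^sub>-\<^sub>1, t\<^sub>i)\<close> and the differences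
  \<open>t\<^sub>i - t\<^sub>i\<^sub>-\<^sub>1\<close>, in order.\<close>

definition steps :: "nat set \<Rightarrow> (nat \<times> nat) list" where
  "steps T = (let ts = sorted_list_of_set T in zip ts (tl ts))"

definition gaps :: "nat set \<Rightarrow> nat list" where
  "gaps T = map (\<lambda>(s, t). t - s) (steps T)"

definition nec_mod ::
    "('r, 'e) ring_scheme \<Rightarrow> ('s, 'r, 'm) templicial \<Rightarrow> necklace \<Rightarrow>
     ('s, 'r, ('s, 'r, 'm) tens) quiver" where
  "nec_mod R X = (\<lambda>(T, p). qtensor R (verts X) (map (tmod X) (gaps T)))"

text \<open>The iterated comultiplication \<open>\<mu>\<^sub>T : X\<^sub>p \<rightarrow> X\<^sub>T\<close>, as a function of the list of gaps of \<open>T\<close>.\<close>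

fun comult_gaps ::
    "('r, 'e) ring_scheme \<Rightarrow> ('s, 'r, 'm) templicial \<Rightarrow> nat list \<Rightarrow>
     's \<Rightarrow> 's \<Rightarrow> 'm \<Rightarrow> ('s, 'r, 'm) tens" where
  "comult_gaps R X [] a b x = unit_tens R (verts X) a b (counit X a b x)"
| "comult_gaps R X [n] a b x = one_tens R (verts X) (tmod X n) a b x"
| "comult_gaps R X (n # m # ns) a b x =
     tens_map R (verts X)
       [id_blk R X n, (map (tmod X) (m # ns), comult_gaps R X (m # ns))] a b
       (comult X n (sum_list (m # ns)) a b x)"

text \<open>\<open>X\<^sub>U \<rightarrow> X\<^sub>T\<close> for the inert map \<open>id : (T,p) \<rightarrow> (U,p)\<close>.\<close>

definition nec_inert ::
    "('r, 'e) ring_scheme \<Rightarrow> ('s, 'r, 'm) templicial \<Rightarrow> nat set \<Rightarrow> nat set \<Rightarrow>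
     's \<Rightarrow> 's \<Rightarrow> ('s, 'r, 'm) tens \<Rightarrow> ('s, 'r, 'm) tens" where
  "nec_inert R X T U =
     tens_map R (verts X) (map (\<lambda>(s, t).
       let ns = gaps {r - s | r. r \<in> T \<and> s \<le> r \<and> r \<le> t} in
       (map (tmod X) ns, comult_gaps R X ns)) (steps U))"

text \<open>The active map \<open>f : (T,p) \<rightarrow> (f(T),q)\<close> acts in two steps. The isomorphism
  \<open>X\<^bsub>f(T)\<^esub> \<simeq> X\<^bsub>d\<^sub>1\<^esub> \<otimes>\<^sub>S \<dots> \<otimes>\<^sub>S X\<^bsub>d\<^sub>k\<^esub>\<close> with \<open>d\<^sub>i = f(t\<^sub>i) - f(t\<^sub>i\<^sub>-\<^sub>1)\<close> inserts
  \<open>\<epsilon>\<^sup>-\<^sup>1(1) \<in> X\<^sub>0(c,c)\<close> at the positions with \<open>d\<^sub>i = 0\<close>, as the gaps of \<open>f(T)\<close> are the nonzero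
  \<open>d\<^sub>i\<close>. It is followed by \<open>X(f\<^sub>1) \<otimes> \<dots> \<otimes> X(f\<^sub>k)\<close>.\<close>

definition unit_elt :: "('r, 'e) ring_scheme \<Rightarrow> ('s, 'r, 'm) templicial \<Rightarrow> 's \<Rightarrow> 'm" where
  "unit_elt R X c = (THE x. x \<in> carrier (tmod X 0 c c) \<and> counit X c c x = \<one>\<^bsub>R\<^esub>)"

fun insert_units ::
    "('r, 'e) ring_scheme \<Rightarrow> ('s, 'r, 'm) templicial \<Rightarrow> nat list \<Rightarrow> 's \<Rightarrow>
     ('m \<times> 's) list \<Rightarrow> ('m \<times> 's) list" where
  "insert_units R X (0 # ds) a p = (unit_elt R X a, a) # insert_units R X ds a p"
| "insert_units R X (Suc d # ds) a ((x, c) # p) = (x, c) # insert_units R X ds c p"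
| "insert_units R X ds a p = []"

definition nec_active ::
    "('r, 'e) ring_scheme \<Rightarrow> ('s, 'r, 'm) templicial \<Rightarrow> nat set \<Rightarrow> (nat \<Rightarrow> nat) \<Rightarrow>
     's \<Rightarrow> 's \<Rightarrow> ('s, 'r, 'm) tens \<Rightarrow> ('s, 'r, 'm) tens" where
  "nec_active R X T f a b z = (let ds = map (\<lambda>(s, t). f t - f s) (steps T);
       Qs = map (tmod X) ds in
     tens_map R (verts X) (map (\<lambda>(s, t).
         tact_blk R X (t - s) (f t - f s) (\<lambda>i\<in>{..t - s}. f (s + i) - f s)) (steps T)) a b
       (tens_lift R (qtensor R (verts X) Qs a b)
         (\<lambda>p. pure R (verts X) Qs a b (insert_units R X ds a p)) z))"

text \<open>Functors \<open>Nec\<^sup>o\<^sup>p \<rightarrow> Mod(k)\<close>; \<open>nmap Y T U f : Y(U) \<rightarrow> Y(T)\<close> for \<open>f : T \<rightarrow> U\<close>.\<close>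

record ('r, 'y) nec_functor =
  nob :: "necklace \<Rightarrow> ('r, 'y) module"
  nmap :: "necklace \<Rightarrow> necklace \<Rightarrow> (nat \<Rightarrow> nat) \<Rightarrow> 'y \<Rightarrow> 'y"

definition nec_fun ::
    "('r, 'e) ring_scheme \<Rightarrow> ('s, 'r, 'm) templicial \<Rightarrow> 's \<Rightarrow> 's \<Rightarrow>
     ('r, ('s, 'r, 'm) tens) nec_functor" where
  "nec_fun R X a b =
    \<lparr>nob = (\<lambda>T. nec_mod R X T a b),
     nmap = (\<lambda>(T, p) (U, q) f z. nec_active R X T f a b (nec_inert R X (f ` T) U a b z))\<rparr>"

definition nec_nat_trans ::
    "('r, 'e) ring_scheme \<Rightarrow> ('r, 'y) nec_functor \<Rightarrow> ('r, 'z) nec_functor \<Rightarrow>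
     (necklace \<Rightarrow> 'y \<Rightarrow> 'z) \<Rightarrow> bool" where
  "nec_nat_trans R Y Z \<phi> \<longleftrightarrow>
     (\<forall>T. is_necklace T \<longrightarrow> \<phi> T \<in> mod_hom R (nob Y T) (nob Z T)) \<and>
     (\<forall>T U. is_necklace T \<and> is_necklace U \<longrightarrow> (\<forall>f\<in>nec_hom T U. \<forall>y\<in>carrier (nob Y U).
        \<phi> T (nmap Y T U f y) = nmap Z T U f (\<phi> U y)))"

text \<open>\<open>X\<^sub>T(a,b) \<rightarrow> Y\<^sub>T(u(a),u(b))\<close> induced by a map \<open>u\<close> on vertices and components
  \<open>\<alpha> n c d : X\<^sub>n(c,d) \<rightarrow> Y\<^sub>n(u(c),u(d))\<close>.\<close>

fun path_map ::
    "('s \<Rightarrow> 't) \<Rightarrow> (nat \<Rightarrow> 's \<Rightarrow> 's \<Rightarrow> 'm \<Rightarrow> 'n) \<Rightarrow> nat list \<Rightarrow> 's \<Rightarrow>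
     ('m \<times> 's) list \<Rightarrow> ('n \<times> 't) list" where
  "path_map u \<alpha> (n # ns) a ((x, c) # p) = (\<alpha> n a c x, u c) # path_map u \<alpha> ns c p"
| "path_map u \<alpha> ns a p = []"

definition nec_induced ::
    "('r, 'e) ring_scheme \<Rightarrow> ('t, 'r, 'n) templicial \<Rightarrow> ('s \<Rightarrow> 't) \<Rightarrow>
     (nat \<Rightarrow> 's \<Rightarrow> 's \<Rightarrow> 'm \<Rightarrow> 'n) \<Rightarrow> 's \<Rightarrow> 's \<Rightarrow> necklace \<Rightarrow>
     ('s, 'r, 'm) tens \<Rightarrow> ('t, 'r, 'n) tens" where
  "nec_induced R Y u \<alpha> a b = (\<lambda>(T, p).
     tens_lift R (nec_mod R Y (T, p) (u a) (u b))
       (\<lambda>w. pure R (verts Y) (map (tmod Y) (gaps T)) (u a) (u b) (path_map u \<alpha> (gaps T) a w)))"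


section \<open>Quasi-categories in modules\<close>

definition horn_incl ::
    "('r, 'e) ring_scheme \<Rightarrow> nat \<Rightarrow> (nat \<Rightarrow> nat) \<Rightarrow> (nat \<Rightarrow> nat) \<Rightarrow> necklace \<Rightarrow>
     (nat \<Rightarrow> nat, 'r, (nat \<Rightarrow> nat) \<Rightarrow> 'r) tens \<Rightarrow> (nat \<Rightarrow> nat, 'r, (nat \<Rightarrow> nat) \<Rightarrow> 'r) tens" where
  "horn_incl R n = nec_induced R (ftilde R (simplex n)) (\<lambda>x. x)
     (ftilde_map R (simplex n) (\<lambda>m x. x))"

text \<open>The vertex \<open>i\<close> of \<open>\<Delta>\<^sup>n\<close> is the map \<open>[0] \<rightarrow> [n]\<close> with value \<open>i\<close>.\<close>

definition pt :: "nat \<Rightarrow> nat \<Rightarrow> nat" where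
  "pt i = (\<lambda>_\<in>{..0}. i)"

definition lifts_inner_horns :: "('r, 'e) ring_scheme \<Rightarrow> ('r, 'y) nec_functor \<Rightarrow> bool" where
  "lifts_inner_horns R Y \<longleftrightarrow> (\<forall>n j. 0 < j \<and> j < n \<longrightarrow>
     (\<forall>\<phi>. nec_nat_trans R (nec_fun R (ftilde R (horn n j)) (pt 0) (pt n)) Y \<phi> \<longrightarrow>
       (\<exists>\<psi>. nec_nat_trans R (nec_fun R (ftilde R (simplex n)) (pt 0) (pt n)) Y \<psi> \<and>
          (\<forall>T. is_necklace T \<longrightarrow>
             (\<forall>z\<in>carrier (nec_mod R (ftilde R (horn n j)) T (pt 0) (pt n)).
                \<psi> T (horn_incl R n (pt 0) (pt n) T z) = \<phi> T z)))))"

definition quasi_category_in_modules ::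
    "('r, 'e) ring_scheme \<Rightarrow> ('s, 'r, 'm) templicial \<Rightarrow> bool" where
  "quasi_category_in_modules R X \<longleftrightarrow> templicial_module R X \<and>
     (\<forall>a\<in>verts X. \<forall>b\<in>verts X. lifts_inner_horns R (nec_fun R X a b))"

end

theory Submission
  imports Defs
begin

text \<open>All tensor products in sight are free on the paths of simplices of the simplicial set, and on
  such basis elements the necklace functor is precomposition with maps of necklaces. A map from the
  necklaces of a horn is thus a compatible family of values on the necklaces \<open>g : \<Delta>\<^sup>T \<rightarrow> \<Delta>\<^sup>n\<close> inside the
  horn, and a lift is one element \<open>y\<close> over \<open>\<Delta>\<^sup>n\<close> that restricts to these values.

  Filling inner horns gives simplices \<open>Z(x, y)\<close> that restrict to \<open>x\<close> on \<open>{0..p}\<close> and to \<open>y\<close> on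
  \<open>{p..p + q}\<close> and satisfy \<open>Z(x, y)|\<^bsub>{l..p + q}\<^esub> = Z(x|\<^bsub>{l..p}\<^esub>, y)\<close>. So every \<open>\<mu>\<^bsub>p,q\<^esub>\<close> has a linear
  section that preserves the vanishing of the previous \<open>\<mu>\<^bsub>l,p+q-l\<^esub>\<close>. Subtracting the errors of
  \<open>\<mu>\<^bsub>1,n-1\<^esub>, \<mu>\<^bsub>2,n-2\<^esub>, \<dots>\<close> one after the other yields \<open>y\<close> with the prescribed
  comultiplications. The inner faces \<open>1, \<dots>, j - 1\<close> and then \<open>n - 1, \<dots>, j + 1\<close> are corrected by
  degeneracies of the errors, which are invisible to the comultiplications and to the faces that are
  already correct.\<close>


section \<open>Free modules and quotients\<close>

text \<open>That one element \<open>y\<close> suffices is the Yoneda lemma: the necklaces on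
  \<open>T\<close> from \<open>0\<close> to \<open>n\<close> in \<open>\<Delta>^n\<close> are the
  maps from \<open>T\<close> to \<open>({0, n}, n)\<close>, so the functor of the simplex is free on
  a representable one. Such a map lands in the horn exactly if it sends a joint to an inner vertex
  or avoids an inner vertex other than \<open>j\<close>. Outer faces occur only inside splittings,
  which leaves the comultiplications and the inner faces as conditions on \<open>y\<close>. The
  obstacle is that repairing one condition may spoil another. For comultiplications this forces
  \<open>Z\<close> to respect the removal of initial vertices, so it is chosen by recursion over all
  prescribed faces at once. The correction at the face \<open>i\<close> pulls back along a map that
  moves \<open>i\<close> to a neighbour \<open>i'\<close>. It is harmless if \<open>i'\<close> is
  inner, so that inner joints stay inner, and not yet treated, so that no treated vertex is hit
  anew. Approaching \<open>j\<close> from both sides leaves such a neighbour at every step, as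
  \<open>j\<close> itself is never treated. Both rounds rest on subtraction, which exists for linear
  combinations of simplices but not for single simplices.\<close>

lemma mod_homI:
  assumes "\<And>x. x \<in> carrier M \<Longrightarrow> h x \<in> carrier N"
    and "\<And>x y. x \<in> carrier M \<Longrightarrow> y \<in> carrier M \<Longrightarrow> h (x \<oplus>\<^bsub>M\<^esub> y) = h x \<oplus>\<^bsub>N\<^esub> h y"
    and "\<And>r x. r \<in> carrier R \<Longrightarrow> x \<in> carrier M \<Longrightarrow> h (r \<odot>\<^bsub>M\<^esub> x) = r \<odot>\<^bsub>N\<^esub> h x"
  shows "h \<in> mod_hom R M N"
  using assms by (auto simp: mod_hom_def)

lemma mod_hom_closed: "h \<in> mod_hom R M N \<Longrightarrow> x \<in> carrier M \<Longrightarrow> h x \<in> carrier N"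
  by (auto simp: mod_hom_def)

lemma mod_hom_add:
  "h \<in> mod_hom R M N \<Longrightarrow> x \<in> carrier M \<Longrightarrow> y \<in> carrier M \<Longrightarrow> h (x \<oplus>\<^bsub>M\<^esub> y) = h x \<oplus>\<^bsub>N\<^esub> h y"
  by (auto simp: mod_hom_def)

lemma mod_hom_smult:
  "h \<in> mod_hom R M N \<Longrightarrow> r \<in> carrier R \<Longrightarrow> x \<in> carrier M \<Longrightarrow> h (r \<odot>\<^bsub>M\<^esub> x) = r \<odot>\<^bsub>N\<^esub> h x"
  by (auto simp: mod_hom_def)

lemma mod_hom_id: "(\<lambda>x. x) \<in> mod_hom R M M"
  by (auto simp: mod_hom_def)

lemma mod_hom_comp:
  "h \<in> mod_hom R M N \<Longrightarrow> h' \<in> mod_hom R N P \<Longrightarrow> (\<lambda>x. h' (h x)) \<in> mod_hom R M P"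
  by (auto simp: mod_hom_def Pi_iff)

lemma mod_hom_zero:
  assumes "module R M" "module R N" "h \<in> mod_hom R M N"
  shows "h \<zero>\<^bsub>M\<^esub> = \<zero>\<^bsub>N\<^esub>"
proof -
  interpret M: module R M by fact
  interpret N: module R N by fact
  have c: "h \<zero>\<^bsub>M\<^esub> \<in> carrier N" by (rule mod_hom_closed[OF assms(3)]) simp
  have "h \<zero>\<^bsub>M\<^esub> = h (\<zero>\<^bsub>R\<^esub> \<odot>\<^bsub>M\<^esub> \<zero>\<^bsub>M\<^esub>)" by simp
  also have "\<dots> = \<zero>\<^bsub>R\<^esub> \<odot>\<^bsub>N\<^esub> h \<zero>\<^bsub>M\<^esub>" by (rule mod_hom_smult[OF assms(3)]) auto
  also have "\<dots> = \<zero>\<^bsub>N\<^esub>" using c by simp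
  finally show ?thesis .
qed

lemma mod_hom_uminus:
  assumes "module R M" "module R N" "h \<in> mod_hom R M N" "x \<in> carrier M"
  shows "h (\<ominus>\<^bsub>M\<^esub> x) = \<ominus>\<^bsub>N\<^esub> h x"
proof -
  interpret M: module R M by fact
  interpret N: module R N by fact
  have c: "h x \<in> carrier N" "h (\<ominus>\<^bsub>M\<^esub> x) \<in> carrier N"
    using assms(3,4) by (auto intro: mod_hom_closed)
  have "h (\<ominus>\<^bsub>M\<^esub> x) \<oplus>\<^bsub>N\<^esub> h x = \<zero>\<^bsub>N\<^esub>"
    using assms mod_hom_add[OF assms(3), of "\<ominus>\<^bsub>M\<^esub> x" x] mod_hom_zero[OF assms(1-3)]
    by (simp add: M.l_neg)
  thus ?thesis using c N.minus_equality by metis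
qed

lemma mod_hom_minus:
  assumes "module R M" "module R N" "h \<in> mod_hom R M N" "x \<in> carrier M" "y \<in> carrier M"
  shows "h (x \<ominus>\<^bsub>M\<^esub> y) = h x \<ominus>\<^bsub>N\<^esub> h y"
proof -
  interpret M: module R M by fact
  show ?thesis
    using assms by (simp add: a_minus_def mod_hom_add mod_hom_uminus)
qed

section \<open>Quotient modules and spans of submodules\<close>

lemma abelian_subgroup_of_submodule:
  assumes "module R M" "submodule H R M"
  shows "abelian_subgroup H M"
proof -
  interpret module R M by fact
  interpret submodule H R M by fact
  have sub: "subgroup H (add_monoid M)" by unfold_locales
  show ?thesis by (rule abelian_subgroupI3) (auto simp: additive_subgroup_def sub abelian_group_axioms)
qed

text \<open>Two representatives differ by an element of \<open>H\<close>, and \<open>H\<close>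
  absorbs its multiples; so all cosets in the union coincide and the union is a single
  coset.\<close>

lemma (in module) smult_Un_coset:
  assumes H: "submodule H R M" and r: "r \<in> carrier R" and x: "x \<in> carrier M"
  shows "(\<Union>y\<in>H +>\<^bsub>M\<^esub> x. H +>\<^bsub>M\<^esub> (r \<odot>\<^bsub>M\<^esub> y)) = H +>\<^bsub>M\<^esub> (r \<odot>\<^bsub>M\<^esub> x)"
proof -
  interpret submodule H R M by fact
  have sub: "subgroup H (add_monoid M)" by unfold_locales
  have HM: "H \<subseteq> carrier M" using submoduleE[OF H] by simp
  have "H +>\<^bsub>M\<^esub> (r \<odot>\<^bsub>M\<^esub> y) = H +>\<^bsub>M\<^esub> (r \<odot>\<^bsub>M\<^esub> x)" if y: "y \<in> H +>\<^bsub>M\<^esub> x" for y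
  proof -
    obtain h where h: "h \<in> H" "y = h \<oplus>\<^bsub>M\<^esub> x" using y by (auto simp: a_r_coset_def')
    have hc: "h \<in> carrier M" "r \<odot>\<^bsub>M\<^esub> h \<in> H" using h HM r submoduleE(4)[OF H] by auto
    have "r \<odot>\<^bsub>M\<^esub> y = r \<odot>\<^bsub>M\<^esub> h \<oplus>\<^bsub>M\<^esub> r \<odot>\<^bsub>M\<^esub> x" using h hc r x by (simp add: smult_r_distr)
    hence "r \<odot>\<^bsub>M\<^esub> y \<in> H +>\<^bsub>M\<^esub> (r \<odot>\<^bsub>M\<^esub> x)" using hc by (auto simp: a_r_coset_def')
    thus ?thesis using a_repr_independence[OF _ _ sub, of "r \<odot>\<^bsub>M\<^esub> y" "r \<odot>\<^bsub>M\<^esub> x"] r x by simp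
  qed
  moreover have "x \<in> H +>\<^bsub>M\<^esub> x"
    using abelian_subgroup.a_rcos_self[OF abelian_subgroup_of_submodule[OF module_axioms H] x] .
  ultimately show ?thesis by blast
qed

lemma quot_mod_sel:
  "carrier (quot_mod M H) = a_rcosets\<^bsub>M\<^esub> H" "zero (quot_mod M H) = H"
  "add (quot_mod M H) = set_add M"
  "smult (quot_mod M H) = (\<lambda>r C. \<Union>x\<in>C. H +>\<^bsub>M\<^esub> (r \<odot>\<^bsub>M\<^esub> x))"
  by (simp_all add: quot_mod_def)

lemma quot_mod_carrier: "C \<in> carrier (quot_mod M H) \<longleftrightarrow> (\<exists>x\<in>carrier M. C = H +>\<^bsub>M\<^esub> x)"
  by (auto simp: quot_mod_sel A_RCOSETS_def')

lemma quot_mod_smult: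
  assumes "module R M" "submodule H R M" "r \<in> carrier R" "x \<in> carrier M"
  shows "r \<odot>\<^bsub>quot_mod M H\<^esub> (H +>\<^bsub>M\<^esub> x) = H +>\<^bsub>M\<^esub> (r \<odot>\<^bsub>M\<^esub> x)"
  using module.smult_Un_coset[OF assms] by (simp add: quot_mod_sel(4))

lemma quot_mod_module:
  assumes M: "module R M" and H: "submodule H R M"
  shows "module R (quot_mod M H)"
proof -
  interpret M: module R M by fact
  interpret abelian_subgroup H M using abelian_subgroup_of_submodule[OF M H] .
  have add: "(H +>\<^bsub>M\<^esub> x) <+>\<^bsub>M\<^esub> (H +>\<^bsub>M\<^esub> y) = H +>\<^bsub>M\<^esub> (x \<oplus>\<^bsub>M\<^esub> y)"
    if "x \<in> carrier M" "y \<in> carrier M" for x y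
    using that a_rcos_sum by simp
  have H0: "H = H +>\<^bsub>M\<^esub> \<zero>\<^bsub>M\<^esub>" using a_subset by simp
  have ab: "abelian_group (quot_mod M H)"
  proof (rule abelian_groupI)
    show "\<zero>\<^bsub>quot_mod M H\<^esub> \<in> carrier (quot_mod M H)"
      using H0 by (auto simp: quot_mod_carrier quot_mod_sel(2))
  next
    fix X assume "X \<in> carrier (quot_mod M H)"
    then obtain x where x: "x \<in> carrier M" "X = H +>\<^bsub>M\<^esub> x" by (auto simp: quot_mod_carrier)
    show "\<zero>\<^bsub>quot_mod M H\<^esub> \<oplus>\<^bsub>quot_mod M H\<^esub> X = X"
      using x add[of "\<zero>\<^bsub>M\<^esub>" x] H0 by (simp add: quot_mod_sel)
    show "\<exists>Y\<in>carrier (quot_mod M H). Y \<oplus>\<^bsub>quot_mod M H\<^esub> X = \<zero>\<^bsub>quot_mod M H\<^esub>"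
      by (rule bexI[of _ "H +>\<^bsub>M\<^esub> (\<ominus>\<^bsub>M\<^esub> x)"])
        (use x add[of "\<ominus>\<^bsub>M\<^esub> x" x] H0 M.l_neg[of x] in
          \<open>auto simp: quot_mod_sel(2,3) quot_mod_carrier\<close>)
  qed (auto simp: quot_mod_carrier quot_mod_sel(2-) add M.add.m_ac)
  show ?thesis
    by (rule moduleI[OF M.is_cring ab])
      (auto simp: quot_mod_carrier quot_mod_smult[OF M H] quot_mod_sel(3) add M.smult_l_distr
         M.smult_r_distr M.smult_assoc1)
qed

lemma quot_mod_proj:
  assumes M: "module R M" and H: "submodule H R M"
  shows "(\<lambda>x. H +>\<^bsub>M\<^esub> x) \<in> mod_hom R M (quot_mod M H)"
proof -
  interpret M: module R M by fact
  interpret abelian_subgroup H M using abelian_subgroup_of_submodule[OF M H] .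
  show ?thesis
    by (rule mod_homI) (auto simp: quot_mod_carrier quot_mod_smult[OF M H] quot_mod_sel(3) a_rcos_sum)
qed

text \<open>This is all that is known about the representative picked by \<open>SOME\<close>: it
  differs from \<open>x\<close> by an element of \<open>H\<close>. The evaluation of
  \<open>tens_lift\<close> rests on it.\<close>

lemma quot_mod_rep:
  assumes M: "module R M" and H: "submodule H R M" and x: "x \<in> carrier M"
  shows "(SOME y. y \<in> H +>\<^bsub>M\<^esub> x) \<in> carrier M" "\<exists>h\<in>H. (SOME y. y \<in> H +>\<^bsub>M\<^esub> x) = h \<oplus>\<^bsub>M\<^esub> x"
proof -
  interpret M: module R M by fact
  interpret abelian_subgroup H M using abelian_subgroup_of_submodule[OF M H] .
  have "(SOME y. y \<in> H +>\<^bsub>M\<^esub> x) \<in> H +>\<^bsub>M\<^esub> x" using a_rcos_self[OF x] by (rule someI)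
  thus "\<exists>h\<in>H. (SOME y. y \<in> H +>\<^bsub>M\<^esub> x) = h \<oplus>\<^bsub>M\<^esub> x" by (auto simp: a_r_coset_def')
  thus "(SOME y. y \<in> H +>\<^bsub>M\<^esub> x) \<in> carrier M" using x a_subset by auto
qed

lemma submod_span_submodule:
  assumes M: "module R M" and G: "G \<subseteq> carrier M"
  shows "submodule (submod_span R M G) R M"
proof -
  interpret M: module R M by fact
  show ?thesis
  proof (rule M.submoduleI)
    show "submod_span R M G \<subseteq> carrier M"
      using M.carrier_is_submodule G by (auto simp: submod_span_def)
    show "\<zero>\<^bsub>M\<^esub> \<in> submod_span R M G"
      using subgroup.one_closed[OF submodule.axioms(1)] by (fastforce simp: submod_span_def)
  qed (auto simp: submod_span_def M.submoduleE)
qed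

text \<open>The kernel of \<open>h\<close> is a submodule, so it contains the span of whatever
  generators it contains.\<close>

lemma submod_span_kernel:
  assumes M: "module R M" and N: "module R N" and h: "h \<in> mod_hom R M N"
    and G: "\<And>x. x \<in> G \<Longrightarrow> x \<in> carrier M \<and> h x = \<zero>\<^bsub>N\<^esub>" and x: "x \<in> submod_span R M G"
  shows "h x = \<zero>\<^bsub>N\<^esub>"
proof -
  interpret M: module R M by fact
  interpret N: module R N by fact
  have "submodule {x \<in> carrier M. h x = \<zero>\<^bsub>N\<^esub>} R M"
    by (rule M.submoduleI)
      (auto simp: mod_hom_zero[OF M N h] mod_hom_uminus[OF M N h] mod_hom_add[OF h] mod_hom_smult[OF h])
  thus ?thesis using x G by (auto simp: submod_span_def)
qed

section \<open>Free modules and linear extension\<close>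

lemma free_mod_sel:
  "carrier (free_mod R A) =
    {f. (\<forall>x. f x \<in> carrier R) \<and> (\<forall>x. x \<notin> A \<longrightarrow> f x = \<zero>\<^bsub>R\<^esub>) \<and> finite {x. f x \<noteq> \<zero>\<^bsub>R\<^esub>}}"
  "zero (free_mod R A) = (\<lambda>x. \<zero>\<^bsub>R\<^esub>)"
  "add (free_mod R A) = (\<lambda>f g x. f x \<oplus>\<^bsub>R\<^esub> g x)"
  "smult (free_mod R A) = (\<lambda>r f x. r \<otimes>\<^bsub>R\<^esub> f x)"
  by (simp_all add: free_mod_def)

context cring
begin

lemma free_mod_add_closed:
  assumes "f \<in> carrier (free_mod R A)" "g \<in> carrier (free_mod R A)"
  shows "f \<oplus>\<^bsub>free_mod R A\<^esub> g \<in> carrier (free_mod R A)"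
proof -
  have "{x. f x \<oplus> g x \<noteq> \<zero>} \<subseteq> {x. f x \<noteq> \<zero>} \<union> {x. g x \<noteq> \<zero>}" by auto
  hence "finite {x. f x \<oplus> g x \<noteq> \<zero>}"
    by (rule finite_subset) (use assms in \<open>simp add: free_mod_sel\<close>)
  thus ?thesis using assms by (simp add: free_mod_sel)
qed

lemma free_mod_smult_closed:
  assumes "f \<in> carrier (free_mod R A)" "r \<in> carrier R"
  shows "r \<odot>\<^bsub>free_mod R A\<^esub> f \<in> carrier (free_mod R A)"
proof -
  have "{x. r \<otimes> f x \<noteq> \<zero>} \<subseteq> {x. f x \<noteq> \<zero>}" using assms by auto
  hence "finite {x. r \<otimes> f x \<noteq> \<zero>}"
    by (rule finite_subset) (use assms in \<open>simp add: free_mod_sel\<close>)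
  thus ?thesis using assms by (simp add: free_mod_sel)
qed

lemma free_mod_module: "module R (free_mod R A)"
proof -
  have neg: "\<exists>y\<in>carrier (free_mod R A). y \<oplus>\<^bsub>free_mod R A\<^esub> f = \<zero>\<^bsub>free_mod R A\<^esub>"
    if f: "f \<in> carrier (free_mod R A)" for f
    \<comment> \<open>Taking the negative as a scalar multiple gives finiteness of its support from
      \<open>free_mod_smult_closed\<close>.\<close>
    by (rule bexI[of _ "(\<ominus> \<one>) \<odot>\<^bsub>free_mod R A\<^esub> f"])
      (use f in \<open>auto simp: free_mod_smult_closed, auto simp: free_mod_sel l_minus l_neg\<close>)
  have z: "\<zero>\<^bsub>free_mod R A\<^esub> \<in> carrier (free_mod R A)" by (simp add: free_mod_sel)
  have ab: "abelian_group (free_mod R A)"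
    by (rule abelian_groupI)
      (use z in \<open>auto simp: free_mod_add_closed intro: neg, auto simp: free_mod_sel a_ac\<close>)
  show ?thesis
    by (rule moduleI[OF is_cring ab])
      (auto simp: free_mod_smult_closed, auto simp: free_mod_sel l_distr r_distr m_assoc)
qed

lemma single_closed: "x \<in> A \<Longrightarrow> single R x \<in> carrier (free_mod R A)"
  by (auto simp: free_mod_sel single_def)

text \<open>Induction on the finite support: one nonzero coefficient is split off, and what remains
  has strictly smaller support.\<close>

lemma free_mod_induct [consumes 1, case_names zero add]:
  assumes f: "f \<in> carrier (free_mod R A)"
    and z: "P \<zero>\<^bsub>free_mod R A\<^esub>"
    and s: "\<And>x r f. x \<in> A \<Longrightarrow> r \<in> carrier R \<Longrightarrow> f \<in> carrier (free_mod R A) \<Longrightarrow> P f \<Longrightarrow>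
      P (r \<odot>\<^bsub>free_mod R A\<^esub> single R x \<oplus>\<^bsub>free_mod R A\<^esub> f)"
  shows "P f"
proof -
  have "finite {x. f x \<noteq> \<zero>}" using f by (simp add: free_mod_sel)
  thus ?thesis using f
  proof (induction "{x. f x \<noteq> \<zero>}" arbitrary: f rule: finite_psubset_induct)
    case (psubset f)
    show ?case
    proof (cases "{x. f x \<noteq> \<zero>} = {}")
      case True
      hence "f = \<zero>\<^bsub>free_mod R A\<^esub>" by (auto simp: free_mod_sel)
      thus ?thesis using z by simp
    next
      case False
      then obtain x where x: "f x \<noteq> \<zero>" by auto
      let ?g = "f(x := \<zero>)"
      have sup: "{y. ?g y \<noteq> \<zero>} = {y. f y \<noteq> \<zero>} - {x}" by auto
      have g: "?g \<in> carrier (free_mod R A)"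
        using psubset.prems psubset.hyps sup by (auto simp: free_mod_sel)
      have xA: "x \<in> A" and fx: "f x \<in> carrier R" using x psubset.prems by (auto simp: free_mod_sel)
      have "{y. ?g y \<noteq> \<zero>} \<subset> {y. f y \<noteq> \<zero>}" unfolding sup using x by auto
      hence "P ?g" using psubset.hyps(2)[of ?g] g by blast
      moreover have "f = f x \<odot>\<^bsub>free_mod R A\<^esub> single R x \<oplus>\<^bsub>free_mod R A\<^esub> ?g"
        using psubset.prems by (auto simp: free_mod_sel single_def)
      ultimately show ?thesis using s[OF xA fx g] by metis
    qed
  qed
qed

lemma free_hom_eqI:
  assumes N: "module R N" and h: "h \<in> mod_hom R (free_mod R A) N" "h' \<in> mod_hom R (free_mod R A) N"
    and eq: "\<And>x. x \<in> A \<Longrightarrow> h (single R x) = h' (single R x)" and f: "f \<in> carrier (free_mod R A)"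
  shows "h f = h' f"
  using f
proof (induction rule: free_mod_induct)
  case zero
  show ?case using mod_hom_zero[OF free_mod_module N] h by metis
next
  case (add x r f)
  show ?case
    using add h by (simp add: mod_hom_add mod_hom_smult eq free_mod_smult_closed single_closed)
qed

text \<open>The support changes under addition and scaling. Summing over any finite superset
  \<open>B\<close> puts the sums for different \<open>f\<close> on a common index set, which makes
  additivity a termwise matter.\<close>

lemma free_lift_eq:
  assumes N: "module R N" and f: "f \<in> carrier (free_mod R A)" and B: "finite B" "B \<subseteq> A" "{x. f x \<noteq> \<zero>} \<subseteq> B"
    and g: "\<And>x. x \<in> A \<Longrightarrow> g x \<in> carrier N"
  shows "free_lift R N g f = (\<Oplus>\<^bsub>N\<^esub> x \<in> B. f x \<odot>\<^bsub>N\<^esub> g x)"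
proof -
  interpret N: module R N by fact
  have fc: "f x \<in> carrier R" for x using f by (simp add: free_mod_sel)
  show ?thesis unfolding free_lift_def
    by (rule N.add.finprod_mono_neutral_cong_left) (use B g fc in \<open>auto simp: subset_iff\<close>)
qed

lemma free_mod_supp: "f \<in> carrier (free_mod R A) \<Longrightarrow> finite {x. f x \<noteq> \<zero>} \<and> {x. f x \<noteq> \<zero>} \<subseteq> A"
  by (auto simp: free_mod_sel)

lemma free_lift_hom:
  assumes N: "module R N" and g: "\<And>x. x \<in> A \<Longrightarrow> g x \<in> carrier N"
  shows "free_lift R N g \<in> mod_hom R (free_mod R A) N"
proof -
  interpret N: module R N by fact
  have fl: "free_lift R N g f = (\<Oplus>\<^bsub>N\<^esub> x \<in> B. f x \<odot>\<^bsub>N\<^esub> g x)"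
    if "f \<in> carrier (free_mod R A)" "finite B" "B \<subseteq> A" "{x. f x \<noteq> \<zero>} \<subseteq> B" for f B
    using free_lift_eq[OF N that g] .
  have fc: "\<And>f x. f \<in> carrier (free_mod R A) \<Longrightarrow> f x \<in> carrier R" by (simp add: free_mod_sel)
  show ?thesis
  proof (rule mod_homI)
    fix f assume f: "f \<in> carrier (free_mod R A)"
    show "free_lift R N g f \<in> carrier N" unfolding free_lift_def
      by (rule N.finsum_closed) (use f free_mod_supp[OF f] fc g in auto)
  next
    fix f f' assume f: "f \<in> carrier (free_mod R A)" "f' \<in> carrier (free_mod R A)"
    let ?B = "{x. f x \<noteq> \<zero>} \<union> {x. f' x \<noteq> \<zero>}"
    have B: "finite ?B" "?B \<subseteq> A" using f free_mod_supp by auto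
    have gB: "x \<in> ?B \<Longrightarrow> g x \<in> carrier N" for x using B g by blast
    have "free_lift R N g (f \<oplus>\<^bsub>free_mod R A\<^esub> f') =
      (\<Oplus>\<^bsub>N\<^esub> x \<in> ?B. f x \<odot>\<^bsub>N\<^esub> g x \<oplus>\<^bsub>N\<^esub> f' x \<odot>\<^bsub>N\<^esub> g x)"
      apply (subst fl[OF free_mod_add_closed[OF f] B])
      subgoal by (auto simp: free_mod_sel)
      apply (rule N.finsum_cong')
      using gB fc f by (auto simp: free_mod_sel N.smult_l_distr)
    also have "\<dots> = free_lift R N g f \<oplus>\<^bsub>N\<^esub> free_lift R N g f'"
      apply (subst fl[OF f(1) B], force)
      apply (subst fl[OF f(2) B], force)
      apply (rule N.finsum_addf)
      using gB fc f by auto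
    finally show "free_lift R N g (f \<oplus>\<^bsub>free_mod R A\<^esub> f') = free_lift R N g f \<oplus>\<^bsub>N\<^esub> free_lift R N g f'" .
  next
    fix r f assume r: "r \<in> carrier R" and f: "f \<in> carrier (free_mod R A)"
    let ?B = "{x. f x \<noteq> \<zero>}"
    have B: "finite ?B" "?B \<subseteq> A" using f free_mod_supp by auto
    have gB: "x \<in> ?B \<Longrightarrow> g x \<in> carrier N" for x using B g by blast
    have "free_lift R N g (r \<odot>\<^bsub>free_mod R A\<^esub> f) = (\<Oplus>\<^bsub>N\<^esub> x \<in> ?B. r \<odot>\<^bsub>N\<^esub> (f x \<odot>\<^bsub>N\<^esub> g x))"
      apply (subst fl[OF free_mod_smult_closed[OF f r] B])
      subgoal using r by (auto simp: free_mod_sel)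
      apply (rule N.finsum_cong')
      using gB fc f r by (auto simp: free_mod_sel N.smult_assoc1)
    also have "\<dots> = r \<odot>\<^bsub>N\<^esub> free_lift R N g f"
      unfolding free_lift_def
      apply (rule N.finsum_smult_ldistr[symmetric])
      using B r gB fc f by auto
    finally show "free_lift R N g (r \<odot>\<^bsub>free_mod R A\<^esub> f) = r \<odot>\<^bsub>N\<^esub> free_lift R N g f" .
  qed
qed

lemma free_lift_single:
  assumes N: "module R N" and g: "g x \<in> carrier N"
  shows "free_lift R N g (single R x) = g x"
proof -
  interpret N: module R N by fact
  \<comment> \<open>Summing over \<open>{x}\<close> rather than over the support also covers the
    zero ring, where \<open>single R x\<close> has empty support.\<close>
  have "free_lift R N g (single R x) = (\<Oplus>\<^bsub>N\<^esub> y \<in> {x}. single R x y \<odot>\<^bsub>N\<^esub> g y)"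
    by (rule free_lift_eq[OF N single_closed, of x "{x}"]) (use g in \<open>auto simp: single_def\<close>)
  also have "\<dots> = g x" using g by (simp add: single_def)
  finally show ?thesis .
qed

text \<open>Here the coefficients \<open>f\<close> are fixed and the values depend linearly on a
  parameter. Scalars of the parameter have to move past the coefficients, so commutativity of the
  ring enters, as \<open>cm\<close>.\<close>

lemma free_lift_hom_param:
  assumes M: "module R M" and N: "module R N" and f: "f \<in> carrier (free_mod R A)"
    and G: "\<And>q. q \<in> A \<Longrightarrow> (\<lambda>x. G x q) \<in> mod_hom R M N"
  shows "(\<lambda>x. free_lift R N (G x) f) \<in> mod_hom R M N"
  using f
proof (induction rule: free_mod_induct)
  interpret M: module R M by fact
  interpret N: module R N by fact
  have hom: "x \<in> carrier M \<Longrightarrow> free_lift R N (G x) \<in> mod_hom R (free_mod R A) N" for x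
    by (rule free_lift_hom[OF N]) (rule mod_hom_closed[OF G])
  {
    case zero
    show ?case
      by (rule mod_homI) (auto simp: mod_hom_zero[OF free_mod_module N hom])
  next
    case (add q r f)
    have Gc: "x \<in> carrier M \<Longrightarrow> G x q \<in> carrier N" for x by (rule mod_hom_closed[OF G[OF add(1)]])
    have fs: "x \<in> carrier M \<Longrightarrow> free_lift R N (G x) (single R q) = G x q" for x
      using free_lift_single[OF N, of "G x" q] Gc by simp
    have e: "x \<in> carrier M \<Longrightarrow> free_lift R N (G x) (r \<odot>\<^bsub>free_mod R A\<^esub> single R q \<oplus>\<^bsub>free_mod R A\<^esub> f)
      = r \<odot>\<^bsub>N\<^esub> G x q \<oplus>\<^bsub>N\<^esub> free_lift R N (G x) f" for x
      using add by (simp add: mod_hom_add[OF hom] mod_hom_smult[OF hom] free_mod_smult_closed single_closed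
        fs)
    have fc: "x \<in> carrier M \<Longrightarrow> free_lift R N (G x) f \<in> carrier N" for x
      by (rule mod_hom_closed[OF add.IH])
    have cm: "r \<otimes> s = s \<otimes> r" if "s \<in> carrier R" for s using add that by (simp add: m_comm)
    show ?case
    proof (rule mod_homI)
      fix s x assume s: "s \<in> carrier R" "x \<in> carrier M"
      thus "free_lift R N (G (s \<odot>\<^bsub>M\<^esub> x)) (r \<odot>\<^bsub>free_mod R A\<^esub> single R q \<oplus>\<^bsub>free_mod R A\<^esub> f) =
           s \<odot>\<^bsub>N\<^esub> free_lift R N (G x) (r \<odot>\<^bsub>free_mod R A\<^esub> single R q \<oplus>\<^bsub>free_mod R A\<^esub> f)"
        using add Gc fc mod_hom_smult[OF G[OF add(1)] s] mod_hom_smult[OF add.IH s]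
        by (simp add: e N.smult_r_distr N.smult_assoc1[symmetric] cm)
    qed (use add Gc fc in \<open>auto simp: e mod_hom_add[OF G[OF add(1)]] mod_hom_add[OF add.IH]
          N.smult_r_distr N.add.m_ac\<close>)
  }
qed

end


section \<open>Tensor products of quivers\<close>

lemma qpaths_append:
  "p \<in> qpaths S Ps a c \<Longrightarrow> q \<in> qpaths S Qs c b \<Longrightarrow> p @ q \<in> qpaths S (Ps @ Qs) a b"
  by (induction Ps arbitrary: a p) (auto split: if_splits)

lemma qpaths_ConsI:
  "x \<in> carrier (Q a c) \<Longrightarrow> c \<in> S \<Longrightarrow> p \<in> qpaths S Qs c b \<Longrightarrow> (x, c) # p \<in> qpaths S (Q # Qs) a b"
  by auto

context cring
begin

section \<open>Multilinear maps and the universal property of the tensor product\<close>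

definition qmods :: "'s set \<Rightarrow> ('s, 'a, 'm) quiver list \<Rightarrow> bool" where
  "qmods S Qs \<longleftrightarrow> (\<forall>Q\<in>set Qs. \<forall>a\<in>S. \<forall>b\<in>S. module R (Q a b))"

lemma qmods_simps [simp]:
  "qmods S []" "qmods S (Q # Qs) \<longleftrightarrow> (\<forall>a\<in>S. \<forall>b\<in>S. module R (Q a b)) \<and> qmods S Qs"
  "qmods S (Qs @ Qs') \<longleftrightarrow> qmods S Qs \<and> qmods S Qs'"
  by (auto simp: qmods_def)

text \<open>The recursion follows that of \<open>qpaths\<close>, since the modules of the later
  slots depend on the vertices chosen before. Linearity in an arbitrary slot is recovered by
  \<open>multilin_append\<close>.\<close>

fun multilin ::
    "'s set \<Rightarrow> ('a, 'n) module \<Rightarrow> ('s, 'a, 'm) quiver list \<Rightarrow> 's \<Rightarrow> 's \<Rightarrow>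
     (('m \<times> 's) list \<Rightarrow> 'n) \<Rightarrow> bool" where
  "multilin S N [] a b g \<longleftrightarrow> (a = b \<longrightarrow> g [] \<in> carrier N)"
| "multilin S N (Q # Qs) a b g \<longleftrightarrow> (\<forall>c\<in>S.
     (\<forall>x\<in>carrier (Q a c). multilin S N Qs c b (\<lambda>p. g ((x, c) # p))) \<and>
     (\<forall>p\<in>qpaths S Qs c b. (\<lambda>x. g ((x, c) # p)) \<in> mod_hom R (Q a c) N))"

lemma multilin_closed: "multilin S N Qs a b g \<Longrightarrow> p \<in> qpaths S Qs a b \<Longrightarrow> g p \<in> carrier N"
proof (induction Qs arbitrary: a g p)
  case Nil
  thus ?case by (auto split: if_splits)
next
  case (Cons Q Qs)
  from Cons.prems(2) obtain x c p' where p: "p = (x, c) # p'" "c \<in> S" "x \<in> carrier (Q a c)"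
    "p' \<in> qpaths S Qs c b" by auto
  hence "multilin S N Qs c b (\<lambda>p. g ((x, c) # p))" using Cons.prems(1) by simp
  from Cons.IH[OF this p(4)] show ?case using p by simp
qed

lemma multilin_append:
  "multilin S N (Ps @ Qs) a b g \<Longrightarrow> p \<in> qpaths S Ps a c \<Longrightarrow> multilin S N Qs c b (\<lambda>q. g (p @ q))"
proof (induction Ps arbitrary: a g p)
  case Nil
  thus ?case by (auto split: if_splits)
next
  case (Cons P Ps)
  from Cons.prems(2) obtain x d p' where p: "p = (x, d) # p'" "d \<in> S" "x \<in> carrier (P a d)"
    "p' \<in> qpaths S Ps d c" by auto
  hence "multilin S N (Ps @ Qs) d b (\<lambda>p. g ((x, d) # p))" using Cons.prems(1) by simp
  from Cons.IH[OF this p(4)] show ?case using p by simp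
qed

lemma multilin_comp:
  assumes "multilin S N Qs a b g" "h \<in> mod_hom R N N'"
  shows "multilin S N' Qs a b (\<lambda>p. h (g p))"
  using assms(1)
proof (induction Qs arbitrary: a g)
  case Nil
  thus ?case using mod_hom_closed[OF assms(2)] by simp
next
  case (Cons Q Qs)
  thus ?case by (simp add: mod_hom_comp[OF _ assms(2), of "\<lambda>x. g ((x, _) # _)"])
qed

lemma multilin_free_lift:
  assumes N: "module R N" and f: "f \<in> carrier (free_mod R A)"
    and Q: "qmods S Qs" "a \<in> S"
    and G: "\<And>x. x \<in> A \<Longrightarrow> multilin S N Qs a b (G x)"
  shows "multilin S N Qs a b (\<lambda>p. free_lift R N (\<lambda>x. G x p) f)"
  using Q G
proof (induction Qs arbitrary: a G)
  case Nil
  have "free_lift R N (\<lambda>x. G x []) f \<in> carrier N" if "a = b"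
    by (rule mod_hom_closed[OF free_lift_hom[OF N] f]) (use Nil that in auto)
  thus ?case by simp
next
  case (Cons Q Qs)
  show ?case unfolding multilin.simps
  proof (intro ballI conjI)
    fix c x assume c: "c \<in> S" "x \<in> carrier (Q a c)"
    show "multilin S N Qs c b (\<lambda>p. free_lift R N (\<lambda>y. G y ((x, c) # p)) f)"
      by (rule Cons.IH) (use Cons.prems c in auto)
  next
    fix c p assume c: "c \<in> S" "p \<in> qpaths S Qs c b"
    show "(\<lambda>x. free_lift R N (\<lambda>y. G y ((x, c) # p)) f) \<in> mod_hom R (Q a c) N"
      by (rule free_lift_hom_param[OF _ N f]) (use Cons.prems c in auto)
  qed
qed

lemma tens_relatorsE:
  assumes "r \<in> tens_relators R S Qs a b"
  obtains (add) Ps Q Rs c d p q x y where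
    "r = single R (p @ (x \<oplus>\<^bsub>Q c d\<^esub> y, d) # q) \<ominus>\<^bsub>free_mod R (qpaths S Qs a b)\<^esub>
      (single R (p @ (x, d) # q) \<oplus>\<^bsub>free_mod R (qpaths S Qs a b)\<^esub> single R (p @ (y, d) # q))"
    "Qs = Ps @ Q # Rs" "c \<in> S" "d \<in> S" "p \<in> qpaths S Ps a c" "q \<in> qpaths S Rs d b"
    "x \<in> carrier (Q c d)" "y \<in> carrier (Q c d)"
  | (smult) Ps Q Rs c d p q s x where
    "r = single R (p @ (s \<odot>\<^bsub>Q c d\<^esub> x, d) # q) \<ominus>\<^bsub>free_mod R (qpaths S Qs a b)\<^esub>
      (s \<odot>\<^bsub>free_mod R (qpaths S Qs a b)\<^esub> single R (p @ (x, d) # q))"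
    "Qs = Ps @ Q # Rs" "c \<in> S" "d \<in> S" "p \<in> qpaths S Ps a c" "q \<in> qpaths S Rs d b"
    "s \<in> carrier R" "x \<in> carrier (Q c d)"
  using assms unfolding tens_relators_def Let_def Un_iff mem_Collect_eq by (elim disjE exE conjE) metis+

lemma qpaths_middle:
  "p \<in> qpaths S Ps a c \<Longrightarrow> q \<in> qpaths S Rs d b \<Longrightarrow> x \<in> carrier (Q c d) \<Longrightarrow> d \<in> S \<Longrightarrow>
    p @ (x, d) # q \<in> qpaths S (Ps @ Q # Rs) a b"
  by (rule qpaths_append[OF _ qpaths_ConsI])

lemma tens_relators_closed:
  assumes "qmods S Qs" and r: "r \<in> tens_relators R S Qs a b"
  shows "r \<in> carrier (free_mod R (qpaths S Qs a b))"
proof -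
  interpret F: module R "free_mod R (qpaths S Qs a b)" by (rule free_mod_module)
  from r show ?thesis
  proof (cases rule: tens_relatorsE)
    case (add Ps Q Rs c d p q x y)
    interpret Q: module R "Q c d" using assms(1) add by simp
    show ?thesis unfolding add(1)
      by (intro F.minus_closed F.add.m_closed single_closed, unfold add(2))
        (auto intro!: qpaths_middle add Q.add.m_closed)
  next
    case (smult Ps Q Rs c d p q s x)
    interpret Q: module R "Q c d" using assms(1) smult by simp
    show ?thesis unfolding smult(1)
      by (intro F.minus_closed F.smult_closed single_closed, unfold smult(2))
        (auto intro!: qpaths_middle smult Q.smult_closed)
  qed
qed

text \<open>Cutting the path just before the slot of the relation reduces the claim to linearity in
  a first slot.\<close>

lemma tens_relators_kernel:
  assumes Qs: "qmods S Qs" and N: "module R N" and g: "multilin S N Qs a b g"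
    and r: "r \<in> tens_relators R S Qs a b"
  shows "free_lift R N g r = \<zero>\<^bsub>N\<^esub>"
proof -
  let ?F = "free_mod R (qpaths S Qs a b)"
  interpret F: module R ?F by (rule free_mod_module)
  interpret N: module R N by fact
  have hom: "free_lift R N g \<in> mod_hom R ?F N"
    by (rule free_lift_hom[OF N multilin_closed[OF g]])
  have sg: "free_lift R N g (single R w) = g w" "g w \<in> carrier N" "single R w \<in> carrier ?F"
    if "w \<in> qpaths S Qs a b" for w
    using free_lift_single[of N g w, OF N multilin_closed[OF g that]] multilin_closed[OF g that]
      single_closed[OF that] by simp_all
  note mh = mod_hom_minus[OF F.module_axioms N hom] mod_hom_add[OF hom] mod_hom_smult[OF hom]
  from r show ?thesis
  proof (cases rule: tens_relatorsE)
    case (add Ps Q Rs c d p q x y)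
    interpret Q: module R "Q c d" using Qs add by simp
    have lin: "(\<lambda>x. g (p @ (x, d) # q)) \<in> mod_hom R (Q c d) N"
      using multilin_append[OF g[unfolded add(2)] add(5)] add by simp
    have w: "p @ (z, d) # q \<in> qpaths S Qs a b" if "z \<in> carrier (Q c d)" for z
      unfolding add(2) by (rule qpaths_middle) (use add that in auto)
    have "free_lift R N g r = g (p @ (x \<oplus>\<^bsub>Q c d\<^esub> y, d) # q) \<ominus>\<^bsub>N\<^esub>
        (g (p @ (x, d) # q) \<oplus>\<^bsub>N\<^esub> g (p @ (y, d) # q))"
      unfolding add(1) using add(7,8) w by (simp add: mh sg)
    thus ?thesis
      using add(7,8) w by (simp add: mod_hom_add[OF lin] sg N.r_neg a_minus_def)
  next
    case (smult Ps Q Rs c d p q s x)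
    interpret Q: module R "Q c d" using Qs smult by simp
    have lin: "(\<lambda>x. g (p @ (x, d) # q)) \<in> mod_hom R (Q c d) N"
      using multilin_append[OF g[unfolded smult(2)] smult(5)] smult by simp
    have w: "p @ (z, d) # q \<in> qpaths S Qs a b" if "z \<in> carrier (Q c d)" for z
      unfolding smult(2) by (rule qpaths_middle) (use smult that in auto)
    have "free_lift R N g r = g (p @ (s \<odot>\<^bsub>Q c d\<^esub> x, d) # q) \<ominus>\<^bsub>N\<^esub> (s \<odot>\<^bsub>N\<^esub> g (p @ (x, d) # q))"
      unfolding smult(1) using smult(7,8) w by (simp add: mh sg)
    thus ?thesis
      using smult(7,8) w by (simp add: mod_hom_smult[OF lin] sg N.r_neg a_minus_def)
  qed
qed

lemma tens_rel_submodule: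
  "qmods S Qs \<Longrightarrow> submodule (tens_rel R S Qs a b) R (free_mod R (qpaths S Qs a b))"
  unfolding tens_rel_def
  by (rule submod_span_submodule[OF free_mod_module subsetI[OF tens_relators_closed]])

lemma qtensor_module: "qmods S Qs \<Longrightarrow> module R (qtensor R S Qs a b)"
  unfolding qtensor_def by (rule quot_mod_module[OF free_mod_module tens_rel_submodule])

lemma qtensor_proj:
  "qmods S Qs \<Longrightarrow> (\<lambda>f. tens_rel R S Qs a b +>\<^bsub>free_mod R (qpaths S Qs a b)\<^esub> f) \<in>
     mod_hom R (free_mod R (qpaths S Qs a b)) (qtensor R S Qs a b)"
  unfolding qtensor_def by (rule quot_mod_proj[OF free_mod_module tens_rel_submodule])

lemma qtensor_carrierE:
  assumes "C \<in> carrier (qtensor R S Qs a b)"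
  obtains f where "f \<in> carrier (free_mod R (qpaths S Qs a b))"
    "C = tens_rel R S Qs a b +>\<^bsub>free_mod R (qpaths S Qs a b)\<^esub> f"
  using assms unfolding qtensor_def quot_mod_carrier by blast

lemma qtensor_rep:
  assumes "qmods S Qs" "C \<in> carrier (qtensor R S Qs a b)"
  shows "(SOME f. f \<in> C) \<in> carrier (free_mod R (qpaths S Qs a b))"
proof -
  obtain f where f: "f \<in> carrier (free_mod R (qpaths S Qs a b))"
    "C = tens_rel R S Qs a b +>\<^bsub>free_mod R (qpaths S Qs a b)\<^esub> f"
    using qtensor_carrierE[OF assms(2)] .
  show ?thesis
    unfolding f(2) by (rule quot_mod_rep(1)[OF free_mod_module tens_rel_submodule[OF assms(1)] f(1)])
qed

text \<open>The chosen representative is \<open>f\<close> plus an element of the span of the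
  relators, and a multilinear \<open>g\<close> kills that span. This is the independence of the
  choice that the definition of \<open>tens_lift\<close> presupposes.\<close>

lemma tens_lift_coset:
  assumes Qs: "qmods S Qs" and N: "module R N" and g: "multilin S N Qs a b g"
    and f: "f \<in> carrier (free_mod R (qpaths S Qs a b))"
  shows "tens_lift R N g (tens_rel R S Qs a b +>\<^bsub>free_mod R (qpaths S Qs a b)\<^esub> f) = free_lift R N g f"
proof -
  let ?F = "free_mod R (qpaths S Qs a b)"
  let ?H = "tens_rel R S Qs a b"
  interpret F: module R ?F by (rule free_mod_module)
  interpret N: module R N by fact
  have hom: "free_lift R N g \<in> mod_hom R ?F N"
    by (rule free_lift_hom[OF N multilin_closed[OF g]])
  obtain h where h: "h \<in> ?H" "(SOME y. y \<in> ?H +>\<^bsub>?F\<^esub> f) = h \<oplus>\<^bsub>?F\<^esub> f"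
    using quot_mod_rep(2)[OF free_mod_module tens_rel_submodule[OF Qs] f] by blast
  have hc: "h \<in> carrier ?F" using h(1) F.submoduleE(1)[OF tens_rel_submodule[OF Qs]] by blast
  have "free_lift R N g h = \<zero>\<^bsub>N\<^esub>"
    by (rule submod_span_kernel[OF free_mod_module N hom _ h(1)[unfolded tens_rel_def]])
      (auto intro: tens_relators_closed[OF Qs] tens_relators_kernel[OF Qs N g])
  thus ?thesis
    using mod_hom_add[OF hom hc f] mod_hom_closed[OF hom f] by (simp add: tens_lift_def h(2))
qed

lemma tens_lift_hom:
  assumes Qs: "qmods S Qs" and N: "module R N" and g: "multilin S N Qs a b g"
  shows "tens_lift R N g \<in> mod_hom R (qtensor R S Qs a b) N"
proof -
  let ?F = "free_mod R (qpaths S Qs a b)"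
  interpret F: module R ?F by (rule free_mod_module)
  have hom: "free_lift R N g \<in> mod_hom R ?F N"
    by (rule free_lift_hom[OF N multilin_closed[OF g]])
  note pr = qtensor_proj[OF Qs, of a b]
  note tl = tens_lift_coset[OF Qs N g]
  show ?thesis
  proof (rule mod_homI)
    fix C assume C: "C \<in> carrier (qtensor R S Qs a b)"
    show "tens_lift R N g C \<in> carrier N"
      by (rule qtensor_carrierE[OF C]) (simp add: tl mod_hom_closed[OF hom])
  next
    fix C D assume C: "C \<in> carrier (qtensor R S Qs a b)" and D: "D \<in> carrier (qtensor R S Qs a b)"
    show "tens_lift R N g (C \<oplus>\<^bsub>qtensor R S Qs a b\<^esub> D) = tens_lift R N g C \<oplus>\<^bsub>N\<^esub> tens_lift R N g D"
      by (rule qtensor_carrierE[OF C], rule qtensor_carrierE[OF D])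
        (simp add: tl mod_hom_add[OF hom] mod_hom_add[OF pr, symmetric])
  next
    fix r C assume r: "r \<in> carrier R" and C: "C \<in> carrier (qtensor R S Qs a b)"
    show "tens_lift R N g (r \<odot>\<^bsub>qtensor R S Qs a b\<^esub> C) = r \<odot>\<^bsub>N\<^esub> tens_lift R N g C"
      by (rule qtensor_carrierE[OF C])
        (simp add: tl r mod_hom_smult[OF hom] mod_hom_smult[OF pr, symmetric])
  qed
qed

lemma tens_lift_pure:
  assumes "qmods S Qs" "module R N" "multilin S N Qs a b g" "p \<in> qpaths S Qs a b"
  shows "tens_lift R N g (pure R S Qs a b p) = g p"
  using tens_lift_coset[OF assms(1-3) single_closed[OF assms(4)]]
    free_lift_single[of N g p, OF assms(2) multilin_closed[OF assms(3,4)]]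
  by (simp add: pure_def)

lemma pure_closed:
  "qmods S Qs \<Longrightarrow> p \<in> qpaths S Qs a b \<Longrightarrow> pure R S Qs a b p \<in> carrier (qtensor R S Qs a b)"
  unfolding pure_def by (rule mod_hom_closed[OF qtensor_proj single_closed])

lemma qtensor_hom_eqI:
  assumes Qs: "qmods S Qs" and N: "module R N"
    and h: "h \<in> mod_hom R (qtensor R S Qs a b) N" "h' \<in> mod_hom R (qtensor R S Qs a b) N"
    and eq: "\<And>p. p \<in> qpaths S Qs a b \<Longrightarrow> h (pure R S Qs a b p) = h' (pure R S Qs a b p)"
    and C: "C \<in> carrier (qtensor R S Qs a b)"
  shows "h C = h' C"
proof (rule qtensor_carrierE[OF C])
  fix f assume f: "f \<in> carrier (free_mod R (qpaths S Qs a b))"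
    "C = tens_rel R S Qs a b +>\<^bsub>free_mod R (qpaths S Qs a b)\<^esub> f"
  show ?thesis unfolding f(2)
    by (rule free_hom_eqI[OF N mod_hom_comp[OF qtensor_proj[OF Qs] h(1)]
          mod_hom_comp[OF qtensor_proj[OF Qs] h(2)] _ f(1)])
      (use eq in \<open>simp add: pure_def\<close>)
qed

lemma pure_add:
  assumes Qs: "qmods S (Ps @ Q # Rs)" and cd: "c \<in> S" "d \<in> S"
    and pq: "p \<in> qpaths S Ps a c" "q \<in> qpaths S Rs d b" and x: "x \<in> carrier (Q c d)"
  shows "y \<in> carrier (Q c d) \<Longrightarrow> pure R S (Ps @ Q # Rs) a b (p @ (x \<oplus>\<^bsub>Q c d\<^esub> y, d) # q) =
      pure R S (Ps @ Q # Rs) a b (p @ (x, d) # q) \<oplus>\<^bsub>qtensor R S (Ps @ Q # Rs) a b\<^esub>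
      pure R S (Ps @ Q # Rs) a b (p @ (y, d) # q)" (is "_ \<Longrightarrow> ?add")
    and "s \<in> carrier R \<Longrightarrow> pure R S (Ps @ Q # Rs) a b (p @ (s \<odot>\<^bsub>Q c d\<^esub> x, d) # q) =
      s \<odot>\<^bsub>qtensor R S (Ps @ Q # Rs) a b\<^esub> pure R S (Ps @ Q # Rs) a b (p @ (x, d) # q)" (is "_ \<Longrightarrow> ?smult")
proof -
  let ?Qs = "Ps @ Q # Rs"
  let ?F = "free_mod R (qpaths S ?Qs a b)"
  let ?H = "tens_rel R S ?Qs a b"
  interpret F: module R ?F by (rule free_mod_module)
  interpret Q: module R "Q c d" using Qs cd by simp
  interpret H: abelian_subgroup ?H ?F
    by (rule abelian_subgroup_of_submodule[OF free_mod_module tens_rel_submodule[OF Qs]])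
  note pr = qtensor_proj[OF Qs, of a b]
  have w: "single R (p @ (z, d) # q) \<in> carrier ?F" if "z \<in> carrier (Q c d)" for z
    by (rule single_closed, rule qpaths_middle) (use pq cd that in auto)
  have key: "?H +>\<^bsub>?F\<^esub> u = ?H +>\<^bsub>?F\<^esub> v"
    if "u \<ominus>\<^bsub>?F\<^esub> v \<in> tens_relators R S ?Qs a b" "u \<in> carrier ?F" "v \<in> carrier ?F" for u v
  proof -
    have "u \<ominus>\<^bsub>?F\<^esub> v \<in> ?H" using that(1) by (auto simp: tens_rel_def submod_span_def)
    moreover have "u = (u \<ominus>\<^bsub>?F\<^esub> v) \<oplus>\<^bsub>?F\<^esub> v"
      using that by (simp add: a_minus_def F.add.m_assoc F.l_neg)
    ultimately have "u \<in> ?H +>\<^bsub>?F\<^esub> v" using F.a_rcosI H.a_subset that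
      by (metis F.a_rcosI)
    thus ?thesis using H.a_repr_independence' that by metis
  qed
  show ?add if y: "y \<in> carrier (Q c d)"
  proof -
    have "?H +>\<^bsub>?F\<^esub> single R (p @ (x \<oplus>\<^bsub>Q c d\<^esub> y, d) # q) =
      ?H +>\<^bsub>?F\<^esub> (single R (p @ (x, d) # q) \<oplus>\<^bsub>?F\<^esub> single R (p @ (y, d) # q))"
    proof (rule key)
      show "single R (p @ (x \<oplus>\<^bsub>Q c d\<^esub> y, d) # q) \<ominus>\<^bsub>?F\<^esub>
        (single R (p @ (x, d) # q) \<oplus>\<^bsub>?F\<^esub> single R (p @ (y, d) # q)) \<in> tens_relators R S ?Qs a b"
        unfolding tens_relators_def Let_def
        by (rule UnI1, unfold mem_Collect_eq, rule exI[of _ Ps], rule exI[of _ Q], rule exI[of _ Rs], rule exI[of _ c], rule exI[of _ d], rule exI[of _ p], rule exI[of _ q], rule exI[of _ x], rule exI[of _ y])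
            (use pq cd x y in auto)
    qed (use w x y in auto)
    thus ?thesis using mod_hom_add[OF pr w[OF x] w[OF y]] by (simp add: pure_def)
  qed
  show ?smult if s: "s \<in> carrier R"
  proof -
    have "?H +>\<^bsub>?F\<^esub> single R (p @ (s \<odot>\<^bsub>Q c d\<^esub> x, d) # q) =
      ?H +>\<^bsub>?F\<^esub> (s \<odot>\<^bsub>?F\<^esub> single R (p @ (x, d) # q))"
    proof (rule key)
      show "single R (p @ (s \<odot>\<^bsub>Q c d\<^esub> x, d) # q) \<ominus>\<^bsub>?F\<^esub>
        (s \<odot>\<^bsub>?F\<^esub> single R (p @ (x, d) # q)) \<in> tens_relators R S ?Qs a b"
        unfolding tens_relators_def Let_def
        by (rule UnI2, unfold mem_Collect_eq, rule exI[of _ Ps], rule exI[of _ Q], rule exI[of _ Rs], rule exI[of _ c], rule exI[of _ d], rule exI[of _ p], rule exI[of _ q], rule exI[of _ s], rule exI[of _ x])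
            (use pq cd x s in auto)
    qed (use w x s in auto)
    thus ?thesis using mod_hom_smult[OF pr s w[OF x]] by (simp add: pure_def)
  qed
qed

text \<open>The prefix \<open>p\<close> is carried along because the induction on \<open>Qs\<close>
  moves one entry at a time into it; the empty prefix gives \<open>pure_multilin\<close>.\<close>

lemma pure_multilin_append:
  assumes "qmods S (Ps @ Qs)" "p \<in> qpaths S Ps a c" "c \<in> S"
  shows "multilin S (qtensor R S (Ps @ Qs) a b) Qs c b (\<lambda>q. pure R S (Ps @ Qs) a b (p @ q))"
  using assms
proof (induction Qs arbitrary: Ps p c)
  case Nil
  thus ?case by (auto intro!: pure_closed)
next
  case (Cons Q Qs)
  show ?case unfolding multilin.simps
  proof (intro ballI conjI)
    fix d x assume d: "d \<in> S" "x \<in> carrier (Q c d)"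
    have "p @ [(x, d)] \<in> qpaths S (Ps @ [Q]) a d"
      by (rule qpaths_append[OF Cons.prems(2)]) (use d in auto)
    from Cons.IH[OF _ this d(1)] Cons.prems
    show "multilin S (qtensor R S (Ps @ Q # Qs) a b) Qs d b
       (\<lambda>q. pure R S (Ps @ Q # Qs) a b (p @ (x, d) # q))" by simp
  next
    fix d q assume d: "d \<in> S" "q \<in> qpaths S Qs d b"
    show "(\<lambda>x. pure R S (Ps @ Q # Qs) a b (p @ (x, d) # q)) \<in>
      mod_hom R (Q c d) (qtensor R S (Ps @ Q # Qs) a b)"
    proof (rule mod_homI)
      fix x assume x: "x \<in> carrier (Q c d)"
      show "pure R S (Ps @ Q # Qs) a b (p @ (x, d) # q) \<in> carrier (qtensor R S (Ps @ Q # Qs) a b)"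
        by (rule pure_closed[OF Cons.prems(1) qpaths_middle[where Q=Q, OF Cons.prems(2) d(2) x d(1)]])
    qed (rule pure_add[OF Cons.prems(1,3) d(1) Cons.prems(2) d(2)]; assumption)+
  qed
qed

lemma pure_multilin:
  "qmods S Qs \<Longrightarrow> a \<in> S \<Longrightarrow> multilin S (qtensor R S Qs a b) Qs a b (pure R S Qs a b)"
  using pure_multilin_append[of S "[]" Qs "[]" a a b] by simp

text \<open>Contracting the back block of slots against a fixed tensor \<open>D\<close> leaves a map
  that is multilinear in the front block. This makes the outer lift in \<open>tens_cat\<close>
  meaningful.\<close>

lemma tens_lift_multilin_append:
  assumes Ps: "qmods S Ps" and Qs: "qmods S Qs" and N: "module R N"
    and D: "D \<in> carrier (qtensor R S Qs c b)"
    and "a \<in> S" "multilin S N (Ps @ Qs) a b G"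
  shows "multilin S N Ps a c (\<lambda>p. tens_lift R N (\<lambda>q. G (p @ q)) D)"
  using assms(1,5,6)
proof (induction Ps arbitrary: a G)
  case Nil
  thus ?case using mod_hom_closed[OF tens_lift_hom[OF Qs N] D, of G] by auto
next
  case (Cons P Ps)
  show ?case unfolding multilin.simps
  proof (intro ballI conjI)
    fix d x assume d: "d \<in> S" "x \<in> carrier (P a d)"
    show "multilin S N Ps d c (\<lambda>p. tens_lift R N (\<lambda>q. G (((x, d) # p) @ q)) D)"
      using Cons.IH[of d "\<lambda>p. G ((x, d) # p)"] Cons.prems d by simp
  next
    fix d p assume d: "d \<in> S" "p \<in> qpaths S Ps d c"
    show "(\<lambda>x. tens_lift R N (\<lambda>q. G (((x, d) # p) @ q)) D) \<in> mod_hom R (P a d) N"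
      \<comment> \<open>As \<open>D\<close> is fixed, so is its chosen representative; the lift
        becomes a \<open>free_lift\<close> with fixed coefficients whose values vary with
        \<open>x\<close>.\<close>
      unfolding tens_lift_def
    proof (rule free_lift_hom_param[OF _ N qtensor_rep[OF Qs D]])
      fix q assume "q \<in> qpaths S Qs c b"
      hence "p @ q \<in> qpaths S (Ps @ Qs) d b" by (rule qpaths_append[OF d(2)])
      thus "(\<lambda>x. G (((x, d) # p) @ q)) \<in> mod_hom R (P a d) N" using Cons.prems(3) d(1) by simp
    qed (use Cons.prems d in simp)
  qed
qed

section \<open>Bilinearity of the concatenation of tensors\<close>

context
  fixes S Ps Qs and a b c :: 's
  assumes PQ: "qmods S (Ps @ Qs)" and ac: "a \<in> S" "c \<in> S"
begin

lemma tens_cat_hom1: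
  assumes D: "D \<in> carrier (qtensor R S Qs c b)"
  shows "(\<lambda>C. tens_cat R S (Ps @ Qs) a b C D) \<in>
    mod_hom R (qtensor R S Ps a c) (qtensor R S (Ps @ Qs) a b)"
  unfolding tens_cat_def
  by (rule tens_lift_hom[OF _ qtensor_module[OF PQ] tens_lift_multilin_append[OF _ _ qtensor_module[OF PQ] D ac(1)]])
    (use PQ pure_multilin[OF PQ ac(1)] in auto)

lemma tens_cat_pure1:
  assumes D: "D \<in> carrier (qtensor R S Qs c b)" and p: "p \<in> qpaths S Ps a c"
  shows "tens_cat R S (Ps @ Qs) a b (pure R S Ps a c p) D =
    tens_lift R (qtensor R S (Ps @ Qs) a b) (\<lambda>q. pure R S (Ps @ Qs) a b (p @ q)) D"
  unfolding tens_cat_def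
  by (rule tens_lift_pure[OF _ qtensor_module[OF PQ] tens_lift_multilin_append[OF _ _ qtensor_module[OF PQ] D ac(1)] p])
    (use PQ pure_multilin[OF PQ ac(1)] in auto)

lemma tens_cat_pure:
  assumes "p \<in> qpaths S Ps a c" "q \<in> qpaths S Qs c b"
  shows "tens_cat R S (Ps @ Qs) a b (pure R S Ps a c p) (pure R S Qs c b q) =
    pure R S (Ps @ Qs) a b (p @ q)"
proof -
  have "qmods S Qs" using PQ by simp
  thus ?thesis
    using tens_cat_pure1[OF pure_closed assms(1)] assms(2)
      tens_lift_pure[OF _ qtensor_module[OF PQ] pure_multilin_append[OF PQ assms(1) ac(2)]]
    by simp
qed

text \<open>The two arguments are not treated alike, as the lift in \<open>D\<close> is nested
  inside the lift in \<open>C\<close>. With \<open>C\<close> fixed, its representative is a fixed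
  finite combination of paths, and each inner lift is linear in \<open>D\<close>.\<close>

lemma tens_cat_hom2:
  assumes C: "C \<in> carrier (qtensor R S Ps a c)"
  shows "tens_cat R S (Ps @ Qs) a b C \<in>
    mod_hom R (qtensor R S Qs c b) (qtensor R S (Ps @ Qs) a b)"
proof -
  let ?N = "qtensor R S (Ps @ Qs) a b"
  have P: "qmods S Ps" and Q: "qmods S Qs" using PQ by auto
  let ?f = "SOME f. f \<in> C"
  have "(\<lambda>D. free_lift R ?N (\<lambda>p. tens_lift R ?N (\<lambda>q. pure R S (Ps @ Qs) a b (p @ q)) D) ?f) \<in>
    mod_hom R (qtensor R S Qs c b) ?N"
    by (rule free_lift_hom_param[OF qtensor_module[OF Q] qtensor_module[OF PQ] qtensor_rep[OF P C]])
      (rule tens_lift_hom[OF Q qtensor_module[OF PQ] pure_multilin_append[OF PQ _ ac(2)]])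
  thus ?thesis unfolding tens_cat_def[abs_def] tens_lift_def[of _ _ _ C] .
qed

end

section \<open>Tensor products of morphisms of quivers\<close>

definition qmaps_ok ::
    "'s set \<Rightarrow> ('s, 'a, 'm) quiver list \<Rightarrow> ('s, 'a, 'm) qmaps \<Rightarrow> bool" where
  "qmaps_ok S = list_all2 (\<lambda>Q (Ps, \<phi>). qmods S Ps \<and>
     (\<forall>a\<in>S. \<forall>b\<in>S. \<phi> a b \<in> mod_hom R (Q a b) (qtensor R S Ps a b)))"

lemma qmaps_ok_Nil [simp]: "qmaps_ok S [] \<Phi> \<longleftrightarrow> \<Phi> = []"
  by (auto simp: qmaps_ok_def)

lemma qmaps_ok_Cons [simp]:
  "qmaps_ok S (Q # Qs) ((Ps, \<phi>) # \<Phi>) \<longleftrightarrow> qmods S Ps \<and>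
     (\<forall>a\<in>S. \<forall>b\<in>S. \<phi> a b \<in> mod_hom R (Q a b) (qtensor R S Ps a b)) \<and> qmaps_ok S Qs \<Phi>"
  by (auto simp: qmaps_ok_def)

lemma qmaps_ok_ConsE:
  assumes "qmaps_ok S (Q # Qs) \<Phi>"
  obtains Ps \<phi> \<Phi>' where "\<Phi> = (Ps, \<phi>) # \<Phi>'" "qmods S Ps"
    "\<forall>a\<in>S. \<forall>b\<in>S. \<phi> a b \<in> mod_hom R (Q a b) (qtensor R S Ps a b)" "qmaps_ok S Qs \<Phi>'"
  using assms by (cases \<Phi>) (auto simp: qmaps_ok_def)

lemma qmaps_ok_cod: "qmaps_ok S Qs \<Phi> \<Longrightarrow> qmods S (concat (map fst \<Phi>))"
  unfolding qmaps_ok_def by (induction rule: list_all2_induct) auto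

lemma tens_path_multilin:
  assumes "qmaps_ok S Qs \<Phi>" "qmods S Qs" "a \<in> S"
  shows "multilin S (qtensor R S (concat (map fst \<Phi>)) a b) Qs a b (tens_path R S \<Phi> a b)"
  using assms
proof (induction Qs arbitrary: \<Phi> a)
  case Nil
  thus ?case by (auto intro!: pure_closed)
next
  case (Cons Q Qs)
  from Cons.prems(1) obtain Ps \<phi> \<Phi>' where \<Phi>: "\<Phi> = (Ps, \<phi>) # \<Phi>'" "qmods S Ps"
    "\<forall>a\<in>S. \<forall>b\<in>S. \<phi> a b \<in> mod_hom R (Q a b) (qtensor R S Ps a b)" "qmaps_ok S Qs \<Phi>'"
    by (rule qmaps_ok_ConsE)
  have PQ: "qmods S (Ps @ concat (map fst \<Phi>'))" using \<Phi> qmaps_ok_cod by auto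
  have IH: "multilin S (qtensor R S (concat (map fst \<Phi>')) c b) Qs c b (tens_path R S \<Phi>' c b)"
    if "c \<in> S" for c using Cons.IH[OF \<Phi>(4) _ that] Cons.prems by simp
  show ?case unfolding multilin.simps \<Phi>(1) tens_path.simps list.map concat.simps fst_conv
  proof (intro ballI conjI)
    fix c x assume c: "c \<in> S" "x \<in> carrier (Q a c)"
    show "multilin S (qtensor R S (Ps @ concat (map fst \<Phi>')) a b) Qs c b
       (\<lambda>p. tens_cat R S (Ps @ concat (map fst \<Phi>')) a b (\<phi> a c x) (tens_path R S \<Phi>' c b p))"
      by (rule multilin_comp[OF IH[OF c(1)] tens_cat_hom2[OF PQ Cons.prems(3) c(1)]])
        (rule mod_hom_closed[OF \<Phi>(3)[rule_format, OF Cons.prems(3) c(1)] c(2)])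
  next
    fix c p assume c: "c \<in> S" "p \<in> qpaths S Qs c b"
    show "(\<lambda>x. tens_cat R S (Ps @ concat (map fst \<Phi>')) a b (\<phi> a c x) (tens_path R S \<Phi>' c b p)) \<in>
      mod_hom R (Q a c) (qtensor R S (Ps @ concat (map fst \<Phi>')) a b)"
      by (rule mod_hom_comp[OF \<Phi>(3)[rule_format, OF Cons.prems(3) c(1)] tens_cat_hom1[OF PQ Cons.prems(3) c(1)]])
        (rule multilin_closed[OF IH[OF c(1)] c(2)])
  qed
qed

lemma tens_map_hom:
  assumes "qmaps_ok S Qs \<Phi>" "qmods S Qs" "a \<in> S"
  shows "tens_map R S \<Phi> a b \<in> mod_hom R (qtensor R S Qs a b) (qtensor R S (concat (map fst \<Phi>)) a b)"
  unfolding tens_map_def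
  by (rule tens_lift_hom[OF assms(2) qtensor_module[OF qmaps_ok_cod[OF assms(1)]]
        tens_path_multilin[OF assms]])

lemma tens_map_pure:
  assumes "qmaps_ok S Qs \<Phi>" "qmods S Qs" "a \<in> S" "p \<in> qpaths S Qs a b"
  shows "tens_map R S \<Phi> a b (pure R S Qs a b p) = tens_path R S \<Phi> a b p"
  unfolding tens_map_def
  by (rule tens_lift_pure[OF assms(2) qtensor_module[OF qmaps_ok_cod[OF assms(1)]]
        tens_path_multilin[OF assms(1-3)] assms(4)])

lemma tens_path_Cons_pure:
  assumes "qmods S Ps" "qmods S (concat (map fst \<Phi>))" "a \<in> S" "c \<in> S"
    and "\<phi> a c x = pure R S Ps a c w" "w \<in> qpaths S Ps a c"
    and "tens_path R S \<Phi> c b p = pure R S (concat (map fst \<Phi>)) c b w'"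
      "w' \<in> qpaths S (concat (map fst \<Phi>)) c b"
  shows "tens_path R S ((Ps, \<phi>) # \<Phi>) a b ((x, c) # p) =
    pure R S (Ps @ concat (map fst \<Phi>)) a b (w @ w')"
  using tens_cat_pure[of S Ps "concat (map fst \<Phi>)" a c w w' b] assms by simp

lemma one_tens_hom:
  assumes "\<forall>a\<in>S. \<forall>b\<in>S. module R (Q a b)" "a \<in> S" "b \<in> S"
  shows "one_tens R S Q a b \<in> mod_hom R (Q a b) (qtensor R S [Q] a b)"
  using pure_multilin[of S "[Q]" a b] assms by (simp add: one_tens_def[abs_def])

end


subsection \<open>Tensor products of free quivers\<close>

text \<open>These paths index a basis of the tensor product of free quivers:
  \<open>qtensor_basis_eqI\<close> shows that they generate and \<open>qtensor_basis_hom\<close>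
  that values on them can be prescribed freely.\<close>

fun bpaths :: "'s set \<Rightarrow> ('s \<Rightarrow> 's \<Rightarrow> 'x set) list \<Rightarrow> 's \<Rightarrow> 's \<Rightarrow> ('x \<times> 's) list set" where
  "bpaths S [] a b = (if a = b then {[]} else {})"
| "bpaths S (B # Bs) a b = {(x, c) # p | x c p. c \<in> S \<and> x \<in> B a c \<and> p \<in> bpaths S Bs c b}"

lemma bpaths_append:
  "p \<in> bpaths S Ps a c \<Longrightarrow> q \<in> bpaths S Qs c b \<Longrightarrow> p @ q \<in> bpaths S (Ps @ Qs) a b"
  by (induction Ps arbitrary: a p) (auto split: if_splits)

context cring
begin

text \<open>All factors below have this form, so a list of factors is written
  \<open>map fquiv Bs\<close> and is determined by the list \<open>Bs\<close> of bases.\<close>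

definition fquiv :: "('s \<Rightarrow> 's \<Rightarrow> 'x set) \<Rightarrow> ('s, 'a, 'x \<Rightarrow> 'a) quiver" where
  "fquiv B a b = free_mod R (B a b)"

definition bas :: "('x \<times> 's) list \<Rightarrow> (('x \<Rightarrow> 'a) \<times> 's) list" where
  "bas = map (\<lambda>(x, c). (single R x, c))"

definition bpure ::
    "'s set \<Rightarrow> ('s \<Rightarrow> 's \<Rightarrow> 'x set) list \<Rightarrow> 's \<Rightarrow> 's \<Rightarrow> ('x \<times> 's) list \<Rightarrow> ('s, 'a, 'x \<Rightarrow> 'a) tens" where
  "bpure S Bs a b p = pure R S (map fquiv Bs) a b (bas p)"

lemma bas_simps [simp]:
  "bas [] = []" "bas ((x, c) # p) = (single R x, c) # bas p" "bas (p @ q) = bas p @ bas q"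
  by (auto simp: bas_def)

lemma qmods_fquiv [simp]: "qmods S (map fquiv Bs)"
  by (auto simp: qmods_def fquiv_def free_mod_module)

lemma fquiv_module [simp]: "module R (fquiv B a b)"
  by (simp add: fquiv_def free_mod_module)

lemma bas_closed: "w \<in> bpaths S Bs a b \<Longrightarrow> bas w \<in> qpaths S (map fquiv Bs) a b"
  by (induction Bs arbitrary: a w) (auto simp: fquiv_def intro!: single_closed split: if_splits)

lemma bpure_closed:
  "w \<in> bpaths S Bs a b \<Longrightarrow> bpure S Bs a b w \<in> carrier (qtensor R S (map fquiv Bs) a b)"
  unfolding bpure_def by (intro pure_closed bas_closed) simp

text \<open>Entries are replaced one at a time: the induction hypothesis treats the tail behind a
  basis element, linearity then treats the head.\<close>

lemma multilin_basis_eqI: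
  assumes N: "module R N"
    and "multilin S N (map fquiv Bs) a b g" "multilin S N (map fquiv Bs) a b g'"
    and "\<And>w. w \<in> bpaths S Bs a b \<Longrightarrow> g (bas w) = g' (bas w)"
    and "p \<in> qpaths S (map fquiv Bs) a b"
  shows "g p = g' p"
  using assms(2-)
proof (induction Bs arbitrary: a g g' p)
  case Nil
  thus ?case by (auto split: if_splits)
next
  case (Cons B Bs)
  from Cons.prems(4) obtain f c p' where p: "p = (f, c) # p'" "c \<in> S" "f \<in> carrier (fquiv B a c)"
    "p' \<in> qpaths S (map fquiv Bs) c b" by auto
  have "g ((f, c) # p') = g' ((f, c) # p')"
  proof (rule free_hom_eqI[OF N _ _ _ p(3)[unfolded fquiv_def], where h = "\<lambda>f. g ((f, c) # p')" and h' = "\<lambda>f. g' ((f, c) # p')"])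
    fix x assume x: "x \<in> B a c"
    hence sx: "single R x \<in> carrier (fquiv B a c)" by (simp add: fquiv_def single_closed)
    show "g ((single R x, c) # p') = g' ((single R x, c) # p')"
    proof (rule Cons.IH[OF _ _ _ p(4)])
      fix w assume "w \<in> bpaths S Bs c b"
      hence "(x, c) # w \<in> bpaths S (B # Bs) a b" using x p(2) by auto
      thus "g ((single R x, c) # bas w) = g' ((single R x, c) # bas w)"
        using Cons.prems(3)[of "(x, c) # w"] by simp
    qed (use Cons.prems p(2) sx in auto)
  qed (use Cons.prems(1,2) p in \<open>auto simp: fquiv_def[symmetric]\<close>)
  thus ?case using p by simp
qed

lemma qtensor_basis_eqI:
  assumes N: "module R N" and a: "a \<in> S"
    and h: "h \<in> mod_hom R (qtensor R S (map fquiv Bs) a b) N"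
      "h' \<in> mod_hom R (qtensor R S (map fquiv Bs) a b) N"
    and eq: "\<And>w. w \<in> bpaths S Bs a b \<Longrightarrow> h (bpure S Bs a b w) = h' (bpure S Bs a b w)"
    and C: "C \<in> carrier (qtensor R S (map fquiv Bs) a b)"
  shows "h C = h' C"
proof (rule qtensor_hom_eqI[OF _ N h _ C])
  fix p assume p: "p \<in> qpaths S (map fquiv Bs) a b"
  note pm = pure_multilin[OF qmods_fquiv a, of Bs b]
  show "h (pure R S (map fquiv Bs) a b p) = h' (pure R S (map fquiv Bs) a b p)"
    by (rule multilin_basis_eqI[OF N multilin_comp[OF pm h(1)] multilin_comp[OF pm h(2)] _ p])
      (use eq in \<open>simp add: bpure_def\<close>)
qed simp

text \<open>The multilinear extension of values \<open>g\<close> on basis paths, with one nested sum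
  for each entry of the path.\<close>

primrec basis_ext ::
    "('a, 'n) module \<Rightarrow> (('x \<Rightarrow> 'a) \<times> 's) list \<Rightarrow> (('x \<times> 's) list \<Rightarrow> 'n) \<Rightarrow> 'n" where
  "basis_ext N [] g = g []"
| "basis_ext N (fc # p) g =
     free_lift R N (\<lambda>x. basis_ext N p (\<lambda>w. g ((x, snd fc) # w))) (fst fc)"

lemma basis_ext_multilin:
  assumes N: "module R N" and "\<And>w. w \<in> bpaths S Bs a b \<Longrightarrow> g w \<in> carrier N" and "a \<in> S"
  shows "multilin S N (map fquiv Bs) a b (\<lambda>p. basis_ext N p g)"
  using assms(2,3)
proof (induction Bs arbitrary: a g)
  case Nil
  thus ?case by simp
next
  case (Cons B Bs)
  have IH: "multilin S N (map fquiv Bs) c b (\<lambda>p. basis_ext N p (\<lambda>w. g ((x, c) # w)))"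
    if "c \<in> S" "x \<in> B a c" for x c
    by (rule Cons.IH) (use Cons.prems that in auto)
  show ?case unfolding multilin.simps list.map
  proof (intro ballI conjI)
    fix c f assume c: "c \<in> S" "f \<in> carrier (fquiv B a c)"
    show "multilin S N (map fquiv Bs) c b (\<lambda>p. basis_ext N ((f, c) # p) g)"
      unfolding basis_ext.simps fst_conv snd_conv
      by (rule multilin_free_lift[OF N c(2)[unfolded fquiv_def] _ c(1) IH]) (use c in auto)
  next
    fix c p assume c: "c \<in> S" "p \<in> qpaths S (map fquiv Bs) c b"
    show "(\<lambda>f. basis_ext N ((f, c) # p) g) \<in> mod_hom R (fquiv B a c) N"
      unfolding basis_ext.simps fst_conv snd_conv fquiv_def
      by (rule free_lift_hom[OF N]) (rule multilin_closed[OF IH[OF c(1)] c(2)])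
  qed
qed

lemma basis_ext_bas:
  assumes N: "module R N" and "w \<in> bpaths S Bs a b"
    "\<And>w. w \<in> bpaths S Bs a b \<Longrightarrow> g w \<in> carrier N"
  shows "basis_ext N (bas w) g = g w"
  using assms(2,3)
proof (induction Bs arbitrary: a g w)
  case Nil
  thus ?case by (auto split: if_splits)
next
  case (Cons B Bs)
  from Cons.prems(1) obtain x c p where p: "w = (x, c) # p" "c \<in> S" "x \<in> B a c"
    "p \<in> bpaths S Bs c b" by auto
  have IH: "basis_ext N (bas p) (\<lambda>w. g ((x, c) # w)) = g ((x, c) # p)"
    by (rule Cons.IH[OF p(4)]) (use Cons.prems p in auto)
  show ?case unfolding p
    using free_lift_single[of N "\<lambda>x. basis_ext N (bas p) (\<lambda>w. g ((x, c) # w))" x, OF N] Cons.prems p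
    by (simp add: IH)
qed

lemma qtensor_basis_hom:
  assumes N: "module R N" and g: "\<And>w. w \<in> bpaths S Bs a b \<Longrightarrow> g w \<in> carrier N" and a: "a \<in> S"
  obtains h where "h \<in> mod_hom R (qtensor R S (map fquiv Bs) a b) N"
    "\<And>w. w \<in> bpaths S Bs a b \<Longrightarrow> h (bpure S Bs a b w) = g w"
proof
  show "tens_lift R N (\<lambda>p. basis_ext N p g) \<in> mod_hom R (qtensor R S (map fquiv Bs) a b) N"
    by (rule tens_lift_hom[OF _ N basis_ext_multilin[OF N g a]]) auto
  show "tens_lift R N (\<lambda>p. basis_ext N p g) (bpure S Bs a b w) = g w" if "w \<in> bpaths S Bs a b" for w
    unfolding bpure_def using tens_lift_pure[OF _ N basis_ext_multilin[OF N g a] bas_closed[OF that]]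
      basis_ext_bas[OF N that g] by simp
qed

lemma tens_path_Cons_basis:
  assumes ac: "a \<in> S" "c \<in> S"
    and x: "\<phi> a c (single R x) = bpure S Ps a c v" "v \<in> bpaths S Ps a c"
    and w: "tens_path R S \<Phi> c b (bas w) = bpure S Rs c b v'" "v' \<in> bpaths S Rs c b"
    and \<Phi>: "concat (map fst \<Phi>) = map fquiv Rs"
  shows "tens_path R S ((map fquiv Ps, \<phi>) # \<Phi>) a b (bas ((x, c) # w)) = bpure S (Ps @ Rs) a b (v @ v')"
  using tens_path_Cons_pure[of S "map fquiv Ps" \<Phi> a c \<phi> "single R x" "bas v" b "bas w" "bas v'"] assms
  by (simp add: bpure_def bas_closed)

lemma tens_path_Nil_basis: "tens_path R S [] a b (bas []) = bpure S [] a b []"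
  by (simp add: bpure_def)

end


section \<open>The templicial module of a simplicial set\<close>

text \<open>The inclusion of the interval \<open>{s..s + l}\<close>. In particular
  \<open>seg 0 n\<close> is the identity of \<open>[n]\<close>, and as a map between necklaces of
  length \<open>n\<close> it is the inert map.\<close>

definition seg :: "nat \<Rightarrow> nat \<Rightarrow> nat \<Rightarrow> nat" where
  "seg s l = (\<lambda>i\<in>{..l}. s + i)"

lemma seg_0: "(\<lambda>i\<in>{..l}. i) = seg 0 l"
  by (simp add: seg_def)

lemma DeltaD:
  "f \<in> Delta m n \<Longrightarrow> i \<le> m \<Longrightarrow> f i \<le> n"
  "f \<in> Delta m n \<Longrightarrow> i \<le> j \<Longrightarrow> j \<le> m \<Longrightarrow> f i \<le> f j"
  "f \<in> Delta m n \<Longrightarrow> f \<in> extensional {..m}"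
  by (auto simp: Delta_def mono_on_def PiE_def Pi_iff)

lemma DeltaI:
  "(\<And>i. i \<le> m \<Longrightarrow> f i \<le> n) \<Longrightarrow> (\<And>i j. i \<le> j \<Longrightarrow> j \<le> m \<Longrightarrow> f i \<le> f j) \<Longrightarrow>
    f \<in> extensional {..m} \<Longrightarrow> f \<in> Delta m n"
  by (auto simp: Delta_def mono_on_def PiE_def Pi_iff)

lemma seg_Delta: "s + l \<le> n \<Longrightarrow> seg s l \<in> Delta l n"
  by (rule DeltaI) (auto simp: seg_def)

lemma pt_Delta: "i \<le> n \<Longrightarrow> pt i \<in> Delta 0 n"
  by (rule DeltaI) (auto simp: pt_def)

lemma compose_Delta: "f \<in> Delta l m \<Longrightarrow> g \<in> Delta m n \<Longrightarrow> compose {..l} g f \<in> Delta l n"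
  by (rule DeltaI) (auto simp: compose_def DeltaD)

lemma Delta_fD:
  "f \<in> Delta_f m n \<Longrightarrow> f \<in> Delta m n" "f \<in> Delta_f m n \<Longrightarrow> f 0 = 0" "f \<in> Delta_f m n \<Longrightarrow> f m = n"
  by (auto simp: Delta_f_def)

lemma compose_Delta_f: "f \<in> Delta_f l m \<Longrightarrow> g \<in> Delta_f m n \<Longrightarrow> compose {..l} g f \<in> Delta_f l n"
  by (auto simp: Delta_f_def compose_Delta) (simp_all add: compose_def)

lemma compose_pt: "compose {0} f (pt i) = pt (f i)"
  by (auto simp: compose_def pt_def)

lemma compose_seg_seg: "t + k \<le> l \<Longrightarrow> compose {..k} (seg s l) (seg t k) = seg (s + t) k"
  by (auto simp: compose_def seg_def)

lemma compose_seg_pt: "i \<le> l \<Longrightarrow> compose {0} (seg s l) (pt i) = pt (s + i)"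
  by (auto simp: compose_def seg_def pt_def)

lemma vertex_pt: "vertex K n i x = sact K 0 n (pt i) x"
  by (simp add: vertex_def pt_def)

context
  fixes K :: "'x sset"
  assumes K: "simplicial_set K"
begin

lemma sact_closed: "\<alpha> \<in> Delta m n \<Longrightarrow> x \<in> cells K n \<Longrightarrow> sact K m n \<alpha> x \<in> cells K m"
  using K unfolding simplicial_set_def by blast

lemma sact_id: "x \<in> cells K n \<Longrightarrow> sact K n n (seg 0 n) x = x"
  using K unfolding simplicial_set_def seg_0 by blast

lemma sact_comp:
  "\<alpha> \<in> Delta l m \<Longrightarrow> \<beta> \<in> Delta m n \<Longrightarrow> x \<in> cells K n \<Longrightarrow>
    sact K l m \<alpha> (sact K m n \<beta> x) = sact K l n (compose {..l} \<beta> \<alpha>) x"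
  using K unfolding simplicial_set_def by metis

lemma vertex_closed: "x \<in> cells K n \<Longrightarrow> i \<le> n \<Longrightarrow> vertex K n i x \<in> cells K 0"
  by (simp add: vertex_pt sact_closed pt_Delta)

lemma vertex_sact:
  "\<alpha> \<in> Delta m n \<Longrightarrow> x \<in> cells K n \<Longrightarrow> i \<le> m \<Longrightarrow> vertex K m i (sact K m n \<alpha> x) = vertex K n (\<alpha> i) x"
  by (simp add: vertex_pt sact_comp pt_Delta compose_pt)

lemma vertex_0: "x \<in> cells K 0 \<Longrightarrow> vertex K 0 0 x = x"
proof -
  have "pt 0 = seg 0 0" by (auto simp: pt_def seg_def)
  thus "x \<in> cells K 0 \<Longrightarrow> vertex K 0 0 x = x" by (simp add: vertex_pt sact_id)
qed

lemma cells_betweenD: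
  "x \<in> cells_between K n a b \<Longrightarrow> x \<in> cells K n \<and> vertex K n 0 x = a \<and> vertex K n n x = b"
  by (simp add: cells_between_def)

lemma sact_cells_between:
  "\<alpha> \<in> Delta m n \<Longrightarrow> x \<in> cells K n \<Longrightarrow>
    sact K m n \<alpha> x \<in> cells_between K m (vertex K n (\<alpha> 0) x) (vertex K n (\<alpha> m) x)"
  by (simp add: cells_between_def sact_closed vertex_sact)

lemma sact_seg_cells_between:
  "x \<in> cells K n \<Longrightarrow> s + l \<le> n \<Longrightarrow>
    sact K l n (seg s l) x \<in> cells_between K l (vertex K n s x) (vertex K n (s + l) x)"
  using sact_cells_between[OF seg_Delta] by (simp add: seg_def)

lemma sact_f_cells_between:
  "f \<in> Delta_f m n \<Longrightarrow> x \<in> cells_between K n a b \<Longrightarrow> sact K m n f x \<in> cells_between K m a b"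
  using sact_cells_between[of f m n x] by (auto simp: cells_between_def Delta_f_def)

lemma cells_between_0: "cells_between K 0 a b = (if a = b \<and> a \<in> cells K 0 then {a} else {})"
  by (auto simp: cells_between_def vertex_0)

end

context cring
begin

lemma ftilde_sel:
  "verts (ftilde R K) = cells K 0"
  "tmod (ftilde R K) n = fquiv (cells_between K n)"
  "tact (ftilde R K) m n f a b = free_lift R (fquiv (cells_between K m) a b) (\<lambda>x. single R (sact K m n f x))"
  "comult (ftilde R K) p q a b =
    free_lift R (qtensor R (cells K 0) (map fquiv [cells_between K p, cells_between K q]) a b)
     (\<lambda>x. bpure (cells K 0) [cells_between K p, cells_between K q] a b
       [(sact K p (p + q) (seg 0 p) x, vertex K (p + q) p x), (sact K q (p + q) (seg p q) x, b)])"
  "counit (ftilde R K) a b = free_lift R (unit_quiver R a b) (\<lambda>x. \<one>)"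
  by (simp_all add: ftilde_def Let_def fquiv_def[abs_def] bpure_def seg_def)

lemma unit_quiver_module: "module R (unit_quiver R a b)"
proof -
  interpret abelian_group "unit_quiver R a b"
    by (rule abelian_groupI)
      (auto simp: unit_quiver_def a_ac split: if_splits intro: exI[of _ "\<ominus> _"] l_neg)
  show ?thesis
    by (rule moduleI[OF is_cring abelian_group_axioms])
      (auto simp: unit_quiver_def l_distr r_distr m_assoc split: if_splits)
qed

lemma unit_tens_hom:
  "unit_tens R S a b \<in> mod_hom R (unit_quiver R a b) (qtensor R S [] a b)"
proof -
  interpret T: module R "qtensor R S [] a b" by (rule qtensor_module) simp
  show ?thesis
  proof (cases "a = b")
    case True
    have pc: "pure R S [] a a [] \<in> carrier (qtensor R S [] a a)" by (rule pure_closed) auto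
    have T: "module R (qtensor R S [] a a)" by (rule qtensor_module) simp
    show ?thesis unfolding True[symmetric]
      by (intro mod_homI) (auto simp: unit_tens_def unit_quiver_def pc module.smult_l_distr[OF T]
        module.smult_assoc1[OF T] module.smult_closed[OF T])
  qed (auto intro!: mod_homI simp: unit_tens_def unit_quiver_def)
qed

end

section \<open>The templicial axioms, checked on simplices\<close>

locale simplicial_base = cring R for R (structure) +
  fixes K :: "'x sset"
  assumes K: "simplicial_set K"
begin

abbreviation (input) "cb \<equiv> cells_between K"
abbreviation (input) "V \<equiv> cells K 0"
abbreviation (input) "X \<equiv> ftilde R K"

lemma tact_hom:
  "f \<in> Delta_f m n \<Longrightarrow> tact X m n f a b \<in> mod_hom R (fquiv (cb n) a b) (fquiv (cb m) a b)"
  unfolding ftilde_sel fquiv_def[of "cb n"]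
  by (rule free_lift_hom) (auto simp: fquiv_def intro!: free_mod_module single_closed sact_f_cells_between[OF K])

lemma tact_single:
  "f \<in> Delta_f m n \<Longrightarrow> x \<in> cb n a b \<Longrightarrow> tact X m n f a b (single R x) = single R (sact K m n f x)"
  unfolding ftilde_sel
  by (rule free_lift_single) (auto simp: fquiv_def intro!: free_mod_module single_closed sact_f_cells_between[OF K])

lemma comult_path:
  assumes "x \<in> cb (p + q) a b"
  shows "[(sact K p (p + q) (seg 0 p) x, vertex K (p + q) p x), (sact K q (p + q) (seg p q) x, b)]
    \<in> bpaths V [cb p, cb q] a b"
  using sact_seg_cells_between[OF K, of x "p + q" 0 p] sact_seg_cells_between[OF K, of x "p + q" p q]
    assms vertex_closed[OF K] by (auto simp: cells_between_def)

lemma comult_hom: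
  "comult X p q a b \<in> mod_hom R (fquiv (cb (p + q)) a b) (qtensor R V (map fquiv [cb p, cb q]) a b)"
  unfolding ftilde_sel fquiv_def[of "cb (p + q)"]
  by (rule free_lift_hom[OF qtensor_module[OF qmods_fquiv] bpure_closed[OF comult_path]])

lemma comult_single:
  "x \<in> cb (p + q) a b \<Longrightarrow> comult X p q a b (single R x) = bpure V [cb p, cb q] a b
    [(sact K p (p + q) (seg 0 p) x, vertex K (p + q) p x), (sact K q (p + q) (seg p q) x, b)]"
  unfolding ftilde_sel
  by (rule free_lift_single[OF qtensor_module[OF qmods_fquiv]]) (rule bpure_closed[OF comult_path])

lemma counit_hom: "counit X a b \<in> mod_hom R (fquiv (cb 0) a b) (unit_quiver R a b)"
  unfolding ftilde_sel fquiv_def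
  by (rule free_lift_hom[OF unit_quiver_module])
    (auto simp: cells_between_0[OF K] unit_quiver_def split: if_splits)

lemma counit_single: "x \<in> cb 0 a b \<Longrightarrow> counit X a b (single R x) = \<one>"
  unfolding ftilde_sel
  by (rule free_lift_single[OF unit_quiver_module])
    (auto simp: cells_between_0[OF K] unit_quiver_def split: if_splits)

text \<open>A \<open>0\<close>-simplex has equal end vertices. So the module in degree
  \<open>0\<close> vanishes for \<open>a \<noteq> b\<close>, and for \<open>a = b\<close> it is free
  on that one vertex, whose coefficient the counit reads off.\<close>

lemma counit_bij:
  assumes "a \<in> V" "b \<in> V"
  shows "bij_betw (counit X a b) (carrier (fquiv (cb 0) a b)) (carrier (unit_quiver R a b))"
proof (cases "a = b")
  case False
  have "carrier (fquiv (cb 0) a b) = {\<lambda>_. \<zero>}"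
    using False by (auto simp: fquiv_def free_mod_sel cells_between_0[OF K])
  moreover have "counit X a b (\<lambda>_. \<zero>) = \<zero>"
    using mod_hom_zero[OF fquiv_module unit_quiver_module counit_hom, of a b]
    by (simp add: fquiv_def free_mod_sel unit_quiver_def)
  ultimately show ?thesis using False by (simp add: bij_betw_def unit_quiver_def)
next
  case True
  have cb: "cb 0 b b = {b}" using assms by (simp add: cells_between_0[OF K])
  have c: "counit X b b f = f b" if "f \<in> carrier (fquiv (cb 0) b b)" for f
  proof -
    have "f = f b \<odot>\<^bsub>fquiv (cb 0) b b\<^esub> single R b" "f b \<in> carrier R"
      using that by (auto simp: fquiv_def free_mod_sel single_def cb)
    moreover have "single R b \<in> carrier (fquiv (cb 0) b b)"
      by (simp add: fquiv_def single_closed cb)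
    ultimately have "counit X b b f = f b \<odot>\<^bsub>unit_quiver R b b\<^esub> counit X b b (single R b)"
      using mod_hom_smult[OF counit_hom] by metis
    thus ?thesis using counit_single[of b b b] \<open>f b \<in> carrier R\<close> by (simp add: cb unit_quiver_def)
  qed
  have m: "(\<lambda>x. if x = b then r else \<zero>) \<in> carrier (fquiv (cb 0) b b)" if "r \<in> carrier R" for r
    using that by (auto simp: fquiv_def free_mod_sel cb)
  show ?thesis unfolding True
    by (rule bij_betw_byWitness[of _ "\<lambda>r x. if x = b then r else \<zero>"])
      (use c m mod_hom_closed[OF counit_hom, of _ b b] in
        \<open>auto simp: unit_quiver_def fquiv_def free_mod_sel cb fun_eq_iff\<close>)
qed

lemma one_tens_single: "one_tens R V (fquiv B) a b (single R x) = bpure V [B] a b [(x, b)]"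
  by (simp add: one_tens_def bpure_def)

lemma unit_tens_one:
  "a \<in> V \<Longrightarrow> unit_tens R V a a \<one> = bpure V [] a a []"
  by (simp add: unit_tens_def bpure_def module.smult_one[OF qtensor_module] pure_closed)

lemma fquiv_one_tens_hom:
  "a \<in> V \<Longrightarrow> b \<in> V \<Longrightarrow> one_tens R V (fquiv B) a b \<in> mod_hom R (fquiv B a b) (qtensor R V (map fquiv [B]) a b)"
  using one_tens_hom[of V "fquiv B" a b] by simp

lemma qmaps_ok_blk:
  "qmaps_ok V (fquiv (cb n) # Qs) (id_blk R X n # \<Phi>) \<longleftrightarrow> qmaps_ok V Qs \<Phi>"
  "qmaps_ok V (fquiv (cb (p + q)) # Qs) (comult_blk X p q # \<Phi>) \<longleftrightarrow> qmaps_ok V Qs \<Phi>"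
  "f \<in> Delta_f m n \<Longrightarrow> qmaps_ok V (fquiv (cb n) # Qs) (tact_blk R X m n f # \<Phi>) \<longleftrightarrow> qmaps_ok V Qs \<Phi>"
  "qmaps_ok V (fquiv (cb 0) # Qs) (counit_blk R X # \<Phi>) \<longleftrightarrow> qmaps_ok V Qs \<Phi>"
proof -
  show "qmaps_ok V (fquiv (cb n) # Qs) (id_blk R X n # \<Phi>) \<longleftrightarrow> qmaps_ok V Qs \<Phi>"
    using fquiv_one_tens_hom[of _ _ "cb n"] by (simp add: id_blk_def ftilde_sel(1,2))
  show "qmaps_ok V (fquiv (cb (p + q)) # Qs) (comult_blk X p q # \<Phi>) \<longleftrightarrow> qmaps_ok V Qs \<Phi>"
    using comult_hom by (simp add: comult_blk_def ftilde_sel(1,2))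
  show "qmaps_ok V (fquiv (cb n) # Qs) (tact_blk R X m n f # \<Phi>) \<longleftrightarrow> qmaps_ok V Qs \<Phi>" if "f \<in> Delta_f m n"
    using mod_hom_comp[OF tact_hom[OF that] fquiv_one_tens_hom[of _ _ "cb m"]] by (simp add: tact_blk_def ftilde_sel(1,2))
  show "qmaps_ok V (fquiv (cb 0) # Qs) (counit_blk R X # \<Phi>) \<longleftrightarrow> qmaps_ok V Qs \<Phi>"
    by (simp add: counit_blk_def ftilde_sel(1,2) mod_hom_comp[OF counit_hom unit_tens_hom])
qed

lemma fst_blk:
  "fst (id_blk R X n) = [fquiv (cb n)]" "fst (comult_blk X p q) = [fquiv (cb p), fquiv (cb q)]"
  "fst (tact_blk R X m n f) = [fquiv (cb m)]" "fst (counit_blk R X) = []"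
  by (simp_all add: id_blk_def tact_blk_def comult_blk_def counit_blk_def ftilde_sel(1,2))

text \<open>One evaluation rule for each kind of leading block. Chaining them from the right
  computes a whole \<open>tens_map\<close> on a basis path.\<close>

lemma tens_path_blk:
  assumes "a \<in> V" "c \<in> V" "tens_path R V \<Phi> c b (bas w) = bpure V Rs c b v" "v \<in> bpaths V Rs c b"
    "concat (map fst \<Phi>) = map fquiv Rs"
  shows "x \<in> cb n a c \<Longrightarrow> tens_path R V (id_blk R X n # \<Phi>) a b (bas ((x, c) # w)) =
      bpure V (cb n # Rs) a b ((x, c) # v)"
    and "x \<in> cb (p + q) a c \<Longrightarrow> tens_path R V (comult_blk X p q # \<Phi>) a b (bas ((x, c) # w)) =
      bpure V (cb p # cb q # Rs) a b ((sact K p (p + q) (seg 0 p) x, vertex K (p + q) p x) #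
        (sact K q (p + q) (seg p q) x, c) # v)"
    and "x \<in> cb n a c \<Longrightarrow> f \<in> Delta_f m n \<Longrightarrow> tens_path R V (tact_blk R X m n f # \<Phi>) a b (bas ((x, c) # w)) =
      bpure V (cb m # Rs) a b ((sact K m n f x, c) # v)"
    and "x \<in> cb 0 a c \<Longrightarrow> tens_path R V (counit_blk R X # \<Phi>) a b (bas ((x, c) # w)) = bpure V Rs a b v"
proof -
  note tc = tens_path_Cons_basis[OF assms(1,2) _ _ assms(3-5)]
  show "tens_path R V (id_blk R X n # \<Phi>) a b (bas ((x, c) # w)) =
      bpure V (cb n # Rs) a b ((x, c) # v)" if "x \<in> cb n a c"
    using tc[of "one_tens R V (fquiv (cb n))" x "[cb n]" "[(x, c)]"] that assms(2)
    by (simp add: id_blk_def ftilde_sel(1,2) one_tens_single)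
  show "tens_path R V (comult_blk X p q # \<Phi>) a b (bas ((x, c) # w)) =
      bpure V (cb p # cb q # Rs) a b ((sact K p (p + q) (seg 0 p) x, vertex K (p + q) p x) #
        (sact K q (p + q) (seg p q) x, c) # v)" if "x \<in> cb (p + q) a c"
    using tc[where \<phi> = "comult X p q", OF comult_single[OF that] comult_path[OF that]]
    by (simp add: comult_blk_def ftilde_sel(1,2))
  show "tens_path R V (tact_blk R X m n f # \<Phi>) a b (bas ((x, c) # w)) =
      bpure V (cb m # Rs) a b ((sact K m n f x, c) # v)" if "x \<in> cb n a c" "f \<in> Delta_f m n"
    using tc[of "\<lambda>a b x. one_tens R V (fquiv (cb m)) a b (tact X m n f a b x)" x "[cb m]"
        "[(sact K m n f x, c)]"] that assms(2)
    by (simp add: tact_blk_def ftilde_sel(1,2) one_tens_single tact_single sact_f_cells_between[OF K])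
  show "tens_path R V (counit_blk R X # \<Phi>) a b (bas ((x, c) # w)) = bpure V Rs a b v" if "x \<in> cb 0 a c"
  proof -
    have "a = c" using that by (auto simp: cells_between_0[OF K] split: if_splits)
    thus ?thesis
      using tc[of "\<lambda>a b x. unit_tens R V a b (counit X a b x)" x "[]" "[]"] that assms(2)
      by (simp add: counit_blk_def ftilde_sel(1,2) counit_single unit_tens_one)
  qed
qed

lemma tens_map_basis:
  assumes "qmaps_ok V (map fquiv Bs) \<Phi>" "a \<in> V" "w \<in> bpaths V Bs a b"
  shows "tens_map R V \<Phi> a b (bpure V Bs a b w) = tens_path R V \<Phi> a b (bas w)"
  unfolding bpure_def by (rule tens_map_pure[OF assms(1) _ assms(2) bas_closed[OF assms(3)]]) simp

lemma tens_map_hom':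
  assumes "qmaps_ok V (map fquiv Bs) \<Phi>" "concat (map fst \<Phi>) = map fquiv Rs" "a \<in> V"
  shows "tens_map R V \<Phi> a b \<in> mod_hom R (qtensor R V (map fquiv Bs) a b) (qtensor R V (map fquiv Rs) a b)"
  using tens_map_hom[OF assms(1) _ assms(3), of b] assms(2) by simp

lemma fquiv_hom_eqI:
  assumes "module R N" "h \<in> mod_hom R (fquiv B a b) N" "h' \<in> mod_hom R (fquiv B a b) N"
    "\<And>x. x \<in> B a b \<Longrightarrow> h (single R x) = h' (single R x)" "f \<in> carrier (fquiv B a b)"
  shows "h f = h' f"
  using free_hom_eqI[of N h "B a b" h' f] assms by (simp add: fquiv_def)

text \<open>On a simplex, both sides restrict along the same two maps, because \<open>f + g\<close>
  is \<open>f\<close> on the front part and a shifted \<open>g\<close> on the back part; these are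
  the equations \<open>c1\<close> and \<open>c2\<close>.\<close>

lemma comult_natural:
  assumes fg: "f \<in> Delta_f p p'" "g \<in> Delta_f q q'" and ab: "a \<in> V" "b \<in> V"
    and u: "u \<in> carrier (fquiv (cb (p' + q')) a b)"
  shows "comult X p q a b (tact X (p + q) (p' + q') (dplus p p' q f g) a b u) =
    tens_map R V [tact_blk R X p p' f, tact_blk R X q q' g] a b (comult X p' q' a b u)"
proof -
  let ?d = "dplus p p' q f g"
  note D = DeltaD[OF Delta_fD(1)[OF fg(1)]] DeltaD[OF Delta_fD(1)[OF fg(2)]] Delta_fD(2,3)[OF fg(1)]
    Delta_fD(2,3)[OF fg(2)]
  have "?d \<in> Delta (p + q) (p' + q')"
  proof (rule DeltaI)
    fix i j assume ij: "i \<le> j" "j \<le> p + q"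
    show "?d i \<le> ?d j"
      using ij D(1)[of i] D(2)[of i j] D(5)[of "i - p" "j - p"] by (auto simp: dplus_def)
  next
    fix i assume i: "i \<le> p + q"
    show "?d i \<le> p' + q'" using i D(1)[of i] D(4)[of "i - p"] by (auto simp: dplus_def)
  qed (simp add: dplus_def)
  moreover have "?d (p + q) = p' + q'" using D by (cases "q = 0") (auto simp: dplus_def)
  ultimately have d: "?d \<in> Delta_f (p + q) (p' + q')" using D by (simp add: Delta_f_def dplus_def)
  have c1: "compose {..p} ?d (seg 0 p) = compose {..p} (seg 0 p') f"
    using D(1) by (auto simp: compose_def seg_def dplus_def)
  have c2: "compose {..q} ?d (seg p q) = compose {..q} (seg p' q') g"
    using D(4) D(7-10) by (auto simp: compose_def seg_def dplus_def)
  have dp: "?d p = p'" using D by (simp add: dplus_def)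
  have ok: "qmaps_ok V (map fquiv [cb p', cb q']) [tact_blk R X p p' f, tact_blk R X q q' g]"
    by (simp add: qmaps_ok_blk fg)
  show ?thesis
  proof (rule fquiv_hom_eqI[OF _ mod_hom_comp[OF tact_hom[OF d] comult_hom]
      mod_hom_comp[OF comult_hom tens_map_hom'[OF ok _ ab(1)]] _ u])
    fix x assume x: "x \<in> cb (p' + q') a b"
    let ?v = "vertex K (p' + q') p' x"
    have v: "?v \<in> V" using x vertex_closed[OF K] by (simp add: cells_between_def)
    have xc: "x \<in> cells K (p' + q')" using x by (simp add: cells_between_def)
    have x1: "sact K p' (p' + q') (seg 0 p') x \<in> cb p' a ?v"
      and x2: "sact K q' (p' + q') (seg p' q') x \<in> cb q' ?v b"
      using comult_path[OF x] by auto
    have "tens_path R V [tact_blk R X p p' f, tact_blk R X q q' g] a b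
       (bas [(sact K p' (p' + q') (seg 0 p') x, ?v), (sact K q' (p' + q') (seg p' q') x, b)]) =
      bpure V [cb p, cb q] a b [(sact K p p' f (sact K p' (p' + q') (seg 0 p') x), ?v),
        (sact K q q' g (sact K q' (p' + q') (seg p' q') x), b)]"
      by (rule tens_path_blk(3)[OF ab(1) v tens_path_blk(3)[OF v ab(2) tens_path_Nil_basis _ _ x2 fg(2)] _ _ x1 fg(1)])
        (use x2 fg(2) ab in \<open>auto simp: fst_blk sact_f_cells_between[OF K]\<close>)
    also have "\<dots> = comult X p q a b (tact X (p + q) (p' + q') ?d a b (single R x))"
      by (simp add: tact_single[OF d x] comult_single[OF sact_f_cells_between[OF K d x]]
        sact_comp[OF K _ _ xc] seg_Delta Delta_fD[OF d] Delta_fD[OF fg(1)] Delta_fD[OF fg(2)] c1 c2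
        vertex_sact[OF K _ xc] dp)
    finally show "comult X p q a b (tact X (p + q) (p' + q') ?d a b (single R x)) =
      tens_map R V [tact_blk R X p p' f, tact_blk R X q q' g] a b (comult X p' q' a b (single R x))"
      by (simp add: comult_single[OF x] tens_map_basis[OF ok ab(1) comult_path[OF x]])
  qed (simp_all add: fst_blk qtensor_module)
qed

text \<open>Both sides send a simplex to its front, middle and back restrictions; \<open>P\<close>
  and \<open>Q\<close> compare each side with this common value.\<close>

lemma comult_coassoc:
  assumes ab: "a \<in> V" "b \<in> V" and u: "u \<in> carrier (fquiv (cb (p + q + r)) a b)"
  shows "tens_map R V [comult_blk X p q, id_blk R X r] a b (comult X (p + q) r a b u) =
    tens_map R V [id_blk R X p, comult_blk X q r] a b (comult X p (q + r) a b u)"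
proof -
  have ok1: "qmaps_ok V (map fquiv [cb (p + q), cb r]) [comult_blk X p q, id_blk R X r]"
    and ok2: "qmaps_ok V (map fquiv [cb p, cb (q + r)]) [id_blk R X p, comult_blk X q r]"
    by (simp_all add: qmaps_ok_blk)
  have h2: "comult X p (q + r) a b \<in> mod_hom R (fquiv (cb (p + q + r)) a b) (qtensor R V (map fquiv [cb p, cb (q + r)]) a b)"
    using comult_hom[of p "q + r" a b] by (simp add: add.assoc)
  show ?thesis
  proof (rule fquiv_hom_eqI[OF _ mod_hom_comp[OF comult_hom tens_map_hom'[where Rs = "[cb p, cb q, cb r]", OF ok1 _ ab(1)]]
      mod_hom_comp[OF h2 tens_map_hom'[where Rs = "[cb p, cb q, cb r]", OF ok2 _ ab(1)]] _ u])
    fix x assume x: "x \<in> cb (p + q + r) a b"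
    hence x': "x \<in> cb (p + (q + r)) a b" by (simp add: add.assoc)
    have xc: "x \<in> cells K (p + (q + r))" using x' by (simp add: cells_between_def)
    let ?n = "p + (q + r)"
    let ?v = "vertex K ?n p x" and ?w = "vertex K ?n (p + q) x"
    have v: "?v \<in> V" "?w \<in> V" using xc vertex_closed[OF K] by simp_all
    have P: "bpure V [cb p, cb q, cb r] a b [(sact K p ?n (seg 0 p) x, ?v), (sact K q ?n (seg p q) x, ?w),
        (sact K r ?n (seg (p + q) r) x, b)] =
      tens_map R V [comult_blk X p q, id_blk R X r] a b (comult X (p + q) r a b (single R x))"
    proof -
      have x1: "sact K (p + q) ?n (seg 0 (p + q)) x \<in> cb (p + q) a ?w"
        and x2: "sact K r ?n (seg (p + q) r) x \<in> cb r ?w b"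
        using comult_path[OF x] by (auto simp: add.assoc)
      have "tens_path R V [comult_blk X p q, id_blk R X r] a b
         (bas [(sact K (p + q) ?n (seg 0 (p + q)) x, ?w), (sact K r ?n (seg (p + q) r) x, b)]) =
        bpure V [cb p, cb q, cb r] a b
         [(sact K p (p + q) (seg 0 p) (sact K (p + q) ?n (seg 0 (p + q)) x),
            vertex K (p + q) p (sact K (p + q) ?n (seg 0 (p + q)) x)),
          (sact K q (p + q) (seg p q) (sact K (p + q) ?n (seg 0 (p + q)) x), ?w),
          (sact K r ?n (seg (p + q) r) x, b)]"
        by (rule tens_path_blk(2)[OF ab(1) v(2) tens_path_blk(1)[OF v(2) ab(2) tens_path_Nil_basis _ _ x2] _ _ x1])
          (use x2 ab in \<open>auto simp: fst_blk\<close>)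
      thus ?thesis
        using comult_single[OF x] tens_map_basis[OF ok1 ab(1) comult_path[OF x]]
        by (simp add: add.assoc sact_comp[OF K _ _ xc] vertex_sact[OF K _ xc] seg_Delta compose_seg_seg)
          (simp add: seg_def)
    qed
    have Q: "bpure V [cb p, cb q, cb r] a b [(sact K p ?n (seg 0 p) x, ?v), (sact K q ?n (seg p q) x, ?w),
        (sact K r ?n (seg (p + q) r) x, b)] =
      tens_map R V [id_blk R X p, comult_blk X q r] a b (comult X p (q + r) a b (single R x))"
    proof -
      have x1: "sact K p ?n (seg 0 p) x \<in> cb p a ?v"
        and x2: "sact K (q + r) ?n (seg p (q + r)) x \<in> cb (q + r) ?v b"
        using comult_path[OF x'] by auto
      have "tens_path R V [id_blk R X p, comult_blk X q r] a b
         (bas [(sact K p ?n (seg 0 p) x, ?v), (sact K (q + r) ?n (seg p (q + r)) x, b)]) =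
        bpure V [cb p, cb q, cb r] a b
         [(sact K p ?n (seg 0 p) x, ?v),
          (sact K q (q + r) (seg 0 q) (sact K (q + r) ?n (seg p (q + r)) x),
            vertex K (q + r) q (sact K (q + r) ?n (seg p (q + r)) x)),
          (sact K r (q + r) (seg q r) (sact K (q + r) ?n (seg p (q + r)) x), b)]"
        by (rule tens_path_blk(1)[OF ab(1) v(1) tens_path_blk(2)[OF v(1) ab(2) tens_path_Nil_basis _ _ x2] _ _ x1])
          (use comult_path[OF x2] ab in \<open>auto simp: fst_blk\<close>)
      thus ?thesis
        using comult_single[OF x'] tens_map_basis[OF ok2 ab(1) comult_path[OF x']]
        by (simp add: sact_comp[OF K _ _ xc] vertex_sact[OF K _ xc] seg_Delta compose_seg_seg)
          (simp add: seg_def)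
    qed
    show "tens_map R V [comult_blk X p q, id_blk R X r] a b (comult X (p + q) r a b (single R x)) =
      tens_map R V [id_blk R X p, comult_blk X q r] a b (comult X p (q + r) a b (single R x))"
      using P Q by simp
  qed (simp_all add: fst_blk qtensor_module)
qed

lemma comult_counit:
  assumes ab: "a \<in> V" "b \<in> V" and u: "u \<in> carrier (fquiv (cb n) a b)"
  shows "tens_map R V [counit_blk R X, id_blk R X n] a b (comult X 0 n a b u) =
      one_tens R V (fquiv (cb n)) a b u" (is ?l)
    and "tens_map R V [id_blk R X n, counit_blk R X] a b (comult X n 0 a b u) =
      one_tens R V (fquiv (cb n)) a b u" (is ?r)
proof -
  have ok1: "qmaps_ok V (map fquiv [cb 0, cb n]) [counit_blk R X, id_blk R X n]"
    and ok2: "qmaps_ok V (map fquiv [cb n, cb 0]) [id_blk R X n, counit_blk R X]"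
    by (simp_all add: qmaps_ok_blk)
  have h: "comult X 0 n a b \<in> mod_hom R (fquiv (cb n) a b) (qtensor R V (map fquiv [cb 0, cb n]) a b)"
    "comult X n 0 a b \<in> mod_hom R (fquiv (cb n) a b) (qtensor R V (map fquiv [cb n, cb 0]) a b)"
    using comult_hom[of 0 n a b] comult_hom[of n 0 a b] by simp_all
  show ?l
  proof (rule fquiv_hom_eqI[OF _ mod_hom_comp[OF h(1) tens_map_hom'[OF ok1 _ ab(1)]]
      fquiv_one_tens_hom[OF ab] _ u])
    fix x assume x: "x \<in> cb n a b"
    hence x': "x \<in> cb (0 + n) a b" by simp
    have xc: "x \<in> cells K n" "vertex K n 0 x = a" using x by (simp_all add: cells_between_def)
    have x1: "sact K 0 n (seg 0 0) x \<in> cb 0 a a"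
      using comult_path[OF x'] xc by auto
    have "tens_path R V [counit_blk R X, id_blk R X n] a b
       (bas [(sact K 0 n (seg 0 0) x, a), (x, b)]) = bpure V [cb n] a b [(x, b)]"
      by (rule tens_path_blk(4)[OF ab(1) ab(1) tens_path_blk(1)[OF ab tens_path_Nil_basis _ _ x] _ _ x1])
        (use x ab in \<open>auto simp: fst_blk\<close>)
    thus "tens_map R V [counit_blk R X, id_blk R X n] a b (comult X 0 n a b (single R x)) =
      one_tens R V (fquiv (cb n)) a b (single R x)"
      using comult_single[OF x'] tens_map_basis[OF ok1 ab(1) comult_path[OF x']] xc
      by (simp add: sact_id[OF K] one_tens_single)
  qed (simp_all add: fst_blk qtensor_module)
  show ?r
  proof (rule fquiv_hom_eqI[OF _ mod_hom_comp[OF h(2) tens_map_hom'[OF ok2 _ ab(1)]]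
      fquiv_one_tens_hom[OF ab] _ u])
    fix x assume x: "x \<in> cb n a b"
    hence x': "x \<in> cb (n + 0) a b" by simp
    have xc: "x \<in> cells K n" "vertex K n n x = b" using x by (simp_all add: cells_between_def)
    have x2: "sact K 0 n (seg n 0) x \<in> cb 0 b b"
      using comult_path[OF x'] xc by auto
    have "tens_path R V [id_blk R X n, counit_blk R X] a b
       (bas [(x, b), (sact K 0 n (seg n 0) x, b)]) = bpure V [cb n] a b [(x, b)]"
      by (rule tens_path_blk(1)[OF ab(1) ab(2) tens_path_blk(4)[OF ab(2,2) tens_path_Nil_basis _ _ x2] _ _ x])
        (use x2 ab in \<open>auto simp: fst_blk\<close>)
    thus "tens_map R V [id_blk R X n, counit_blk R X] a b (comult X n 0 a b (single R x)) =
      one_tens R V (fquiv (cb n)) a b (single R x)"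
      using comult_single[OF x'] tens_map_basis[OF ok2 ab(1) comult_path[OF x']] xc
      by (simp add: sact_id[OF K] one_tens_single)
  qed (simp_all add: fst_blk qtensor_module)
qed

lemma tact_comp:
  assumes "f \<in> Delta_f l m" "g \<in> Delta_f m n" "u \<in> carrier (fquiv (cb n) a b)"
  shows "tact X l n (compose {..l} g f) a b u = tact X l m f a b (tact X m n g a b u)"
proof (rule fquiv_hom_eqI[OF _ tact_hom[OF compose_Delta_f[OF assms(1,2)]]
      mod_hom_comp[OF tact_hom[OF assms(2)] tact_hom[OF assms(1)]] _ assms(3)])
  fix x assume x: "x \<in> cb n a b"
  thus "tact X l n (compose {..l} g f) a b (single R x) = tact X l m f a b (tact X m n g a b (single R x))"
    using assms sact_comp[OF K, of f l m g n x]
    by (simp add: tact_single compose_Delta_f sact_f_cells_between[OF K] Delta_fD cells_betweenD[OF K x])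
qed simp

lemma tact_id:
  assumes "u \<in> carrier (fquiv (cb n) a b)"
  shows "tact X n n (seg 0 n) a b u = u"
proof -
  have i: "seg 0 n \<in> Delta_f n n" using seg_Delta[of 0 n n] by (simp add: Delta_f_def seg_def)
  show ?thesis
  proof (rule fquiv_hom_eqI[OF _ tact_hom[OF i] mod_hom_id _ assms])
    fix x assume x: "x \<in> cb n a b"
    thus "tact X n n (seg 0 n) a b (single R x) = single R x"
      using tact_single[OF i x] sact_id[OF K] by (simp add: cells_between_def)
  qed simp
qed

lemma templicial_module_ftilde: "templicial_module R X"
  unfolding templicial_module_def Let_def ftilde_sel(1,2) seg_0
  using comult_hom comult_natural comult_coassoc comult_counit tact_comp tact_id tact_hom counit_hom
    counit_bij
  by simp

end


section \<open>Necklaces\<close>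

text \<open>Lists of beads are handled as chains of pairs. Unlike sorted lists of joints, chains can
  be split and appended without repeating the joint in the middle.\<close>

fun linked :: "(nat \<times> nat) list \<Rightarrow> nat \<Rightarrow> nat \<Rightarrow> bool" where
  "linked [] x y \<longleftrightarrow> x = y"
| "linked ((s, t) # L) x y \<longleftrightarrow> s = x \<and> linked L t y"

lemma linked_append: "linked (L @ M) x y \<longleftrightarrow> (\<exists>z. linked L x z \<and> linked M z y)"
  by (induction L x y rule: linked.induct) auto

definition incr :: "(nat \<times> nat) list \<Rightarrow> bool" where
  "incr L \<longleftrightarrow> (\<forall>(s, t)\<in>set L. s < t)"

lemma incr_simps [simp]: "incr []" "incr ((s, t) # L) \<longleftrightarrow> s < t \<and> incr L" "incr (L @ M) \<longleftrightarrow> incr L \<and> incr M"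
  by (auto simp: incr_def)

lemma linked_bounds:
  "linked L x y \<Longrightarrow> incr L \<Longrightarrow> x \<le> y \<and> (\<forall>(s, t)\<in>set L. x \<le> s \<and> s < t \<and> t \<le> y)"
  by (induction L x y rule: linked.induct) fastforce+

lemma linked_cover:
  "linked L x y \<Longrightarrow> incr L \<Longrightarrow> x \<le> r \<Longrightarrow> r \<le> y \<Longrightarrow> x < y \<Longrightarrow> \<exists>(s, t)\<in>set L. s \<le> r \<and> r \<le> t"
proof (induction L x y rule: linked.induct)
  case (2 s t L x y)
  show ?case
  proof (cases "r \<le> t")
    case False
    thus ?thesis using 2 linked_bounds[of L t y] by fastforce
  qed (use 2 in auto)
qed auto

lemma linked_gap:
  "linked L x y \<Longrightarrow> incr L \<Longrightarrow> (s, t) \<in> set L \<Longrightarrow> u \<in> insert x (snd ` set L) \<Longrightarrow> u \<le> s \<or> t \<le> u"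
proof (induction L x y rule: linked.induct)
  case (2 s' t' L x y)
  have b: "linked L t' y" "incr L" using 2 by auto
  note lb = linked_bounds[OF b]
  show ?case
  proof (cases "(s, t) = (s', t')")
    case True
    thus ?thesis using 2 lb by fastforce
  next
    case False
    hence st: "(s, t) \<in> set L" using 2 by auto
    show ?thesis
    proof (cases "u \<in> insert t' (snd ` set L)")
      case True
      thus ?thesis using 2 st by auto
    next
      case False
      hence "u = x" using 2 by auto
      thus ?thesis using 2 st lb by fastforce
    qed
  qed
qed auto

lemma steps_linked_aux:
  "sorted_wrt (<) (x # ts) \<Longrightarrow> linked (zip (x # ts) ts) x (last (x # ts)) \<and> incr (zip (x # ts) ts) \<and>
    insert x (snd ` set (zip (x # ts) ts)) = set (x # ts)"
  by (induction ts arbitrary: x) auto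

lemma steps_linked:
  assumes "finite T" "x \<in> T" "y \<in> T" "T \<subseteq> {x..y}"
  shows "linked (steps T) x y" "incr (steps T)" "insert x (snd ` set (steps T)) = T"
proof -
  let ?l = "sorted_list_of_set T"
  have l: "set ?l = T" "sorted_wrt (<) ?l" using assms by auto
  obtain x' ts where ts: "?l = x' # ts" using l assms by (cases ?l) auto
  have x': "x' = x" using l assms unfolding ts by fastforce
  have "last (x # ts) = y"
  proof -
    have "last (x # ts) \<in> T" using l(1) ts x' last_in_set[of "x # ts"] by simp
    moreover have "z \<le> last (x # ts)" if z: "z \<in> T" for z
    proof -
      have "z \<in> set (x # ts)" using z l(1) ts x' by simp
      then obtain i where i: "i < length (x # ts)" "(x # ts) ! i = z" unfolding in_set_conv_nth by blast
      have "sorted (x # ts)" using ts x' by (metis sorted_sorted_list_of_set)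
      from sorted_nth_mono[OF this, of i "length ts"] i show ?thesis by (subst last_conv_nth) auto
    qed
    ultimately show ?thesis using assms by (metis atLeastAtMost_iff le_antisym subsetD)
  qed
  thus "linked (steps T) x y" "incr (steps T)" "insert x (snd ` set (steps T)) = T"
    using steps_linked_aux[of x ts] l ts x' by (auto simp: steps_def Let_def)
qed

lemma steps_linked_restrict:
  assumes "finite T" "s \<in> T" "t \<in> T" "s \<le> t"
  shows "linked (steps {r \<in> T. s \<le> r \<and> r \<le> t}) s t" "incr (steps {r \<in> T. s \<le> r \<and> r \<le> t})"
    "insert s (snd ` set (steps {r \<in> T. s \<le> r \<and> r \<le> t})) = {r \<in> T. s \<le> r \<and> r \<le> t}"
proof -
  have "{r \<in> T. s \<le> r \<and> r \<le> t} \<subseteq> {s..t}" by auto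
  note l = steps_linked[OF _ _ _ this]
  show "linked (steps {r \<in> T. s \<le> r \<and> r \<le> t}) s t" "incr (steps {r \<in> T. s \<le> r \<and> r \<le> t})"
    "insert s (snd ` set (steps {r \<in> T. s \<le> r \<and> r \<le> t})) = {r \<in> T. s \<le> r \<and> r \<le> t}"
    by (rule l; use assms in simp)+
qed

lemma sorted_list_of_set_insert_less:
  "finite A \<Longrightarrow> \<forall>a\<in>A. x < a \<Longrightarrow> sorted_list_of_set (insert x A) = x # sorted_list_of_set (A :: nat set)"
  by (subst sorted_list_of_set_unique[symmetric]) auto

text \<open>The characterisation of \<open>steps\<close> by which it is computed below: an
  increasing chain is the list of beads of its set of points.\<close>

lemma steps_unique:
  "linked L x y \<Longrightarrow> incr L \<Longrightarrow> steps (insert x (snd ` set L)) = L"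
proof (induction L x y rule: linked.induct)
  case (1 x y)
  thus ?case by (simp add: steps_def)
next
  case (2 s t L x y)
  let ?T = "insert t (snd ` set L)"
  have b: "linked L t y" "incr L" and xt: "x < t" using 2 by auto
  have gt: "\<forall>u\<in>?T. t \<le> u" using linked_bounds[OF b] by fastforce
  hence "sorted_list_of_set (insert x ?T) = x # sorted_list_of_set ?T"
    using xt by (intro sorted_list_of_set_insert_less) auto
  moreover have "sorted_list_of_set ?T = t # sorted_list_of_set (?T - {t})"
  proof -
    have "sorted_list_of_set (insert t (?T - {t})) = t # sorted_list_of_set (?T - {t})"
      by (intro sorted_list_of_set_insert_less) (use gt in \<open>auto simp: order.order_iff_strict\<close>)
    thus ?thesis by (simp add: insert_absorb)
  qed
  ultimately have "steps (insert x ?T) = (x, t) # steps ?T" by (simp add: steps_def)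
  thus ?case using 2 b by (simp add: insert_commute)
qed

lemma linked_map: "linked L x y \<Longrightarrow> linked (map (map_prod f f) L) (f x) (f y)"
  by (induction L x y rule: linked.induct) auto

lemma linked_filter: "linked L x y \<Longrightarrow> linked (filter (\<lambda>(s, t). s \<noteq> t) L) x y"
  by (induction L x y rule: linked.induct) auto

lemma linked_filter_points:
  "linked L x y \<Longrightarrow> insert x (snd ` set (filter (\<lambda>(s, t). s \<noteq> t) L)) = insert x (snd ` set L)"
proof (induction L x y rule: linked.induct)
  case (2 s t L x y)
  hence "insert t (snd ` set (filter (\<lambda>(s, t). s \<noteq> t) L)) = insert t (snd ` set L)" by simp
  thus ?case using 2 by (cases "s = t") (auto simp: insert_commute)
qed simp

text \<open>Subdividing every bead of a coarser chain gives an increasing chain with the points of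
  \<open>T\<close>, so uniqueness identifies it with the beads of \<open>T\<close>.\<close>

lemma steps_concat:
  assumes "linked L x y" "incr L" "finite T" "insert x (snd ` set L) \<subseteq> T" "T \<subseteq> {x..y}"
  shows "concat (map (\<lambda>(s, t). steps {r \<in> T. s \<le> r \<and> r \<le> t}) L) = steps T"
proof -
  let ?c = "\<lambda>L. concat (map (\<lambda>(s, t). steps {r \<in> T. s \<le> r \<and> r \<le> t}) L)"
  note blk = steps_linked_restrict[OF assms(3)]
  have "linked (?c L) x y \<and> incr (?c L) \<and> insert x (snd ` set (?c L)) = {r \<in> T. x \<le> r \<and> r \<le> y}"
    using assms(1,2,4)
  proof (induction L x y rule: linked.induct)
    case (1 x y)
    thus ?case by auto
  next
    case (2 s t L x y)
    have st: "s \<in> T" "t \<in> T" "s < t" "s = x" using 2 by auto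
    have IH: "linked (?c L) t y" "incr (?c L)" "insert t (snd ` set (?c L)) = {r \<in> T. t \<le> r \<and> r \<le> y}"
      using 2 by auto
    have ty: "t \<le> y" using linked_bounds[of L t y] 2 by auto
    note b = blk[OF st(1,2) less_imp_le[OF st(3)]]
    have "insert x (snd ` set (?c ((s, t) # L))) =
      insert s (snd ` set (steps {r \<in> T. s \<le> r \<and> r \<le> t})) \<union> insert t (snd ` set (?c L))"
    proof -
      have "t \<in> insert s (snd ` set (steps {r \<in> T. s \<le> r \<and> r \<le> t}))"
        unfolding b(3) using st by simp
      thus ?thesis
        unfolding list.map concat.simps set_append image_Un split_conv st(4)[symmetric] by blast
    qed
    also have "\<dots> = {r \<in> T. x \<le> r \<and> r \<le> y}"
      unfolding b(3) IH(3) using st ty by auto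
    finally show ?case using b IH st by (auto simp: linked_append)
  qed
  moreover have "{r \<in> T. x \<le> r \<and> r \<le> y} = T" using assms(5) by auto
  ultimately show ?thesis using steps_unique[of "?c L" x y] by auto
qed

text \<open>Translating each bead to start at \<open>0\<close>, as the definition of inert maps
  does, leaves the differences unchanged.\<close>

lemma gaps_shift:
  assumes "finite A" "s \<in> A" "t \<in> A" "A \<subseteq> {s..t}"
  shows "gaps {r - s | r. r \<in> A} = map (\<lambda>(x, y). y - x) (steps A)"
proof -
  note l = steps_linked[OF assms]
  let ?f = "\<lambda>r. r - s"
  let ?L = "map (map_prod ?f ?f) (steps A)"
  have lk: "linked ?L 0 (t - s)" using linked_map[OF l(1), of ?f] by simp
  have inc: "incr ?L" using linked_bounds[OF l(1,2)] by (fastforce simp: incr_def)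
  have "insert 0 (snd ` set ?L) = ?f ` insert s (snd ` set (steps A))" by (auto simp: image_image)
  also have "\<dots> = {r - s | r. r \<in> A}" unfolding l(3) by auto
  finally have "steps {r - s | r. r \<in> A} = ?L" using steps_unique[OF lk inc] by simp
  thus ?thesis using linked_bounds[OF l(1,2)] by (fastforce simp: gaps_def)
qed

lemma diffs_sum: "linked L x y \<Longrightarrow> incr L \<Longrightarrow> sum_list (map (\<lambda>(s, t). t - s) L) = y - x"
proof (induction L x y rule: linked.induct)
  case (2 s t L x y)
  thus ?case using linked_bounds[of L t y] by auto
qed simp

lemma steps_nec:
  assumes "is_necklace (U, q)"
  shows "linked (steps U) 0 q" "incr (steps U)" "insert 0 (snd ` set (steps U)) = U" "finite U"
proof -
  have U: "finite U" "0 \<in> U" "q \<in> U" "U \<subseteq> {0..q}"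
    using assms finite_subset[of U "{..q}"] by (auto simp: is_necklace_def)
  show "linked (steps U) 0 q" "incr (steps U)" "insert 0 (snd ` set (steps U)) = U" "finite U"
    using steps_linked[OF U] U by auto
qed

lemma steps_nec_gap:
  assumes "is_necklace (U, q)" "(s, t) \<in> set (steps U)"
  shows "s < t" "t \<le> q" "\<forall>u\<in>U. u \<le> s \<or> t \<le> u" "s \<in> U" "t \<in> U"
proof -
  note st = steps_nec[OF assms(1)]
  show "s < t" "t \<le> q" using linked_bounds[OF st(1,2)] assms(2) by auto
  show gap: "\<forall>u\<in>U. u \<le> s \<or> t \<le> u" using linked_gap[OF st(1,2) assms(2)] unfolding st(3) by blast
  show "t \<in> U" using st(3) assms(2) by force
  show "s \<in> U" using assms(2) by (auto simp: steps_def Let_def st(4) dest!: set_zip_leftD)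
qed

section \<open>Gaps of inert and active maps\<close>

definition inert_ns :: "nat set \<Rightarrow> nat \<Rightarrow> nat \<Rightarrow> nat list" where
  "inert_ns T s t = gaps {r - s | r. r \<in> T \<and> s \<le> r \<and> r \<le> t}"

lemma inert_ns_eq:
  assumes "finite T" "s \<in> T" "t \<in> T" "s < t"
  shows "inert_ns T s t = map (\<lambda>(x, y). y - x) (steps {r \<in> T. s \<le> r \<and> r \<le> t})"
proof -
  have "{r \<in> T. s \<le> r \<and> r \<le> t} \<subseteq> {s..t}" by auto
  from gaps_shift[OF _ _ _ this] show ?thesis using assms by (simp add: inert_ns_def)
qed

lemma concat_inert_ns:
  assumes U: "is_necklace (U, q)" and T: "is_necklace (T, q)" and UT: "U \<subseteq> T"
  shows "concat (map (\<lambda>(s, t). inert_ns T s t) (steps U)) = gaps T"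
proof -
  have "concat (map (\<lambda>(s, t). inert_ns T s t) (steps U)) =
    concat (map (\<lambda>(s, t). map (\<lambda>(x, y). y - x) (steps {r \<in> T. s \<le> r \<and> r \<le> t})) (steps U))"
  proof (intro arg_cong[where f = concat] map_cong refl, clarify)
    fix s t assume "(s, t) \<in> set (steps U)"
    from steps_nec_gap[OF U this] UT
    show "inert_ns T s t = map (\<lambda>(x, y). y - x) (steps {r \<in> T. s \<le> r \<and> r \<le> t})"
      by (intro inert_ns_eq[OF steps_nec(4)[OF T]]) auto
  qed
  also have "\<dots> = map (\<lambda>(x, y). y - x) (concat (map (\<lambda>(s, t). steps {r \<in> T. s \<le> r \<and> r \<le> t}) (steps U)))"
    by (simp add: map_concat case_prod_beta' o_def)
  also have "concat (map (\<lambda>(s, t). steps {r \<in> T. s \<le> r \<and> r \<le> t}) (steps U)) = steps T"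
    using steps_nec[OF U] T UT by (intro steps_concat) (auto simp: is_necklace_def steps_nec(4)[OF T])
  finally show ?thesis by (simp add: gaps_def)
qed

definition act_ds :: "nat set \<Rightarrow> (nat \<Rightarrow> nat) \<Rightarrow> nat list" where
  "act_ds T f = map (\<lambda>(s, t). f t - f s) (steps T)"

lemma nec_image:
  assumes "is_necklace (T, p)" "f \<in> Delta_f p q"
  shows "is_necklace (f ` T, q)"
proof -
  have T: "T \<subseteq> {..p}" "0 \<in> T" "p \<in> T" using assms by (auto simp: is_necklace_def)
  note f = Delta_fD[OF assms(2)]
  have "f ` T \<subseteq> {..q}" using T(1) DeltaD(1)[OF f(1)] by auto
  moreover have "f 0 \<in> f ` T" "f p \<in> f ` T" using T by auto
  ultimately show ?thesis by (simp add: is_necklace_def f)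
qed

text \<open>By monotonicity the images of the beads still form a chain; the collapsed beads are its
  constant pairs, and removing them makes it increasing.\<close>

lemma steps_image:
  assumes T: "is_necklace (T, p)" and f: "f \<in> Delta_f p q"
  shows "steps (f ` T) = filter (\<lambda>(s, t). s \<noteq> t) (map (map_prod f f) (steps T))" (is "_ = ?L")
proof -
  note st = steps_nec[OF T] and g = steps_nec_gap[OF T]
  have lk: "linked ?L (f 0) (f p)" by (intro linked_filter linked_map st)
  have le: "f s \<le> f t" if "(s, t) \<in> set (steps T)" for s t
    using DeltaD(2)[OF Delta_fD(1)[OF f], of s t] g[OF that] by simp
  have inc: "incr ?L" using le by (fastforce simp: incr_def)
  have "insert (f 0) (snd ` set ?L) = insert (f 0) (snd ` set (map (map_prod f f) (steps T)))"
    by (rule linked_filter_points[OF linked_map[OF st(1)]])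
  also have "\<dots> = f ` insert 0 (snd ` set (steps T))" by (auto simp: image_image)
  also have "\<dots> = f ` T" unfolding st(3) ..
  finally show ?thesis using steps_unique[OF lk inc] by simp
qed

lemma gaps_image:
  assumes T: "is_necklace (T, p)" and f: "f \<in> Delta_f p q"
  shows "gaps (f ` T) = filter (\<lambda>d. d \<noteq> 0) (act_ds T f)"
proof -
  have le: "f s \<le> f t" if "(s, t) \<in> set (steps T)" for s t
    using DeltaD(2)[OF Delta_fD(1)[OF f], of s t] steps_nec_gap[OF T that] by simp
  have "map (\<lambda>(s, t). t - s) (filter (\<lambda>(s, t). s \<noteq> t) (map (map_prod f f) L)) =
      filter (\<lambda>d. d \<noteq> 0) (map (\<lambda>(s, t). f t - f s) L)" if "set L \<subseteq> set (steps T)" for L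
    using that
  proof (induction L)
    case (Cons st L)
    obtain s t where st: "st = (s, t)" by (cases st)
    show ?case using Cons le[of s t] by (auto simp: st)
  qed simp
  from this[OF subset_refl] show ?thesis by (simp add: gaps_def steps_image[OF T f] act_ds_def)
qed

lemma act_part:
  assumes T: "is_necklace (T, p)" and f: "f \<in> Delta_f p q" and st: "(s, t) \<in> set (steps T)"
  shows "(\<lambda>i\<in>{..t - s}. f (s + i) - f s) \<in> Delta_f (t - s) (f t - f s)"
proof -
  note g = steps_nec_gap[OF T st] and d = DeltaD[OF Delta_fD(1)[OF f]]
  have "(\<lambda>i\<in>{..t - s}. f (s + i) - f s) \<in> Delta (t - s) (f t - f s)"
    by (rule DeltaI) (use g d(2) in \<open>auto intro!: diff_le_mono\<close>)
  thus ?thesis using g by (simp add: Delta_f_def)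
qed

text \<open>This describes the simplices \<open>\<alpha>\<close> of \<open>\<Delta>^q\<close> that
  belong to the necklace: no joint lies strictly between their first and last vertex.\<close>

definition inbead :: "nat set \<Rightarrow> nat \<Rightarrow> (nat \<Rightarrow> nat) \<Rightarrow> bool" where
  "inbead U l \<alpha> \<longleftrightarrow> (\<forall>u\<in>U. u \<le> \<alpha> 0 \<or> \<alpha> l \<le> u)"

text \<open>A map \<open>w\<close> from the necklace \<open>\<Delta>\<^sup>U \<subseteq> \<Delta>\<^sup>q\<close>, the union of the simplices on the beads of
  \<open>U\<close>, to \<open>K\<close>. Precomposition makes functoriality in the necklace immediate.\<close>

definition nsimp :: "'x sset \<Rightarrow> nat set \<Rightarrow> nat \<Rightarrow> (nat \<Rightarrow> (nat \<Rightarrow> nat) \<Rightarrow> 'x) \<Rightarrow> bool" where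
  "nsimp K U q w \<longleftrightarrow> (\<forall>l. \<forall>\<alpha>\<in>Delta l q. inbead U l \<alpha> \<longrightarrow> w l \<alpha> \<in> cells K l \<and>
     (\<forall>m. \<forall>\<beta>\<in>Delta m l. sact K m l \<beta> (w l \<alpha>) = w m (compose {..m} \<alpha> \<beta>)))"

definition wsim :: "(nat \<Rightarrow> (nat \<Rightarrow> nat) \<Rightarrow> 'x) \<Rightarrow> nat \<Rightarrow> nat \<Rightarrow> 'x" where
  "wsim w s t = w (t - s) (seg s (t - s))"

definition wvert :: "(nat \<Rightarrow> (nat \<Rightarrow> nat) \<Rightarrow> 'x) \<Rightarrow> nat \<Rightarrow> 'x" where
  "wvert w t = w 0 (pt t)"

definition necl :: "nat set \<Rightarrow> (nat \<Rightarrow> (nat \<Rightarrow> nat) \<Rightarrow> 'x) \<Rightarrow> ('x \<times> 'x) list" where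
  "necl U w = map (\<lambda>(s, t). (wsim w s t, wvert w t)) (steps U)"

definition wpull :: "(nat \<Rightarrow> (nat \<Rightarrow> nat) \<Rightarrow> 'x) \<Rightarrow> (nat \<Rightarrow> nat) \<Rightarrow> nat \<Rightarrow> (nat \<Rightarrow> nat) \<Rightarrow> 'x" where
  "wpull w f = (\<lambda>l \<alpha>. w l (compose {..l} f \<alpha>))"

lemma nsimpD:
  assumes "nsimp K U q w" "\<alpha> \<in> Delta l q" "inbead U l \<alpha>"
  shows "w l \<alpha> \<in> cells K l" "\<beta> \<in> Delta m l \<Longrightarrow> sact K m l \<beta> (w l \<alpha>) = w m (compose {..m} \<alpha> \<beta>)"
  using assms by (auto simp: nsimp_def)

lemma nsimp_mono: "nsimp K U q w \<Longrightarrow> U \<subseteq> T \<Longrightarrow> nsimp K T q w"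
  by (auto simp: nsimp_def inbead_def subset_iff)

text \<open>Every joint of \<open>U\<close> is the image of a joint of \<open>T\<close>, so
  \<open>f\<close> takes a simplex inside one bead of \<open>T\<close> into one bead of
  \<open>U\<close>. This is where the defining condition on maps of necklaces is used.\<close>

lemma nsimp_pull:
  assumes w: "nsimp K U q w" and f: "f \<in> nec_hom (T, p) (U, q)" and T: "T \<subseteq> {..p}"
  shows "nsimp K T p (wpull w f)"
  unfolding nsimp_def
proof (intro allI ballI impI)
  fix l \<alpha> assume \<alpha>: "\<alpha> \<in> Delta l p" "inbead T l \<alpha>"
  have fD: "f \<in> Delta p q" and fT: "U \<subseteq> f ` T" using f by (auto simp: nec_hom_def Delta_f_def)
  have c: "compose {..l} f \<alpha> \<in> Delta l q" by (rule compose_Delta[OF \<alpha>(1) fD])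
  have "inbead U l (compose {..l} f \<alpha>)"
    unfolding inbead_def
  proof
    fix u assume "u \<in> U"
    then obtain t where t: "t \<in> T" "u = f t" using fT by auto
    have tp: "t \<le> p" using t T by auto
    from \<alpha>(2) t have "t \<le> \<alpha> 0 \<or> \<alpha> l \<le> t" by (auto simp: inbead_def)
    thus "u \<le> compose {..l} f \<alpha> 0 \<or> compose {..l} f \<alpha> l \<le> u"
      using DeltaD(2)[OF fD] DeltaD(1)[OF \<alpha>(1)] t tp by (auto simp: compose_def)
  qed
  note n = nsimpD[OF w c this]
  show "wpull w f l \<alpha> \<in> cells K l \<and>
    (\<forall>m. \<forall>\<beta>\<in>Delta m l. sact K m l \<beta> (wpull w f l \<alpha>) = wpull w f m (compose {..m} \<alpha> \<beta>))"
  proof (intro conjI allI ballI)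
    fix m \<beta> assume \<beta>: "\<beta> \<in> Delta m l"
    have "compose {..m} (compose {..l} f \<alpha>) \<beta> = compose {..m} f (compose {..m} \<alpha> \<beta>)"
      using DeltaD(1)[OF \<beta>] by (auto simp: compose_def)
    thus "sact K m l \<beta> (wpull w f l \<alpha>) = wpull w f m (compose {..m} \<alpha> \<beta>)"
      using n(2)[OF \<beta>] by (simp add: wpull_def)
  qed (use n in \<open>simp add: wpull_def\<close>)
qed

lemma pt_seg: "pt s = seg s 0"
  by (auto simp: pt_def seg_def)

lemma inbead_seg: "inbead U l (seg s l) \<longleftrightarrow> (\<forall>u\<in>U. u \<le> s \<or> s + l \<le> u)"
  by (simp add: inbead_def seg_def)

lemma wvert_wsim: "wvert w s = wsim w s s"
  by (simp add: wvert_def wsim_def pt_seg)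

lemma wvert_pull: "wvert (wpull w f) t = wvert w (f t)"
  by (simp add: wvert_def wpull_def compose_pt)

context
  fixes K :: "'x sset" and U q w
  assumes w: "nsimp K U q w"
begin

lemma wvert_closed: "t \<le> q \<Longrightarrow> wvert w t \<in> cells K 0"
  unfolding wvert_def by (rule nsimpD(1)[OF w pt_Delta]) (auto simp: inbead_def pt_def)

lemma wsim_closed:
  assumes "s \<le> t" "t \<le> q" "\<forall>u\<in>U. u \<le> s \<or> t \<le> u"
  shows "wsim w s t \<in> cells_between K (t - s) (wvert w s) (wvert w t)"
proof -
  have d: "seg s (t - s) \<in> Delta (t - s) q" using assms by (intro seg_Delta) simp
  have i: "inbead U (t - s) (seg s (t - s))" using assms by (simp add: inbead_seg)
  have "sact K 0 (t - s) (pt i) (wsim w s t) = wvert w (s + i)" if "i \<le> t - s" for i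
    using nsimpD(2)[OF w d i pt_Delta[OF that]] that by (simp add: wsim_def wvert_def compose_seg_pt)
  thus ?thesis
    using nsimpD(1)[OF w d i] assms by (simp add: cells_between_def wsim_def vertex_pt)
qed

lemma sact_wsim:
  assumes "s \<le> x" "x \<le> y" "y \<le> t" "t \<le> q" "\<forall>u\<in>U. u \<le> s \<or> t \<le> u"
  shows "sact K (y - x) (t - s) (seg (x - s) (y - x)) (wsim w s t) = wsim w x y"
proof -
  have d: "seg s (t - s) \<in> Delta (t - s) q" using assms by (intro seg_Delta) simp
  have i: "inbead U (t - s) (seg s (t - s))" using assms by (simp add: inbead_seg)
  have "seg (x - s) (y - x) \<in> Delta (y - x) (t - s)" using assms by (intro seg_Delta) auto
  from nsimpD(2)[OF w d i this] show ?thesis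
    using assms by (simp add: wsim_def compose_seg_seg)
qed

lemma vertex_wsim:
  assumes "s \<le> x" "x \<le> t" "t \<le> q" "\<forall>u\<in>U. u \<le> s \<or> t \<le> u"
  shows "vertex K (t - s) (x - s) (wsim w s t) = wvert w x"
  using sact_wsim[of s x x t] assms by (simp add: vertex_pt pt_seg wvert_wsim)

end

context cring
begin

lemma qmods_fquiv_comp [simp]: "qmods S (map (fquiv \<circ> f) ns)"
  unfolding map_map[symmetric] by (rule qmods_fquiv)

lemma bpaths_linked:
  assumes "linked L x y" "\<And>s t. (s, t) \<in> set L \<Longrightarrow> v t \<in> S \<and> F s t \<in> B s t (v s) (v t)"
  shows "map (\<lambda>(s, t). (F s t, v t)) L \<in> bpaths S (map (\<lambda>(s, t). B s t) L) (v x) (v y)"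
  using assms by (induction L x y rule: linked.induct) auto

lemma bpaths_linked_concat:
  assumes "linked L x y" "\<And>s t. (s, t) \<in> set L \<Longrightarrow> W s t \<in> bpaths S (B s t) (v s) (v t)"
  shows "concat (map (\<lambda>(s, t). W s t) L) \<in> bpaths S (concat (map (\<lambda>(s, t). B s t) L)) (v x) (v y)"
  using assms by (induction L x y rule: linked.induct) (auto intro: bpaths_append)

text \<open>The evaluation rule for one block per bead. The function \<open>v\<close> gives the
  vertices at the joints, so that consecutive blocks meet automatically.\<close>

lemma tens_path_linked:
  assumes "linked L x y" "v x \<in> S"
    "\<And>s t. (s, t) \<in> set L \<Longrightarrow> v t \<in> S \<and> W s t \<in> bpaths S (Ps s t) (v s) (v t) \<and>
      \<phi> s t (v s) (v t) (single R (F s t)) = bpure S (Ps s t) (v s) (v t) (W s t)"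
  shows "tens_path R S (map (\<lambda>(s, t). (map fquiv (Ps s t), \<phi> s t)) L) (v x) (v y)
      (bas (map (\<lambda>(s, t). (F s t, v t)) L)) =
    bpure S (concat (map (\<lambda>(s, t). Ps s t) L)) (v x) (v y) (concat (map (\<lambda>(s, t). W s t) L))"
  using assms
proof (induction L x y rule: linked.induct)
  case (1 x y)
  thus ?case by (simp add: tens_path_Nil_basis[simplified])
next
  case (2 s t L x y)
  have h: "v t \<in> S \<and> W s t \<in> bpaths S (Ps s t) (v s) (v t) \<and>
      \<phi> s t (v s) (v t) (single R (F s t)) = bpure S (Ps s t) (v s) (v t) (W s t)"
    by (rule 2(4)) simp
  have lk: "linked L t y" "s = x" using 2 by auto
  have IH: "tens_path R S (map (\<lambda>(s, t). (map fquiv (Ps s t), \<phi> s t)) L) (v t) (v y)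
      (bas (map (\<lambda>(s, t). (F s t, v t)) L)) =
    bpure S (concat (map (\<lambda>(s, t). Ps s t) L)) (v t) (v y) (concat (map (\<lambda>(s, t). W s t) L))"
    by (rule 2(1)[OF lk(1) conjunct1[OF h]]) (rule 2(4), simp)
  have wc: "concat (map (\<lambda>(s, t). W s t) L) \<in> bpaths S (concat (map (\<lambda>(s, t). Ps s t) L)) (v t) (v y)"
    by (rule bpaths_linked_concat[OF lk(1)]) (use 2(4) in simp)
  have cc: "concat (map fst (map (\<lambda>(s, t). (map fquiv (Ps s t), \<phi> s t)) L)) =
      map fquiv (concat (map (\<lambda>(s, t). Ps s t) L))"
    by (induction L) auto
  show ?case
    using tens_path_Cons_basis[of "v s" S "v t" "\<phi> s t" "F s t" "Ps s t" "W s t", OF _ _ _ _ IH wc cc] h 2(3) lk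
    by simp
qed

end

section \<open>Inert maps on basis elements\<close>

context simplicial_base
begin

abbreviation (input) "gb ns \<equiv> map cb ns"

lemma map_tmod: "map (tmod X) ns = map fquiv (gb ns)"
  by (simp add: ftilde_sel)

lemma comult_gaps_hom:
  "a \<in> V \<Longrightarrow> b \<in> V \<Longrightarrow> comult_gaps R X ns a b \<in>
    mod_hom R (fquiv (cb (sum_list ns)) a b) (qtensor R V (map fquiv (gb ns)) a b)"
proof (induction ns arbitrary: a b rule: induct_list012)
  case 1
  show ?case unfolding comult_gaps.simps ftilde_sel(1)
    using mod_hom_comp[OF counit_hom unit_tens_hom] by simp
next
  case (2 n)
  thus ?case unfolding comult_gaps.simps ftilde_sel(1,2)
    using fquiv_one_tens_hom by simp
next
  case (3 n m ns)
  have ok: "qmaps_ok V (map fquiv [cb n, cb (sum_list (m # ns))])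
      [id_blk R X n, (map (tmod X) (m # ns), comult_gaps R X (m # ns))]"
    unfolding list.map(2)[of fquiv] qmaps_ok_blk map_tmod using 3 by simp
  have "tens_map R V [id_blk R X n, (map (tmod X) (m # ns), comult_gaps R X (m # ns))] a b \<in>
      mod_hom R (qtensor R V (map fquiv [cb n, cb (sum_list (m # ns))]) a b)
        (qtensor R V (map fquiv (gb (n # m # ns))) a b)"
    by (rule tens_map_hom'[OF ok]) (use 3 in \<open>auto simp: fst_blk ftilde_sel\<close>)
  from mod_hom_comp[OF comult_hom this] show ?case
    unfolding comult_gaps.simps ftilde_sel(1) by simp
qed

context
  fixes U q and w :: "nat \<Rightarrow> (nat \<Rightarrow> nat) \<Rightarrow> 'x"
  assumes w: "nsimp K U q w"
begin

lemma necl_closed_linked: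
  assumes "linked L x y" "\<And>s t. (s, t) \<in> set L \<Longrightarrow> s \<le> t \<and> t \<le> q \<and> (\<forall>u\<in>U. u \<le> s \<or> t \<le> u)"
  shows "map (\<lambda>(s, t). (wsim w s t, wvert w t)) L \<in>
    bpaths V (gb (map (\<lambda>(s, t). t - s) L)) (wvert w x) (wvert w y)"
proof -
  have "map (\<lambda>(s, t). (wsim w s t, wvert w t)) L \<in>
    bpaths V (map (\<lambda>(s, t). cb (t - s)) L) (wvert w x) (wvert w y)"
    by (rule bpaths_linked[OF assms(1)]) (use assms(2) wvert_closed[OF w] wsim_closed[OF w] in blast)
  thus ?thesis by (simp add: o_def case_prod_beta')
qed

text \<open>The recursion cuts off the first bead. What remains is the restriction
  \<open>wsim w y t\<close> of the same \<open>w\<close>, so the induction hypothesis applies to it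
  directly.\<close>

lemma comult_gaps_basis:
  assumes "linked L s t" "incr L" "t \<le> q" "\<forall>u\<in>U. u \<le> s \<or> t \<le> u"
  shows "comult_gaps R X (map (\<lambda>(x, y). y - x) L) (wvert w s) (wvert w t) (single R (wsim w s t)) =
    bpure V (gb (map (\<lambda>(x, y). y - x) L)) (wvert w s) (wvert w t)
      (map (\<lambda>(x, y). (wsim w x y, wvert w y)) L)"
  using assms
proof (induction L arbitrary: s rule: induct_list012)
  case 1
  hence st: "s = t" by simp
  have "wsim w t t \<in> cb 0 (wvert w t) (wvert w t)" using wsim_closed[OF w, of t t] 1 st by simp
  thus ?case
    using counit_single unit_tens_one wvert_closed[OF w 1(3)] st by (simp add: ftilde_sel(1))
next
  case (2 xy)
  obtain x y where xy: "xy = (x, y)" by (cases xy)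
  show ?case using 2 by (simp add: xy ftilde_sel(1,2) one_tens_single)
next
  case (3 xy yz L)
  obtain y z where yz: "xy = (s, y)" "yz = (y, z)" using 3(3) by (cases xy, cases yz) auto
  let ?L = "(y, z) # L"
  let ?ns = "map (\<lambda>(x, y). y - x) ?L"
  have lk: "linked ?L y t" "incr ?L" using 3 yz by auto
  have sy: "s < y" using 3 yz by simp
  have yt: "y \<le> t" using linked_bounds[OF lk] by simp
  have gap: "\<forall>u\<in>U. u \<le> s \<or> y \<le> u" "\<forall>u\<in>U. u \<le> y \<or> t \<le> u" using 3(6) sy yt by fastforce+
  have sum: "sum_list ?ns = t - y" by (rule diffs_sum[OF lk])
  have IH: "comult_gaps R X ?ns (wvert w y) (wvert w t) (single R (wsim w y t)) =
    bpure V (gb ?ns) (wvert w y) (wvert w t) (map (\<lambda>(x, y). (wsim w x y, wvert w y)) ?L)"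
    using 3(2)[of y] lk 3(5) gap yz by simp
  let ?W = "map (\<lambda>(x, y). (wsim w x y, wvert w y)) ?L"
  have Wc: "?W \<in> bpaths V (gb ?ns) (wvert w y) (wvert w t)"
    by (rule necl_closed_linked[OF lk(1)]) (use linked_bounds[OF lk] gap 3(5) in fastforce)
  have V: "wvert w s \<in> V" "wvert w y \<in> V" "wvert w t \<in> V"
    using wvert_closed[OF w] sy yt 3(5) by auto
  have x1: "wsim w s y \<in> cb (y - s) (wvert w s) (wvert w y)"
    by (rule wsim_closed[OF w]) (use sy yt 3(5) gap in auto)
  have x0: "wsim w s t \<in> cb ((y - s) + (t - y)) (wvert w s) (wvert w t)"
    using wsim_closed[OF w, of s t] sy yt 3(5,6) by simp
  have r1: "sact K (y - s) ((y - s) + (t - y)) (seg 0 (y - s)) (wsim w s t) = wsim w s y"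
    using sact_wsim[OF w, of s s y t] sy yt 3(5,6) by simp
  have r2: "sact K (t - y) ((y - s) + (t - y)) (seg (y - s) (t - y)) (wsim w s t) = wsim w y t"
    using sact_wsim[OF w, of s y t t] sy yt 3(5,6) by simp
  have r3: "vertex K ((y - s) + (t - y)) (y - s) (wsim w s t) = wvert w y"
    using vertex_wsim[OF w, of s y t] sy yt 3(5,6) by simp
  let ?\<Phi> = "[id_blk R X (y - s), (map (tmod X) ?ns, comult_gaps R X ?ns)]"
  have ok: "qmaps_ok V (map fquiv [cb (y - s), cb (t - y)]) ?\<Phi>"
    unfolding list.map(2)[of fquiv] qmaps_ok_blk map_tmod
    using comult_gaps_hom[of _ _ ?ns] sum by simp
  have pc: "[(wsim w s y, wvert w y), (wsim w y t, wvert w t)] \<in>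
      bpaths V [cb (y - s), cb (t - y)] (wvert w s) (wvert w t)"
    using comult_path[OF x0] unfolding r1 r2 r3 .
  have t2: "tens_path R V [(map fquiv (gb ?ns), comult_gaps R X ?ns)] (wvert w y) (wvert w t)
      (bas [(wsim w y t, wvert w t)]) = bpure V (gb ?ns @ []) (wvert w y) (wvert w t) (?W @ [])"
    by (rule tens_path_Cons_basis[where \<phi> = "comult_gaps R X ?ns", OF V(2,3) IH Wc tens_path_Nil_basis]) auto
  have t1: "tens_path R V ?\<Phi> (wvert w s) (wvert w t) (bas [(wsim w s y, wvert w y), (wsim w y t, wvert w t)]) =
      bpure V (cb (y - s) # gb ?ns) (wvert w s) (wvert w t) ((wsim w s y, wvert w y) # ?W)"
    unfolding map_tmod
    by (rule tens_path_blk(1)[OF V(1,2) t2[unfolded append_Nil2] Wc _ x1]) simp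
  have "comult_gaps R X ((y - s) # ?ns) (wvert w s) (wvert w t) (single R (wsim w s t)) =
    tens_map R V ?\<Phi> (wvert w s) (wvert w t)
      (comult X (y - s) (t - y) (wvert w s) (wvert w t) (single R (wsim w s t)))"
    using sum by (simp add: ftilde_sel(1))
  also have "\<dots> = bpure V (cb (y - s) # gb ?ns) (wvert w s) (wvert w t) ((wsim w s y, wvert w y) # ?W)"
    unfolding comult_single[OF x0] r1 r2 r3 tens_map_basis[OF ok V(1) pc] t1 ..
  finally show ?case using yz by simp
qed

end

lemma necl_closed:
  assumes "nsimp K U q w" "is_necklace (U, q)"
  shows "necl U w \<in> bpaths V (gb (gaps U)) (wvert w 0) (wvert w q)"
  unfolding necl_def gaps_def
proof (rule necl_closed_linked[OF assms(1) steps_nec(1)[OF assms(2)]])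
  fix s t assume "(s, t) \<in> set (steps U)"
  from steps_nec_gap[OF assms(2) this] show "s \<le> t \<and> t \<le> q \<and> (\<forall>u\<in>U. u \<le> s \<or> t \<le> u)" by simp
qed

lemma nec_inert_alt:
  "nec_inert R X T U = tens_map R V (map (\<lambda>(s, t). (map fquiv (gb (inert_ns T s t)), comult_gaps R X (inert_ns T s t))) (steps U))"
  by (simp add: nec_inert_def inert_ns_def Let_def map_tmod ftilde_sel(1))

lemma inert_ok:
  assumes U: "is_necklace (U, q)" and T: "is_necklace (T, q)" and UT: "U \<subseteq> T"
  shows "qmaps_ok V (map fquiv (gb (gaps U)))
    (map (\<lambda>(s, t). (map fquiv (gb (inert_ns T s t)), comult_gaps R X (inert_ns T s t))) (steps U))"
proof -
  have "sum_list (inert_ns T s t) = t - s" if "(s, t) \<in> set (steps U)" for s t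
  proof -
    note g = steps_nec_gap[OF U that]
    have "linked (steps {r \<in> T. s \<le> r \<and> r \<le> t}) s t" "incr (steps {r \<in> T. s \<le> r \<and> r \<le> t})"
      using steps_linked_restrict[OF steps_nec(4)[OF T], of s t] g UT by auto
    moreover have "inert_ns T s t = map (\<lambda>(x, y). y - x) (steps {r \<in> T. s \<le> r \<and> r \<le> t})"
      using g UT by (intro inert_ns_eq[OF steps_nec(4)[OF T]]) auto
    ultimately show ?thesis using diffs_sum by simp
  qed
  hence "qmaps_ok V (map (\<lambda>(s, t). fquiv (cb (t - s))) L)
    (map (\<lambda>(s, t). (map fquiv (gb (inert_ns T s t)), comult_gaps R X (inert_ns T s t))) L)"
    if "set L \<subseteq> set (steps U)" for L
    using that
  proof (induction L)
    case (Cons st L)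
    obtain s t where st: "st = (s, t)" by (cases st)
    show ?case using Cons comult_gaps_hom[of _ _ "inert_ns T s t"] by (simp add: st)
  qed simp
  from this[OF subset_refl] show ?thesis by (simp add: gaps_def o_def case_prod_beta')
qed

lemma concat_fst_inert:
  assumes U: "is_necklace (U, q)" and T: "is_necklace (T, q)" and UT: "U \<subseteq> T"
  shows "concat (map fst (map (\<lambda>(s, t). (map fquiv (gb (inert_ns T s t)), comult_gaps R X (inert_ns T s t)))
    (steps U))) = map fquiv (gb (gaps T))"
  unfolding concat_inert_ns[OF assms, symmetric] by (simp add: map_concat o_def case_prod_beta')

lemma nec_inert_hom:
  assumes U: "is_necklace (U, q)" and T: "is_necklace (T, q)" and UT: "U \<subseteq> T" and a: "a \<in> V"
  shows "nec_inert R X T U a b \<in>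
    mod_hom R (qtensor R V (map fquiv (gb (gaps U))) a b) (qtensor R V (map fquiv (gb (gaps T))) a b)"
  unfolding nec_inert_alt by (rule tens_map_hom'[OF inert_ok[OF U T UT] concat_fst_inert[OF U T UT] a])

text \<open>An inert map leaves \<open>w\<close> alone and only adds joints at which its beads are
  cut; on each bead of \<open>U\<close> this is \<open>comult_gaps_basis\<close>.\<close>

lemma nec_inert_basis:
  assumes U: "is_necklace (U, q)" and T: "is_necklace (T, q)" and UT: "U \<subseteq> T" and w: "nsimp K U q w"
  shows "nec_inert R X T U (wvert w 0) (wvert w q) (bpure V (gb (gaps U)) (wvert w 0) (wvert w q) (necl U w)) =
    bpure V (gb (gaps T)) (wvert w 0) (wvert w q) (necl T w)"
proof -
  note stU = steps_nec[OF U] and g = steps_nec_gap[OF U]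
  have V0: "wvert w 0 \<in> V" using wvert_closed[OF w] by simp
  let ?W = "\<lambda>s t. map (\<lambda>(x, y). (wsim w x y, wvert w y)) (steps {r \<in> T. s \<le> r \<and> r \<le> t})"
  have "nec_inert R X T U (wvert w 0) (wvert w q) (bpure V (gb (gaps U)) (wvert w 0) (wvert w q) (necl U w)) =
    tens_path R V (map (\<lambda>(s, t). (map fquiv (gb (inert_ns T s t)), comult_gaps R X (inert_ns T s t))) (steps U))
      (wvert w 0) (wvert w q) (bas (necl U w))"
    unfolding nec_inert_alt by (rule tens_map_basis[OF inert_ok[OF U T UT] V0 necl_closed[OF w U]])
  also have "\<dots> = bpure V (concat (map (\<lambda>(s, t). gb (inert_ns T s t)) (steps U))) (wvert w 0) (wvert w q)
      (concat (map (\<lambda>(s, t). ?W s t) (steps U)))"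
    unfolding necl_def
  proof (rule tens_path_linked[where v = "wvert w" and F = "wsim w" and W = ?W and S = V and
      \<phi> = "\<lambda>s t. comult_gaps R X (inert_ns T s t)" and Ps = "\<lambda>s t. gb (inert_ns T s t)", OF stU(1) V0])
    fix s t assume st: "(s, t) \<in> set (steps U)"
    note g = steps_nec_gap[OF U st]
    have ns: "inert_ns T s t = map (\<lambda>(x, y). y - x) (steps {r \<in> T. s \<le> r \<and> r \<le> t})"
      by (rule inert_ns_eq[OF steps_nec(4)[OF T]]) (use g UT in auto)
    have lk: "linked (steps {r \<in> T. s \<le> r \<and> r \<le> t}) s t" "incr (steps {r \<in> T. s \<le> r \<and> r \<le> t})"
      using steps_linked_restrict[OF steps_nec(4)[OF T], of s t] g UT by auto
    have "?W s t \<in> bpaths V (gb (inert_ns T s t)) (wvert w s) (wvert w t)"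
      unfolding ns
    proof (rule necl_closed_linked[OF w lk(1)])
      fix x y assume "(x, y) \<in> set (steps {r \<in> T. s \<le> r \<and> r \<le> t})"
      with linked_bounds[OF lk] have b: "s \<le> x" "x < y" "y \<le> t" by auto
      have "u \<le> x \<or> y \<le> u" if "u \<in> U" for u
        using bspec[OF g(3) that] b by linarith
      thus "x \<le> y \<and> y \<le> q \<and> (\<forall>u\<in>U. u \<le> x \<or> y \<le> u)" using b g(2) by auto
    qed
    thus "wvert w t \<in> V \<and> ?W s t \<in> bpaths V (gb (inert_ns T s t)) (wvert w s) (wvert w t) \<and>
      comult_gaps R X (inert_ns T s t) (wvert w s) (wvert w t) (single R (wsim w s t)) =
      bpure V (gb (inert_ns T s t)) (wvert w s) (wvert w t) (?W s t)"
      using comult_gaps_basis[OF w lk g(2,3)] wvert_closed[OF w g(2)] unfolding ns by simp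
  qed
  also have "concat (map (\<lambda>(s, t). gb (inert_ns T s t)) (steps U)) = gb (gaps T)"
    unfolding concat_inert_ns[OF U T UT, symmetric] by (simp add: map_concat o_def case_prod_beta')
  also have "concat (map (\<lambda>(s, t). ?W s t) (steps U)) =
      map (\<lambda>(x, y). (wsim w x y, wvert w y)) (concat (map (\<lambda>(s, t). steps {r \<in> T. s \<le> r \<and> r \<le> t}) (steps U)))"
    by (simp add: map_concat case_prod_beta' o_def)
  also have "concat (map (\<lambda>(s, t). steps {r \<in> T. s \<le> r \<and> r \<le> t}) (steps U)) = steps T"
    using stU T UT by (intro steps_concat) (auto simp: is_necklace_def steps_nec(4)[OF T])
  finally show ?thesis by (simp add: necl_def)
qed

end


section \<open>Active maps, and the necklace functor on basis elements\<close>

context simplicial_base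
begin

lemma unit_elt_ftilde:
  assumes a: "a \<in> V"
  shows "unit_elt R X a = single R a"
  unfolding unit_elt_def
proof (rule the_equality)
  have aa: "a \<in> cb 0 a a" using a by (simp add: cells_between_0[OF K])
  thus s: "single R a \<in> carrier (tmod X 0 a a) \<and> counit X a a (single R a) = \<one>"
    by (simp add: ftilde_sel(2) fquiv_def single_closed counit_single)
  fix x assume x: "x \<in> carrier (tmod X 0 a a) \<and> counit X a a x = \<one>"
  show "x = single R a"
    using counit_bij[OF a a] x s by (auto simp: bij_betw_def inj_on_def ftilde_sel(2))
qed

lemma unit_elt_closed: "a \<in> V \<Longrightarrow> unit_elt R X a \<in> carrier (tmod X 0 a a)"
  by (simp add: unit_elt_ftilde ftilde_sel(2) fquiv_def single_closed cells_between_0[OF K])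

lemma insert_units_closed:
  "a \<in> V \<Longrightarrow> p \<in> qpaths V (map (tmod X) (filter (\<lambda>d. d \<noteq> 0) ds)) a b \<Longrightarrow>
    insert_units R X ds a p \<in> qpaths V (map (tmod X) ds) a b"
proof (induction ds arbitrary: a p)
  case (Cons d ds)
  show ?case
  proof (cases d)
    case 0
    thus ?thesis using Cons unit_elt_closed by simp
  next
    case (Suc e)
    then obtain x c p' where "p = (x, c) # p'" "c \<in> V" "x \<in> carrier (tmod X d a c)"
      "p' \<in> qpaths V (map (tmod X) (filter (\<lambda>d. d \<noteq> 0) ds)) c b" using Cons.prems by auto
    thus ?thesis using Cons.IH[of c p'] Suc by simp
  qed
qed (simp split: if_splits)

text \<open>An inserted unit depends only on the vertex reached so far and not on the entries of the
  path, so it preserves linearity in every remaining slot.\<close>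

lemma insert_units_multilin:
  "a \<in> V \<Longrightarrow> multilin V N (map (tmod X) ds) a b g \<Longrightarrow>
    multilin V N (map (tmod X) (filter (\<lambda>d. d \<noteq> 0) ds)) a b (\<lambda>p. g (insert_units R X ds a p))"
proof (induction ds arbitrary: a g)
  case (Cons d ds)
  show ?case
  proof (cases d)
    case 0
    have "multilin V N (map (tmod X) ds) a b (\<lambda>p. g ((unit_elt R X a, a) # p))"
      using Cons.prems 0 unit_elt_closed by simp
    from Cons.IH[OF Cons.prems(1) this] show ?thesis using 0 by simp
  next
    case (Suc e)
    have "multilin V N (map (tmod X) (filter (\<lambda>d. d \<noteq> 0) ds)) c b
        (\<lambda>p. g ((x, c) # insert_units R X ds c p))"
      if "c \<in> V" "x \<in> carrier (tmod X d a c)" for x c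
      using Cons.IH[of c "\<lambda>p. g ((x, c) # p)"] Cons.prems that by simp
    moreover have "(\<lambda>x. g ((x, c) # insert_units R X ds c p)) \<in> mod_hom R (tmod X d a c) N"
      if "c \<in> V" "p \<in> qpaths V (map (tmod X) (filter (\<lambda>d. d \<noteq> 0) ds)) c b" for p c
      using insert_units_closed[OF that] Cons.prems that by simp
    ultimately show ?thesis using Suc by simp
  qed
qed simp

text \<open>At a collapsed bead the inserted unit is the vertex itself as a
  \<open>0\<close>-simplex, which is \<open>wsim w (f s) (f t)\<close> with
  \<open>f s = f t\<close>. Thus one formula covers collapsed and other beads.\<close>

lemma insert_units_basis:
  assumes "linked L x y" "\<And>s t. (s, t) \<in> set L \<Longrightarrow> f s \<le> f t \<and> wvert w (f s) \<in> V"
  shows "insert_units R X (map (\<lambda>(s, t). f t - f s) L) (wvert w (f x))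
      (bas (map (\<lambda>(s, t). (wsim w s t, wvert w t)) (filter (\<lambda>(s, t). s \<noteq> t) (map (map_prod f f) L)))) =
    bas (map (\<lambda>(s, t). (wsim w (f s) (f t), wvert w (f t))) L)"
  using assms
proof (induction L x y rule: linked.induct)
  case (2 s t L x y)
  have IH: "insert_units R X (map (\<lambda>(s, t). f t - f s) L) (wvert w (f t))
      (bas (map (\<lambda>(s, t). (wsim w s t, wvert w t)) (filter (\<lambda>(s, t). s \<noteq> t) (map (map_prod f f) L)))) =
    bas (map (\<lambda>(s, t). (wsim w (f s) (f t), wvert w (f t))) L)"
    by (rule 2(1)) (use 2(2) in simp, rule 2(3), simp)
  have st: "f s \<le> f t" "wvert w (f s) \<in> V" "s = x" using 2(2) 2(3)[of s t] by simp_all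
  show ?case
  proof (cases "f s = f t")
    case True
    thus ?thesis using IH st by (simp add: unit_elt_ftilde wvert_wsim[symmetric])
  next
    case False
    then obtain d where "f t - f s = Suc d" using st(1) by (metis diff_is_0_eq' le_antisym not0_implies_Suc diff_is_0_eq)
    thus ?thesis using IH st False by simp
  qed
qed simp

definition act_blks :: "nat set \<Rightarrow> (nat \<Rightarrow> nat) \<Rightarrow> ('x, 'a, 'x \<Rightarrow> 'a) qmaps" where
  "act_blks T f = map (\<lambda>(s, t). tact_blk R X (t - s) (f t - f s) (\<lambda>i\<in>{..t - s}. f (s + i) - f s)) (steps T)"

lemma nec_active_alt:
  "nec_active R X T f a b z = tens_map R V (act_blks T f) a b
     (tens_lift R (qtensor R V (map fquiv (gb (act_ds T f))) a b)
       (\<lambda>p. pure R V (map fquiv (gb (act_ds T f))) a b (insert_units R X (act_ds T f) a p)) z)"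
  by (simp only: nec_active_def act_blks_def act_ds_def Let_def map_tmod ftilde_sel(1))

lemma act_ok:
  assumes T: "is_necklace (T, p)" and f: "f \<in> Delta_f p q"
  shows "qmaps_ok V (map fquiv (gb (act_ds T f))) (act_blks T f)"
proof -
  have "qmaps_ok V (map (\<lambda>(s, t). fquiv (cb (f t - f s))) L)
    (map (\<lambda>(s, t). tact_blk R X (t - s) (f t - f s) (\<lambda>i\<in>{..t - s}. f (s + i) - f s)) L)"
    if "set L \<subseteq> set (steps T)" for L
    using that
  proof (induction L)
    case (Cons st L)
    obtain s t where st: "st = (s, t)" by (cases st)
    have m: "(s, t) \<in> set (steps T)" using Cons st by simp
    show ?case unfolding st list.map split_conv qmaps_ok_blk(3)[OF act_part[OF T f m]]
      by (rule Cons.IH) (use Cons.prems in simp)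
  qed simp
  from this[OF subset_refl] show ?thesis by (simp add: act_ds_def act_blks_def o_def case_prod_beta')
qed

lemma concat_fst_act: "concat (map fst (act_blks T f)) = map fquiv (gb (gaps T))"
proof -
  have "concat (map fst (map (\<lambda>(s, t). tact_blk R X (t - s) (f t - f s) (\<lambda>i\<in>{..t - s}. f (s + i) - f s)) L)) =
    map fquiv (gb (map (\<lambda>(s, t). t - s) L))" for L
    by (induction L) (auto simp: fst_blk)
  thus ?thesis by (simp add: act_blks_def gaps_def)
qed

lemma insert_pure_multilin:
  assumes T: "is_necklace (T, p)" and f: "f \<in> Delta_f p q" and a: "a \<in> V"
  shows "multilin V (qtensor R V (map fquiv (gb (act_ds T f))) a b) (map fquiv (gb (gaps (f ` T)))) a b
    (\<lambda>p. pure R V (map fquiv (gb (act_ds T f))) a b (insert_units R X (act_ds T f) a p))"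
  unfolding gaps_image[OF T f] map_tmod[symmetric]
  by (rule insert_units_multilin[OF a pure_multilin[OF _ a]]) (simp add: map_tmod)

lemma nec_active_hom:
  assumes T: "is_necklace (T, p)" and f: "f \<in> Delta_f p q" and a: "a \<in> V"
  shows "nec_active R X T f a b \<in>
    mod_hom R (qtensor R V (map fquiv (gb (gaps (f ` T)))) a b) (qtensor R V (map fquiv (gb (gaps T))) a b)"
  unfolding nec_active_alt[abs_def]
  by (rule mod_hom_comp[OF tens_lift_hom[OF _ qtensor_module insert_pure_multilin[OF T f a]]
        tens_map_hom'[OF act_ok[OF T f] concat_fst_act a]]) auto

text \<open>Once units are inserted, each bead \<open>(s, t)\<close> of \<open>T\<close> carries the
  restriction of \<open>w\<close> to the interval from \<open>f s\<close> to \<open>f t\<close>.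
  Acting by the part of \<open>f\<close> on that bead yields the bead of
  \<open>wpull w f\<close>.\<close>

lemma nec_active_basis:
  assumes T: "is_necklace (T, p)" and f: "f \<in> Delta_f p q" and w: "nsimp K (f ` T) q w"
  shows "nec_active R X T f (wvert w 0) (wvert w q)
      (bpure V (gb (gaps (f ` T))) (wvert w 0) (wvert w q) (necl (f ` T) w)) =
    bpure V (gb (gaps T)) (wvert w 0) (wvert w q) (necl T (wpull w f))"
proof -
  note fT = nec_image[OF T f] and st = steps_nec[OF T] and d = DeltaD[OF Delta_fD(1)[OF f]]
  let ?a = "wvert w 0" and ?b = "wvert w q" and ?ds = "act_ds T f"
  have a: "?a \<in> V" using wvert_closed[OF w] by simp
  have g: "s < t \<and> t \<le> p \<and> f s \<le> f t \<and> f t \<le> q \<and> (\<forall>u\<in>f ` T. u \<le> f s \<or> f t \<le> u)"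
    if "(s, t) \<in> set (steps T)" for s t
  proof -
    note g = steps_nec_gap[OF T that]
    have "f u \<le> f s \<or> f t \<le> f u" if "u \<in> T" for u
    proof -
      have "u \<le> p" using that T by (auto simp: is_necklace_def)
      thus ?thesis using bspec[OF g(3) that] d(2)[of u s] d(2)[of t u] g(1,2) by auto
    qed
    thus ?thesis using g d(1)[of t] d(2)[of s t] by auto
  qed
  let ?w' = "map (\<lambda>(s, t). (wsim w (f s) (f t), wvert w (f t))) (steps T)"
  have V: "wvert w (f t) \<in> V \<and> wvert w (f s) \<in> V" if "(s, t) \<in> set (steps T)" for s t
    using g[OF that] wvert_closed[OF w] by auto
  have ins: "insert_units R X ?ds ?a (bas (necl (f ` T) w)) = bas ?w'"
    unfolding necl_def steps_image[OF T f] act_ds_def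
    using insert_units_basis[OF st(1), of f w] g V Delta_fD[OF f] by auto
  have w'c: "?w' \<in> bpaths V (gb ?ds) ?a ?b"
  proof -
    have "?w' \<in> bpaths V (map (\<lambda>(s, t). cb (f t - f s)) (steps T)) (wvert w (f 0)) (wvert w (f p))"
      by (rule bpaths_linked[OF st(1), where v = "\<lambda>t. wvert w (f t)"]) (use g V wsim_closed[OF w] in auto)
    thus ?thesis using Delta_fD[OF f] by (simp add: act_ds_def o_def case_prod_beta')
  qed
  have "tens_lift R (qtensor R V (map fquiv (gb ?ds)) ?a ?b)
       (\<lambda>p. pure R V (map fquiv (gb ?ds)) ?a ?b (insert_units R X ?ds ?a p))
       (bpure V (gb (gaps (f ` T))) ?a ?b (necl (f ` T) w)) = bpure V (gb ?ds) ?a ?b ?w'"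
    unfolding bpure_def ins[symmetric]
    by (rule tens_lift_pure[OF qmods_fquiv qtensor_module[OF qmods_fquiv] insert_pure_multilin[OF T f a]
          bas_closed[OF necl_closed[OF w fT]]])
  hence "nec_active R X T f ?a ?b (bpure V (gb (gaps (f ` T))) ?a ?b (necl (f ` T) w)) =
      tens_path R V (act_blks T f) ?a ?b (bas ?w')"
    by (simp add: nec_active_alt tens_map_basis[OF act_ok[OF T f] a w'c])
  also have "\<dots> = bpure V (concat (map (\<lambda>(s, t). [cb (t - s)]) (steps T))) (wvert w (f 0)) (wvert w (f p))
      (concat (map (\<lambda>(s, t). [(wsim (wpull w f) s t, wvert w (f t))]) (steps T)))"
  proof -
    let ?\<phi> = "\<lambda>s t. snd (tact_blk R X (t - s) (f t - f s) (\<lambda>i\<in>{..t - s}. f (s + i) - f s))"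
    have blk: "act_blks T f = map (\<lambda>(s, t). (map fquiv [cb (t - s)], ?\<phi> s t)) (steps T)"
      by (simp add: act_blks_def tact_blk_def ftilde_sel(2) o_def)
    have "tens_path R V (map (\<lambda>(s, t). (map fquiv [cb (t - s)], ?\<phi> s t)) (steps T)) (wvert w (f 0)) (wvert w (f p))
      (bas ?w') = bpure V (concat (map (\<lambda>(s, t). [cb (t - s)]) (steps T))) (wvert w (f 0)) (wvert w (f p))
      (concat (map (\<lambda>(s, t). [(wsim (wpull w f) s t, wvert w (f t))]) (steps T)))"
    proof (rule tens_path_linked[where v = "\<lambda>t. wvert w (f t)" and F = "\<lambda>s t. wsim w (f s) (f t)" and
          W = "\<lambda>s t. [(wsim (wpull w f) s t, wvert w (f t))]" and S = V and
          \<phi> = ?\<phi> and Ps = "\<lambda>s t. [cb (t - s)]", OF st(1)])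
      show "wvert w (f 0) \<in> V" using a Delta_fD[OF f] by simp
      fix s t assume st: "(s, t) \<in> set (steps T)"
      note g = g[OF st] and ap = act_part[OF T f st]
      let ?f = "\<lambda>i\<in>{..t - s}. f (s + i) - f s"
      have e0: "wsim (wpull w f) s t = w (t - s) (compose {..t - s} f (seg s (t - s)))"
        by (simp add: wsim_def wpull_def)
      have x: "wsim w (f s) (f t) \<in> cb (f t - f s) (wvert w (f s)) (wvert w (f t))"
        by (rule wsim_closed[OF w]) (use g in auto)
      have "sact K (t - s) (f t - f s) ?f (wsim w (f s) (f t)) =
        w (t - s) (compose {..t - s} (seg (f s) (f t - f s)) ?f)"
        unfolding wsim_def
        by (rule nsimpD(2)[OF w seg_Delta _ Delta_fD(1)[OF ap]]) (use g in \<open>auto simp: inbead_seg\<close>)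
      \<comment> \<open>Subtracting \<open>f s\<close> in the part of \<open>f\<close> and adding it
        back through \<open>seg\<close> cancel, because \<open>f\<close> is monotone and natural
        subtraction does not truncate here.\<close>
      also have "compose {..t - s} (seg (f s) (f t - f s)) ?f = compose {..t - s} f (seg s (t - s))"
      proof
        fix i
        show "compose {..t - s} (seg (f s) (f t - f s)) ?f i = compose {..t - s} f (seg s (t - s)) i"
        proof (cases "i \<le> t - s")
          case True
          have "f s \<le> f (s + i)" "f (s + i) \<le> f t" using True g d(2)[of s "s + i"] d(2)[of "s + i" t] by auto
          thus ?thesis using True by (simp add: compose_def seg_def diff_le_mono)
        qed (simp add: compose_def)
      qed
      finally have e: "sact K (t - s) (f t - f s) ?f (wsim w (f s) (f t)) = wsim (wpull w f) s t"
        unfolding e0 .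
      have "wsim (wpull w f) s t \<in> cb (t - s) (wvert w (f s)) (wvert w (f t))"
        unfolding e[symmetric] by (rule sact_f_cells_between[OF K ap x])
      moreover have "?\<phi> s t (wvert w (f s)) (wvert w (f t)) (single R (wsim w (f s) (f t))) =
        bpure V [cb (t - s)] (wvert w (f s)) (wvert w (f t)) [(wsim (wpull w f) s t, wvert w (f t))]"
        unfolding tact_blk_def snd_conv ftilde_sel(1,2) tact_single[OF ap x] e one_tens_single ..
      ultimately show "wvert w (f t) \<in> V \<and> [(wsim (wpull w f) s t, wvert w (f t))] \<in>
          bpaths V [cb (t - s)] (wvert w (f s)) (wvert w (f t)) \<and>
        ?\<phi> s t (wvert w (f s)) (wvert w (f t)) (single R (wsim w (f s) (f t))) =
        bpure V [cb (t - s)] (wvert w (f s)) (wvert w (f t)) [(wsim (wpull w f) s t, wvert w (f t))]"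
        using V[OF st] by simp
    qed
    thus ?thesis unfolding blk using Delta_fD[OF f] by simp
  qed
  also have "concat (map (\<lambda>(s, t). [cb (t - s)]) (steps T)) = gb (gaps T)"
    by (simp add: gaps_def o_def case_prod_beta' concat_map_singleton)
  also have "concat (map (\<lambda>(s, t). [(wsim (wpull w f) s t, wvert w (f t))]) (steps T)) = necl T (wpull w f)"
    by (simp add: necl_def wvert_pull case_prod_beta' concat_map_singleton)
  finally show ?thesis using Delta_fD[OF f] by simp
qed

lemma nob_nec_fun: "nob (nec_fun R X a b) (T, p) = qtensor R V (map fquiv (gb (gaps T))) a b"
  by (simp add: nec_fun_def nec_mod_def map_tmod ftilde_sel(1) del: map_map)

lemma nob_module: "module R (nob (nec_fun R X a b) T)"
  by (cases T) (simp add: nob_nec_fun qtensor_module del: map_map)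

lemma nmap_nec_fun:
  "nmap (nec_fun R X a b) (T, p) (U, q) f z = nec_active R X T f a b (nec_inert R X (f ` T) U a b z)"
  by (simp add: nec_fun_def)

lemma nmap_hom:
  assumes T: "is_necklace (T, p)" and U: "is_necklace (U, q)" and f: "f \<in> nec_hom (T, p) (U, q)" and a: "a \<in> V"
  shows "nmap (nec_fun R X a b) (T, p) (U, q) f \<in>
    mod_hom R (nob (nec_fun R X a b) (U, q)) (nob (nec_fun R X a b) (T, p))"
proof -
  have f': "f \<in> Delta_f p q" "U \<subseteq> f ` T" using f by (auto simp: nec_hom_def)
  show ?thesis unfolding nmap_nec_fun[abs_def] nob_nec_fun
    by (rule mod_hom_comp[OF nec_inert_hom[OF U nec_image[OF T f'(1)] f'(2) a] nec_active_hom[OF T f'(1) a]])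
qed

definition nelt :: "necklace \<Rightarrow> (nat \<Rightarrow> (nat \<Rightarrow> nat) \<Rightarrow> 'x) \<Rightarrow> ('x, 'a, 'x \<Rightarrow> 'a) tens" where
  "nelt U w = bpure V (gb (gaps (fst U))) (wvert w 0) (wvert w (snd U)) (necl (fst U) w)"

text \<open>The factorisation into an active and an inert map drops out: inert maps keep
  \<open>w\<close> and active maps precompose it, so any \<open>f\<close> acts by
  precomposition.\<close>

lemma nmap_nelt:
  assumes T: "is_necklace (T, p)" and U: "is_necklace (U, q)" and f: "f \<in> nec_hom (T, p) (U, q)"
    and w: "nsimp K U q w" and ab: "wvert w 0 = a" "wvert w q = b"
  shows "nmap (nec_fun R X a b) (T, p) (U, q) f (nelt (U, q) w) = nelt (T, p) (wpull w f)"
proof -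
  have f': "f \<in> Delta_f p q" "U \<subseteq> f ` T" using f by (auto simp: nec_hom_def)
  show ?thesis
    unfolding nmap_nec_fun nelt_def fst_conv snd_conv ab[symmetric] wvert_pull Delta_fD(2,3)[OF f'(1)]
      nec_inert_basis[OF U nec_image[OF T f'(1)] f'(2) w]
    by (rule nec_active_basis[OF T f'(1) nsimp_mono[OF w f'(2)]])
qed

lemma nelt_closed:
  assumes U: "is_necklace (U, q)" and w: "nsimp K U q w" and ab: "wvert w 0 = a" "wvert w q = b"
  shows "nelt (U, q) w \<in> carrier (nob (nec_fun R X a b) (U, q))"
  unfolding nob_nec_fun nelt_def fst_conv snd_conv ab[symmetric]
  by (rule bpure_closed[OF necl_closed[OF w U]])

end


section \<open>Horns and composition in a quasi-category\<close>

lemma compose_Delta_id: "x \<in> Delta l n \<Longrightarrow> compose {..l} x (seg 0 l) = x"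
  by (rule ext) (auto simp: compose_def seg_def dest: DeltaD(3) simp: extensional_def)

lemma compose_Delta_assoc:
  "\<alpha> \<in> Delta l m \<Longrightarrow> compose {..l} x (compose {..l} \<beta> \<alpha>) = compose {..l} (compose {..m} x \<beta>) \<alpha>"
  using DeltaD(1)[of \<alpha> l m] by (auto simp: compose_def)

lemma simplicial_set_simplex: "simplicial_set (simplex n)"
  unfolding simplicial_set_def simplex_def seg_0
  by (auto simp: compose_Delta compose_Delta_id compose_Delta_assoc)

lemma horn_cells_compose:
  "x \<in> cells (horn n j) m \<Longrightarrow> \<alpha> \<in> Delta l m \<Longrightarrow> compose {..l} x \<alpha> \<in> cells (horn n j) l"
  using DeltaD(1)[of \<alpha> l m] by (auto simp: horn_def compose_Delta) (auto simp: compose_def)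

lemma simplicial_set_horn: "simplicial_set (horn n j)"
  unfolding simplicial_set_def seg_0
  using horn_cells_compose by (auto simp: horn_def compose_Delta_id compose_Delta_assoc)

text \<open>The coface that omits \<open>i\<close>, indexed by the dimension of its source;
  \<open>dface\<close> follows the same convention and takes the dimension of the resulting
  face.\<close>

definition dl :: "nat \<Rightarrow> nat \<Rightarrow> nat \<Rightarrow> nat" where
  "dl n i = (\<lambda>k\<in>{..n}. if k < i then k else Suc k)"

lemma dl_Delta: "dl n i \<in> Delta n (Suc n)"
  by (rule DeltaI) (auto simp: dl_def)

definition dface :: "'x sset \<Rightarrow> nat \<Rightarrow> nat \<Rightarrow> 'x \<Rightarrow> 'x" where
  "dface K n i x = sact K n (Suc n) (dl n i) x"

lemma compose_dl: "i < l \<Longrightarrow> l \<le> Suc (Suc n) \<Longrightarrow>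
    compose {..n} (dl (Suc n) l) (dl n i) = compose {..n} (dl (Suc n) i) (dl n (l - 1))"
  by (rule ext) (auto simp: compose_def dl_def)

text \<open>The factor through which a map that misses \<open>i\<close> passes on its way into the
  coface omitting \<open>i\<close>.\<close>

definition skip :: "nat \<Rightarrow> nat \<Rightarrow> (nat \<Rightarrow> nat) \<Rightarrow> nat \<Rightarrow> nat" where
  "skip m i \<alpha> = (\<lambda>k\<in>{..m}. if \<alpha> k < i then \<alpha> k else \<alpha> k - 1)"

lemma skip_Delta:
  assumes "\<alpha> \<in> Delta m (Suc n)" "i \<notin> \<alpha> ` {..m}" "i \<le> Suc n"
  shows "skip m i \<alpha> \<in> Delta m n"
proof (rule DeltaI)
  fix k l assume kl: "k \<le> l" "l \<le> m"
  have "\<alpha> k \<noteq> i" "\<alpha> l \<noteq> i" using assms(2) kl by auto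
  thus "skip m i \<alpha> k \<le> skip m i \<alpha> l" using DeltaD(2)[OF assms(1) kl] kl by (auto simp: skip_def)
next
  fix k assume k: "k \<le> m"
  have "\<alpha> k \<noteq> i" using assms(2) k by auto
  thus "skip m i \<alpha> k \<le> n" using DeltaD(1)[OF assms(1) k] k assms(3) by (auto simp: skip_def)
qed (simp add: skip_def)

context
  fixes K :: "'x sset"
  assumes K: "simplicial_set K"
begin

lemma dface_closed: "x \<in> cells K (Suc n) \<Longrightarrow> dface K n i x \<in> cells K n"
  unfolding dface_def by (rule sact_closed[OF K dl_Delta])

lemma dface_dface:
  "x \<in> cells K (Suc (Suc n)) \<Longrightarrow> i < l \<Longrightarrow> l \<le> Suc (Suc n) \<Longrightarrow>
    dface K n i (dface K (Suc n) l x) = dface K n (l - 1) (dface K (Suc n) i x)"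
  using compose_dl[of i l n] unfolding dface_def
  by (simp add: sact_comp[OF K dl_Delta dl_Delta])

lemma vertex_dface:
  "x \<in> cells K (Suc n) \<Longrightarrow> k \<le> n \<Longrightarrow> vertex K n k (dface K n i x) = vertex K (Suc n) (if k < i then k else Suc k) x"
  unfolding dface_def by (simp add: vertex_sact[OF K dl_Delta]) (simp add: dl_def)

text \<open>A map missing both \<open>i\<close> and \<open>l\<close> factors through the codimension
  two face omitting them, via \<open>?\<beta>\<close>; on that face the compatibility condition says
  that \<open>y i\<close> and \<open>y l\<close> agree.\<close>

lemma skip_indep:
  assumes \<alpha>: "\<alpha> \<in> Delta m (Suc (Suc n))" and il: "i < l" "l \<le> Suc (Suc n)"
    and miss: "i \<notin> \<alpha> ` {..m}" "l \<notin> \<alpha> ` {..m}"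
    and y: "y i \<in> cells K (Suc n)" "y l \<in> cells K (Suc n)"
    and compat: "dface K n i (y l) = dface K n (l - 1) (y i)"
  shows "sact K m (Suc n) (skip m i \<alpha>) (y i) = sact K m (Suc n) (skip m l \<alpha>) (y l)"
proof -
  let ?\<beta> = "\<lambda>k\<in>{..m}. if \<alpha> k < i then \<alpha> k else if \<alpha> k < l then \<alpha> k - 1 else \<alpha> k - 2"
  have ne: "\<alpha> k \<noteq> i \<and> \<alpha> k \<noteq> l" if "k \<le> m" for k using miss that by auto
  have \<beta>: "?\<beta> \<in> Delta m n"
  proof (rule DeltaI)
    fix k k' assume kl: "k \<le> k'" "k' \<le> m"
    show "?\<beta> k \<le> ?\<beta> k'"
      using DeltaD(2)[OF \<alpha> kl] ne[of k] ne[of k'] kl il by auto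
  next
    fix k assume k: "k \<le> m"
    show "?\<beta> k \<le> n" using DeltaD(1)[OF \<alpha> k] ne[OF k] k il by auto
  qed simp
  have 1: "skip m i \<alpha> = compose {..m} (dl n (l - 1)) ?\<beta>"
  proof
    fix k show "skip m i \<alpha> k = compose {..m} (dl n (l - 1)) ?\<beta> k"
      using DeltaD(1)[OF \<alpha>, of k] ne[of k] il by (auto simp: skip_def compose_def dl_def)
  qed
  have 2: "skip m l \<alpha> = compose {..m} (dl n i) ?\<beta>"
  proof
    fix k show "skip m l \<alpha> k = compose {..m} (dl n i) ?\<beta> k"
      using DeltaD(1)[OF \<alpha>, of k] ne[of k] il by (auto simp: skip_def compose_def dl_def)
  qed
  show ?thesis
    unfolding 1 2 sact_comp[OF K \<beta> dl_Delta y(1), symmetric] sact_comp[OF K \<beta> dl_Delta y(2), symmetric]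
    using compat by (simp only: dface_def)
qed

lemma skip_natural:
  assumes \<alpha>: "\<alpha> \<in> Delta m (Suc n)" "i \<notin> \<alpha> ` {..m}" "i \<le> Suc n" and \<beta>: "\<beta> \<in> Delta l m"
    and y: "y \<in> cells K n"
  shows "sact K l n (skip l i (compose {..l} \<alpha> \<beta>)) y = sact K l m \<beta> (sact K m n (skip m i \<alpha>) y)"
proof -
  have "skip l i (compose {..l} \<alpha> \<beta>) = compose {..l} (skip m i \<alpha>) \<beta>"
    using DeltaD(1)[OF \<beta>] by (auto simp: skip_def compose_def)
  thus ?thesis using sact_comp[OF K \<beta> skip_Delta[OF \<alpha>] y] by simp
qed

end

text \<open>A compatible family of faces glues to a map from the horn: each simplex of the horn
  misses some \<open>i \<noteq> j\<close> and is evaluated in the face \<open>y i\<close>,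
  independently of the choice of \<open>i\<close> by \<open>skip_indep\<close>. The dimension is
  written \<open>Suc (Suc n)\<close> since an inner horn has dimension at least two and faces of
  faces must exist.\<close>

lemma horn_filler:
  assumes Q: "quasi_category K" and j: "0 < j" "j < Suc (Suc n)"
    and y: "\<And>i. i \<le> Suc (Suc n) \<Longrightarrow> i \<noteq> j \<Longrightarrow> y i \<in> cells K (Suc n)"
    and compat: "\<And>i l. i < l \<Longrightarrow> l \<le> Suc (Suc n) \<Longrightarrow> i \<noteq> j \<Longrightarrow> l \<noteq> j \<Longrightarrow>
      dface K n i (y l) = dface K n (l - 1) (y i)"
  shows "\<exists>z\<in>cells K (Suc (Suc n)). \<forall>i\<le>Suc (Suc n). i \<noteq> j \<longrightarrow> dface K (Suc n) i z = y i"
proof -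
  have K: "simplicial_set K" using Q by (simp add: quasi_category_def)
  let ?N = "Suc (Suc n)"
  let ?P = "\<lambda>m \<alpha> i. i \<le> ?N \<and> i \<noteq> j \<and> i \<notin> \<alpha> ` {..m}"
  define g where "g m \<alpha> = (let i = SOME i. ?P m \<alpha> i in sact K m (Suc n) (skip m i \<alpha>) (y i))" for m \<alpha>
  have g: "g m \<alpha> = sact K m (Suc n) (skip m i \<alpha>) (y i)" if "\<alpha> \<in> Delta m ?N" "?P m \<alpha> i" for m \<alpha> i
  proof -
    define l where "l = (SOME i. ?P m \<alpha> i)"
    have l: "?P m \<alpha> l" unfolding l_def by (rule someI) (rule that(2))
    have "sact K m (Suc n) (skip m l \<alpha>) (y l) = sact K m (Suc n) (skip m i \<alpha>) (y i)"
    proof (cases i l rule: linorder_cases)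
      case less
      show ?thesis
        by (rule skip_indep[where y = y, OF K that(1) less, symmetric]) (use l that y compat less in auto)
    next
      case greater
      show ?thesis
        by (rule skip_indep[where y = y, OF K that(1) greater]) (use l that y compat greater in auto)
    qed simp
    thus ?thesis by (simp add: g_def Let_def flip: l_def)
  qed
  have hc: "\<alpha> \<in> cells (horn ?N j) m \<longleftrightarrow> \<alpha> \<in> Delta m ?N \<and> (\<exists>i. ?P m \<alpha> i)" for m \<alpha>
    by (auto simp: horn_def)
  have "simplicial_map (horn ?N j) K g"
    unfolding simplicial_map_def
  proof (intro conjI allI ballI)
    fix m show "g m \<in> cells (horn ?N j) m \<rightarrow> cells K m"
    proof
      fix \<alpha> assume "\<alpha> \<in> cells (horn ?N j) m"
      then obtain i where i: "\<alpha> \<in> Delta m ?N" "?P m \<alpha> i" unfolding hc by blast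
      show "g m \<alpha> \<in> cells K m" unfolding g[OF i]
        by (rule sact_closed[OF K skip_Delta]) (use i y in auto)
    qed
  next
    fix l m \<beta> \<alpha> assume \<beta>: "\<beta> \<in> Delta l m" and "\<alpha> \<in> cells (horn ?N j) m"
    then obtain i where i: "\<alpha> \<in> Delta m ?N" "?P m \<alpha> i" unfolding hc by blast
    have c: "compose {..l} \<alpha> \<beta> \<in> Delta l ?N" by (rule compose_Delta[OF \<beta> i(1)])
    have i': "?P l (compose {..l} \<alpha> \<beta>) i" using i(2) DeltaD(1)[OF \<beta>] by (auto simp: compose_def)
    have "g l (compose {..l} \<alpha> \<beta>) = sact K l m \<beta> (g m \<alpha>)"
      unfolding g[OF i] g[OF c i'] by (rule skip_natural[OF K i(1) _ _ \<beta>]) (use i y in auto)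
    thus "g l (sact (horn ?N j) l m \<beta> \<alpha>) = sact K l m \<beta> (g m \<alpha>)" by (simp add: horn_def)
  qed
  then obtain h where h: "simplicial_map (simplex ?N) K h" "\<forall>m. \<forall>x\<in>cells (horn ?N j) m. h m x = g m x"
    using Q j unfolding quasi_category_def by blast
  have id: "seg 0 ?N \<in> Delta ?N ?N" by (rule seg_Delta) simp
  show ?thesis
  proof (intro bexI[of _ "h ?N (seg 0 ?N)"] allI impI)
    show "h ?N (seg 0 ?N) \<in> cells K ?N"
      using h(1) id by (auto simp: simplicial_map_def simplex_def)
  next
    fix i assume i: "i \<le> ?N" "i \<noteq> j"
    have c: "compose {..Suc n} (seg 0 ?N) (dl (Suc n) i) = dl (Suc n) i"
      by (auto simp: compose_def seg_def dl_def)
    have P: "?P (Suc n) (dl (Suc n) i) i" using i by (auto simp: dl_def)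
    have s: "skip (Suc n) i (dl (Suc n) i) = seg 0 (Suc n)" by (auto simp: skip_def seg_def dl_def)
    have "dface K (Suc n) i (h ?N (seg 0 ?N)) = h (Suc n) (sact (simplex ?N) (Suc n) ?N (dl (Suc n) i) (seg 0 ?N))"
      using h(1) id dl_Delta[of "Suc n" i] unfolding dface_def simplicial_map_def by (simp add: simplex_def)
    also have "\<dots> = h (Suc n) (dl (Suc n) i)" by (simp add: simplex_def c)
    also have "dl (Suc n) i \<in> cells (horn ?N j) (Suc n)"
      unfolding hc using P dl_Delta[of "Suc n" i] by blast
    hence "h (Suc n) (dl (Suc n) i) = g (Suc n) (dl (Suc n) i)" using h(2) by blast
    also have "\<dots> = y i" unfolding g[OF dl_Delta P] s by (rule sact_id[OF K y[OF i]])
    finally show "dface K (Suc n) i (h ?N (seg 0 ?N)) = y i" .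
  qed
qed

text \<open>A choice of \<open>(p + q)\<close>-simplices with prescribed restrictions to \<open>{0..p}\<close> and \<open>{p..p + q}\<close>,
  compatible with all faces except the one opposite to \<open>p\<close>; these faces form an inner horn.\<close>

function Zc :: "'x sset \<Rightarrow> nat \<Rightarrow> nat \<Rightarrow> 'x \<Rightarrow> 'x \<Rightarrow> 'x" where
  "Zc K 0 q x y = y"
| "Zc K (Suc p) 0 x y = x"
| "Zc K (Suc p) (Suc q) x y = (SOME z. z \<in> cells K (Suc (Suc (p + q))) \<and>
     (\<forall>i\<le>p. dface K (Suc (p + q)) i z = Zc K p (Suc q) (dface K p i x) y) \<and>
     (\<forall>i\<le>q. dface K (Suc (p + q)) (Suc (Suc p) + i) z = Zc K (Suc p) q x (dface K q (Suc i) y)))"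
  by pat_completeness auto
termination by (relation "measure (\<lambda>(K, p, q, x, y). p + q)") auto

declare Zc.simps(3) [simp del]

context
  fixes K :: "'x sset"
  assumes Q: "quasi_category K"
begin

lemma quasi_category_simplicial: "simplicial_set K"
  using Q by (simp add: quasi_category_def)

text \<open>The choice in \<open>Zc\<close> succeeds if the prescribed faces form a compatible horn.
  Their own faces are again values of \<open>Zc\<close>, by induction on the dimension, and
  compatibility reduces to the simplicial identities of \<open>x\<close> and
  \<open>y\<close>.\<close>

lemma Zc_spec:
  "x \<in> cells K p \<Longrightarrow> y \<in> cells K q \<Longrightarrow> vertex K p p x = vertex K q 0 y \<Longrightarrow>
    Zc K p q x y \<in> cells K (p + q) \<and>
    (\<forall>p'. p = Suc p' \<longrightarrow> (\<forall>i\<le>p'. dface K (p' + q) i (Zc K p q x y) = Zc K p' q (dface K p' i x) y)) \<and>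
    (\<forall>q'. q = Suc q' \<longrightarrow> (\<forall>i\<le>q'. dface K (p + q') (Suc p + i) (Zc K p q x y) = Zc K p q' x (dface K q' (Suc i) y)))"
proof (induction "p + q" arbitrary: p q x y rule: less_induct)
  case less
  note x = less(2) and y = less(3) and xy = less(4)
  show ?case
  proof (cases p)
    case 0
    thus ?thesis using y by simp
  next
    case (Suc p')
    show ?thesis
    proof (cases q)
      case 0
      \<comment> \<open>For an edge \<open>x\<close> and a vertex \<open>y\<close> the prescribed
        face \<open>0\<close> is \<open>y\<close>; this is the assumption that \<open>x\<close> ends
        where \<open>y\<close> starts.\<close>
      have "dface K 0 0 x = y" if "p' = 0"
      proof -
        have "dface K 0 0 x = vertex K 0 0 (dface K 0 0 x)"
          using dface_closed[OF quasi_category_simplicial, of x 0 0] vertex_0[OF quasi_category_simplicial] x Suc that by simp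
        also have "\<dots> = vertex K 1 1 x" using vertex_dface[OF quasi_category_simplicial, of x 0 0 0] x Suc that by simp
        also have "\<dots> = y" using xy y Suc that 0 vertex_0[OF quasi_category_simplicial] by simp
        finally show ?thesis .
      qed
      thus ?thesis using x Suc 0 by (cases p') auto
    next
      case (Suc q')
      note p = \<open>p = Suc p'\<close>
      \<comment> \<open>Face \<open>i\<close> of the filler comes from face \<open>i\<close> of
        \<open>x\<close> if \<open>i < p\<close>, and from face \<open>i - p\<close> of
        \<open>y\<close> if \<open>i > p\<close>, since vertex \<open>p\<close> of the filler is
        vertex \<open>0\<close> of \<open>y\<close>.\<close>
      define f where "f i = (if i \<le> p' then Zc K p' q (dface K p' i x) y
        else Zc K p q' x (dface K q' (i - p) y))" for i
      have dx: "dface K p' i x \<in> cells K p'" for i using dface_closed[OF quasi_category_simplicial] x p by simp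
      have dy: "dface K q' i y \<in> cells K q'" for i using dface_closed[OF quasi_category_simplicial] y Suc by simp
      have vx: "vertex K p' p' (dface K p' i x) = vertex K q 0 y" if "i \<le> p'" for i
        using vertex_dface[OF quasi_category_simplicial, of x p' p' i] that x p xy by simp
      have vy: "vertex K p p x = vertex K q' 0 (dface K q' i y)" if "0 < i" for i
        using vertex_dface[OF quasi_category_simplicial, of y q' 0 i] that y Suc xy by simp
      have IH1: "Zc K p' q (dface K p' i x) y \<in> cells K (p' + q) \<and>
        (\<forall>p''. p' = Suc p'' \<longrightarrow> (\<forall>l\<le>p''. dface K (p'' + q) l (Zc K p' q (dface K p' i x) y) =
            Zc K p'' q (dface K p'' l (dface K p' i x)) y)) \<and>
        (\<forall>l\<le>q'. dface K (p' + q') (Suc p' + l) (Zc K p' q (dface K p' i x) y) =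
            Zc K p' q' (dface K p' i x) (dface K q' (Suc l) y))" if "i \<le> p'" for i
        using less(1)[of p' q, OF _ dx y vx[OF that]] p Suc by auto
      have IH2: "Zc K p q' x (dface K q' i y) \<in> cells K (p + q') \<and>
        (\<forall>l\<le>p'. dface K (p' + q') l (Zc K p q' x (dface K q' i y)) =
            Zc K p' q' (dface K p' l x) (dface K q' i y)) \<and>
        (\<forall>q''. q' = Suc q'' \<longrightarrow> (\<forall>l\<le>q''. dface K (p + q'') (Suc p + l) (Zc K p q' x (dface K q' i y)) =
            Zc K p q'' x (dface K q'' (Suc l) (dface K q' i y))))" if "0 < i" for i
        using less(1)[of p q', OF _ x dy vy[OF that]] p Suc by auto
      have "\<exists>z\<in>cells K (Suc (Suc (p' + q'))). \<forall>i\<le>Suc (Suc (p' + q')). i \<noteq> p \<longrightarrow> dface K (Suc (p' + q')) i z = f i"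
      proof (rule horn_filler[OF Q])
        show "0 < p" "p < Suc (Suc (p' + q'))" using p by auto
      next
        fix i assume "i \<le> Suc (Suc (p' + q'))" "i \<noteq> p"
        thus "f i \<in> cells K (Suc (p' + q'))"
          using IH1[of i] IH2[of "i - p"] p Suc by (auto simp: f_def)
      next
        fix i l assume il: "i < l" "l \<le> Suc (Suc (p' + q'))" "i \<noteq> p" "l \<noteq> p"
        \<comment> \<open>Either both faces lie in \<open>x\<close>, or one lies in each part, or
          both lie in \<open>y\<close>. In the mixed case both sides are the composite of the two
          shortened simplices.\<close>
        consider "l \<le> p'" | "i \<le> p'" "p < l" | "p < i" using il p by linarith
        thus "dface K (p' + q') i (f l) = dface K (p' + q') (l - 1) (f i)"
        proof cases
          case 1
          then obtain p'' where p'': "p' = Suc p''" using il by (cases p') auto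
          have "dface K (p'' + q) i (f l) = Zc K p'' q (dface K p'' i (dface K p' l x)) y"
            using IH1[of l] 1 il p'' by (simp add: f_def)
          also have "dface K p'' i (dface K p' l x) = dface K p'' (l - 1) (dface K p' i x)"
            using dface_dface[OF quasi_category_simplicial, of x p'' i l] x p p'' il 1 by simp
          also have "Zc K p'' q (dface K p'' (l - 1) (dface K p' i x)) y = dface K (p'' + q) (l - 1) (f i)"
            using IH1[of i] 1 il p'' by (simp add: f_def)
          finally show ?thesis using p'' Suc by simp
        next
          case 2
          obtain l' where l': "l = Suc p + l'" using le_Suc_ex[OF Suc_leI[OF 2(2)]] by blast
          have "dface K (p' + q') i (f l) = Zc K p' q' (dface K p' i x) (dface K q' (Suc l') y)"
            using IH2[of "Suc l'"] 2 p l' by (simp add: f_def)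
          also have "\<dots> = dface K (p' + q') (l - 1) (f i)"
            using IH1[OF 2(1)] l' il 2 p by (simp add: f_def)
          finally show ?thesis .
        next
          case 3
          then obtain q'' where q'': "q' = Suc q''" using il p by (cases q') auto
          obtain i' where i': "i = Suc p + i'" using le_Suc_ex[OF Suc_leI[OF 3]] by blast
          have "Suc (Suc p) \<le> l" using il(1) 3 by simp
          from le_Suc_ex[OF this] obtain l' where "l = Suc (Suc p) + l'" by blast
          hence l': "l = Suc (Suc p + l')" by simp
          have q: "i' \<le> q''" "l' \<le> q''" "i' \<le> l'" using il i' l' p q'' by auto
          have "dface K (p + q'') i (f l) = Zc K p q'' x (dface K q'' (Suc i') (dface K q' (Suc (Suc l')) y))"
            using IH2[of "Suc (Suc l')"] i' l' q p q'' by (simp add: f_def)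
          also have "dface K q'' (Suc i') (dface K q' (Suc (Suc l')) y) = dface K q'' (Suc l') (dface K q' (Suc i') y)"
            using dface_dface[OF quasi_category_simplicial, of y q'' "Suc i'" "Suc (Suc l')"] y Suc q'' q by simp
          also have "Zc K p q'' x (dface K q'' (Suc l') (dface K q' (Suc i') y)) = dface K (p + q'') (l - 1) (f i)"
            using IH2[of "Suc i'"] i' l' q p q'' by (simp add: f_def)
          finally show ?thesis using p q'' by simp
        qed
      qed
      then obtain z where z: "z \<in> cells K (Suc (Suc (p' + q')))"
        "\<And>i. i \<le> Suc (Suc (p' + q')) \<Longrightarrow> i \<noteq> p \<Longrightarrow> dface K (Suc (p' + q')) i z = f i" by blast
      define S where "S z \<longleftrightarrow> z \<in> cells K (Suc (Suc (p' + q'))) \<and>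
        (\<forall>i\<le>p'. dface K (Suc (p' + q')) i z = Zc K p' (Suc q') (dface K p' i x) y) \<and>
        (\<forall>i\<le>q'. dface K (Suc (p' + q')) (Suc (Suc p') + i) z = Zc K (Suc p') q' x (dface K q' (Suc i) y))" for z
      have "S z"
        unfolding S_def using z(1) z(2)[unfolded f_def] p Suc by auto
      hence "S (Eps S)" by (rule someI)
      moreover have "Zc K p q x y = Eps S"
        unfolding p Suc Zc.simps(3) S_def[abs_def] ..
      ultimately have "S (Zc K p q x y)" by simp
      thus ?thesis using p Suc by (auto simp: S_def)
    qed
  qed
qed

lemma Zc_closed:
  "x \<in> cells K p \<Longrightarrow> y \<in> cells K q \<Longrightarrow> vertex K p p x = vertex K q 0 y \<Longrightarrow> Zc K p q x y \<in> cells K (p + q)"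
  using Zc_spec by blast

text \<open>Removing the first \<open>l\<close> vertices is iterating face \<open>0\<close>, and
  face \<open>0\<close> is among the prescribed ones as long as the front part has positive
  length.\<close>

lemma Zc_suffix:
  assumes "x \<in> cells K p" "y \<in> cells K q" "vertex K p p x = vertex K q 0 y" "l \<le> p"
  shows "sact K (p - l + q) (p + q) (seg l (p - l + q)) (Zc K p q x y) =
    Zc K (p - l) q (sact K (p - l) p (seg l (p - l)) x) y"
  using assms
proof (induction l arbitrary: p x)
  case 0
  thus ?case using sact_id[OF quasi_category_simplicial] Zc_closed by simp
next
  case (Suc l)
  then obtain p' where p: "p = Suc p'" "l \<le> p'" by (cases p) auto
  have d0: "dl m 0 = seg (Suc 0) m" for m by (auto simp: dl_def seg_def)
  have c: "compose {..m} (seg (Suc 0) r) (seg l m) = seg (Suc l) m" if "l + m \<le> r" for r m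
    using compose_seg_seg[OF that, of "Suc 0"] by simp
  have dx: "dface K p' 0 x \<in> cells K p'" using dface_closed[OF quasi_category_simplicial] Suc.prems p by simp
  have vx: "vertex K p' p' (dface K p' 0 x) = vertex K q 0 y"
    using vertex_dface[OF quasi_category_simplicial, of x p' p' 0] Suc.prems p by simp
  have "sact K (p' - l + q) (p + q) (seg (Suc l) (p' - l + q)) (Zc K p q x y) =
    sact K (p' - l + q) (p' + q) (seg l (p' - l + q)) (dface K (p' + q) 0 (Zc K p q x y))"
    unfolding dface_def d0 using p Zc_closed[OF Suc.prems(1-3)]
    by (simp add: sact_comp[OF quasi_category_simplicial] seg_Delta c)
  also have "dface K (p' + q) 0 (Zc K p q x y) = Zc K p' q (dface K p' 0 x) y"
    using Zc_spec[OF Suc.prems(1-3)] p by simp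
  also have "sact K (p' - l + q) (p' + q) (seg l (p' - l + q)) \<dots> =
    Zc K (p' - l) q (sact K (p' - l) p' (seg l (p' - l)) (dface K p' 0 x)) y"
    by (rule Suc.IH[OF dx Suc.prems(2) vx p(2)])
  also have "sact K (p' - l) p' (seg l (p' - l)) (dface K p' 0 x) = sact K (p' - l) p (seg (Suc l) (p' - l)) x"
    unfolding dface_def d0 using p Suc.prems(1) by (simp add: sact_comp[OF quasi_category_simplicial] seg_Delta c)
  finally show ?case using p by simp
qed

lemma Zc_right:
  assumes "x \<in> cells K p" "y \<in> cells K q" "vertex K p p x = vertex K q 0 y"
  shows "sact K q (p + q) (seg p q) (Zc K p q x y) = y"
  using Zc_suffix[OF assms, of p] by simp

text \<open>Removing the last vertex of \<open>y\<close> is a prescribed face as well, so induction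
  on \<open>q\<close> strips \<open>y\<close> off.\<close>

lemma Zc_left:
  assumes "x \<in> cells K p" "y \<in> cells K q" "vertex K p p x = vertex K q 0 y"
  shows "sact K p (p + q) (seg 0 p) (Zc K p q x y) = x"
  using assms(2,3)
proof (induction q arbitrary: y)
  case 0
  have "Zc K p 0 x y = x"
  proof (cases p)
    case 0
    thus ?thesis using assms(1) \<open>y \<in> cells K 0\<close> \<open>vertex K p p x = vertex K 0 0 y\<close> vertex_0[OF quasi_category_simplicial] by simp
  qed simp
  thus ?case using sact_id[OF quasi_category_simplicial assms(1)] by simp
next
  case (Suc q)
  have dy: "dface K q (Suc q) y \<in> cells K q" using dface_closed[OF quasi_category_simplicial] Suc.prems by simp
  have vy: "vertex K p p x = vertex K q 0 (dface K q (Suc q) y)"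
    using vertex_dface[OF quasi_category_simplicial, of y q 0 "Suc q"] Suc.prems by simp
  have d: "dl (p + q) (Suc p + q) = seg 0 (p + q)" by (auto simp: dl_def seg_def)
  have "sact K p (p + Suc q) (seg 0 p) (Zc K p (Suc q) x y) =
    sact K p (p + q) (seg 0 p) (dface K (p + q) (Suc p + q) (Zc K p (Suc q) x y))"
    unfolding dface_def d using Zc_closed[OF assms(1) Suc.prems]
    by (simp add: sact_comp[OF quasi_category_simplicial] seg_Delta compose_seg_seg)
  also have "dface K (p + q) (Suc p + q) (Zc K p (Suc q) x y) = Zc K p q x (dface K q (Suc q) y)"
    using Zc_spec[OF assms(1) Suc.prems] by blast
  finally show ?case using Suc.IH[OF dy vy] by simp
qed

end

section \<open>Necklaces in a simplex\<close>

lemma simplex_sel: "cells (simplex n) m = Delta m n" "sact (simplex n) l m \<alpha> x = compose {..l} x \<alpha>"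
  by (simp_all add: simplex_def)

lemma horn_sel:
  "cells (horn n j) m = {x \<in> Delta m n. \<exists>i\<in>{..n}. i \<noteq> j \<and> i \<notin> x ` {..m}}"
  "sact (horn n j) l m \<alpha> x = compose {..l} x \<alpha>"
  by (simp_all add: horn_def)

lemma vertex_simplex: "vertex (simplex n) m i x = pt (x i)" "vertex (horn n j) m i x = pt (x i)"
  by (simp_all add: vertex_pt simplex_sel horn_sel compose_pt)

lemma horn_cells_between: "cells_between (horn n j) m a b \<subseteq> cells_between (simplex n) m a b"
  by (auto simp: cells_between_def vertex_simplex simplex_sel horn_sel)

lemma pt_inject [simp]: "pt i = pt k \<longleftrightarrow> i = k"
  by (auto simp: pt_def restrict_def fun_eq_iff)

text \<open>The map \<open>\<Delta>^q \<rightarrow> \<Delta>^n\<close> given by \<open>g\<close> on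
  vertices; restricted to a necklace it is a necklace in \<open>\<Delta>^n\<close>.\<close>

definition gsimp :: "(nat \<Rightarrow> nat) \<Rightarrow> nat \<Rightarrow> (nat \<Rightarrow> nat) \<Rightarrow> nat \<Rightarrow> nat" where
  "gsimp g = (\<lambda>l \<alpha>. compose {..l} g \<alpha>)"

lemma wvert_gsimp: "wvert (gsimp g) t = pt (g t)"
  by (simp add: wvert_def gsimp_def compose_pt)

lemma wsim_gsimp: "s \<le> t \<Longrightarrow> wsim (gsimp g) s t = (\<lambda>i\<in>{..t - s}. g (s + i))"
  by (auto simp: wsim_def gsimp_def compose_def seg_def)

lemma nsimp_gsimp_simplex: "g \<in> Delta q n \<Longrightarrow> nsimp (simplex n) U q (gsimp g)"
  by (auto simp: nsimp_def simplex_sel gsimp_def compose_Delta compose_Delta_assoc)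

lemma wpull_gsimp: "f \<in> Delta p q \<Longrightarrow> \<alpha> \<in> Delta l p \<Longrightarrow> wpull (gsimp g) f l \<alpha> = gsimp (compose {..p} g f) l \<alpha>"
  using DeltaD(1)[of \<alpha> l p] by (auto simp: wpull_def gsimp_def compose_def)

text \<open>Consecutive simplices of a path share a vertex, so their vertex maps glue to one
  monotone \<open>g\<close>. The bound by \<open>n\<close> is conditional because an empty path says
  nothing about the size of \<open>a\<close>.\<close>

lemma simplex_path:
  assumes "linked L x y" "incr L" "pth \<in> bpaths V (map (\<lambda>(s, t). cells_between (simplex n) (t - s)) L) (pt a) (pt b)"
  shows "\<exists>g. g x = a \<and> g y = b \<and> (\<forall>i k. x \<le> i \<longrightarrow> i \<le> k \<longrightarrow> k \<le> y \<longrightarrow> g i \<le> g k) \<and>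
    (a \<le> n \<longrightarrow> (\<forall>i. x \<le> i \<longrightarrow> i \<le> y \<longrightarrow> g i \<le> n)) \<and>
    pth = map (\<lambda>(s, t). (wsim (gsimp g) s t, wvert (gsimp g) t)) L"
  using assms
proof (induction L x y arbitrary: a pth rule: linked.induct)
  case (1 x y)
  thus ?case by (intro exI[of _ "\<lambda>_. a"]) (auto split: if_splits)
next
  case (2 s t L x y)
  have st: "s = x" "x < t" "linked L t y" "incr L" using 2 by auto
  have ty: "t \<le> y" using linked_bounds[OF st(3,4)] by simp
  obtain h c p where p: "pth = (h, c) # p" "h \<in> cells_between (simplex n) (t - s) (pt a) c"
    "p \<in> bpaths V (map (\<lambda>(s, t). cells_between (simplex n) (t - s)) L) c (pt b)"
    using 2(4) by auto
  have h: "h \<in> Delta (t - x) n" "h 0 = a" "c = pt (h (t - x))"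
    using p(2) st(1) by (auto simp: cells_between_def vertex_simplex simplex_sel)
  obtain g where g: "g t = h (t - x)" "g y = b" "\<forall>i k. t \<le> i \<longrightarrow> i \<le> k \<longrightarrow> k \<le> y \<longrightarrow> g i \<le> g k"
    "\<forall>i. t \<le> i \<longrightarrow> i \<le> y \<longrightarrow> g i \<le> n" "p = map (\<lambda>(s, t). (wsim (gsimp g) s t, wvert (gsimp g) t)) L"
    using 2(1)[OF st(3,4) p(3)[unfolded h(3)]] DeltaD(1)[OF h(1)] by auto
  \<comment> \<open>Both branches agree at the joint \<open>t\<close>, which is what
    \<open>Gt\<close> records.\<close>
  define G where "G i = (if i \<le> t then h (i - x) else g i)" for i
  have Gt: "G i = g i" if "t \<le> i" for i using that g(1) by (auto simp: G_def)
  have "G i \<le> G k" if "x \<le> i" "i \<le> k" "k \<le> y" for i k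
  proof (cases "t \<le> i")
    case True
    thus ?thesis using g(3) that by (simp add: Gt)
  next
    case False
    have "G i \<le> G (min k t)" using DeltaD(2)[OF h(1), of "i - x" "min k t - x"] that False by (auto simp: G_def)
    also have "\<dots> \<le> G k" using g(3) that by (cases "k \<le> t") (auto simp: Gt min_def)
    finally show ?thesis .
  qed
  moreover have "G i \<le> n" if "x \<le> i" "i \<le> y" for i
    using DeltaD(1)[OF h(1), of "i - x"] g(4) that by (auto simp: G_def)
  moreover have "map (\<lambda>(s, t). (wsim (gsimp g) s t, wvert (gsimp g) t)) L =
    map (\<lambda>(s, t). (wsim (gsimp G) s t, wvert (gsimp G) t)) L"
  proof (intro map_cong refl, clarify)
    fix s' t' assume "(s', t') \<in> set L"
    hence "t \<le> s'" "s' < t'" using linked_bounds[OF st(3,4)] by auto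
    thus "wsim (gsimp g) s' t' = wsim (gsimp G) s' t' \<and> wvert (gsimp g) t' = wvert (gsimp G) t'"
      by (auto simp: wsim_gsimp wvert_gsimp Gt)
  qed
  moreover have "wsim (gsimp G) s t i = h i" for i
    using DeltaD(3)[OF h(1)] st(1,2) by (auto simp: wsim_gsimp G_def extensional_def)
  moreover have "G x = a" "G y = b" "G t = h (t - x)"
    using st(2) ty h(2) g(1,2) Gt[of y] by (auto simp: G_def)
  ultimately show ?case using p(1) g(5) h(3) st(1) by (intro exI[of _ G]) (auto simp: wvert_gsimp fun_eq_iff)
qed


section \<open>Lifting inner horns\<close>

lemma seg_id_Delta_f: "seg 0 n \<in> Delta_f n n"
  using seg_Delta[of 0 n n] by (simp add: Delta_f_def seg_def)

lemma seg_nec_hom: "U \<subseteq> T \<Longrightarrow> T \<subseteq> {..n} \<Longrightarrow> seg 0 n \<in> nec_hom (T, n) (U, n)"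
proof -
  assume "U \<subseteq> T" "T \<subseteq> {..n}"
  hence "U \<subseteq> seg 0 n ` T" by (force simp: seg_def)
  thus ?thesis by (simp add: nec_hom_def seg_id_Delta_f)
qed

lemma compose_seg_left: "f \<in> Delta m n \<Longrightarrow> compose {..m} (seg 0 n) f = f"
  using DeltaD(1)[of f m n] DeltaD(3)[of f m n] by (auto simp: compose_def seg_def extensional_def fun_eq_iff)

lemma steps_two: "0 < n \<Longrightarrow> steps {0, n} = [(0, n)]"
  using steps_unique[of "[(0, n)]" 0 n] by simp

lemma steps_three: "0 < k \<Longrightarrow> k < n \<Longrightarrow> steps {0, k, n} = [(0, k), (k, n)]"
  using steps_unique[of "[(0, k), (k, n)]" 0 n] by simp

lemma steps_four: "0 < l \<Longrightarrow> l < k \<Longrightarrow> k < n \<Longrightarrow> steps {0, l, k, n} = [(0, l), (l, k), (k, n)]"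
  using steps_unique[of "[(0, l), (l, k), (k, n)]" 0 n] by simp

lemma is_necklace_insert: "is_necklace ({0, n}, n)" "k \<le> n \<Longrightarrow> is_necklace ({0, k, n}, n)"
  "l \<le> n \<Longrightarrow> k \<le> n \<Longrightarrow> is_necklace ({0, l, k, n}, n)"
  by (auto simp: is_necklace_def)

lemma nec_hom_compose:
  assumes "f \<in> nec_hom (T, p) (U, q)" "g \<in> nec_hom (U, q) (W, r)" "T \<subseteq> {..p}"
  shows "compose {..p} g f \<in> nec_hom (T, p) (W, r)"
proof -
  have fg: "f \<in> Delta_f p q" "g \<in> Delta_f q r" "U \<subseteq> f ` T" "W \<subseteq> g ` U" using assms by (auto simp: nec_hom_def)
  have "compose {..p} g f ` T = g ` f ` T"
    using assms(3) by (force simp: compose_def image_image)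
  thus ?thesis
    using compose_Delta_f[OF fg(1,2)] subset_trans[OF fg(4) image_mono[OF fg(3)]] by (simp add: nec_hom_def)
qed

lemma wsim_pull_seg: "s \<le> t \<Longrightarrow> t \<le> n \<Longrightarrow> wsim (wpull w (seg 0 n)) s t = wsim w s t"
  by (simp add: wsim_def wpull_def compose_seg_seg)

lemma wvert_pull_seg: "t \<le> n \<Longrightarrow> wvert (wpull w (seg 0 n)) t = wvert w t"
  by (simp add: wvert_pull seg_def)

section \<open>Basis elements with few beads, and linear composition of beads\<close>

definition sim :: "'x sset \<Rightarrow> nat \<Rightarrow> 'x \<Rightarrow> nat \<Rightarrow> (nat \<Rightarrow> nat) \<Rightarrow> 'x" where
  "sim K n x = (\<lambda>l \<alpha>. sact K l n \<alpha> x)"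

text \<open>Two simplices with a common vertex, as a map from the necklace with joint
  \<open>k\<close>. A simplex inside one bead lies on one side of \<open>k\<close>, so its last
  vertex decides which of the two is restricted.\<close>

definition sim2 :: "'x sset \<Rightarrow> nat \<Rightarrow> nat \<Rightarrow> 'x \<Rightarrow> 'x \<Rightarrow> nat \<Rightarrow> (nat \<Rightarrow> nat) \<Rightarrow> 'x" where
  "sim2 K k n x y = (\<lambda>l \<alpha>. if \<alpha> l \<le> k then sact K l k \<alpha> x else sact K l (n - k) (\<lambda>i\<in>{..l}. \<alpha> i - k) y)"

context simplicial_base
begin

lemma nsimp_sim: "x \<in> cells K n \<Longrightarrow> nsimp K U n (sim K n x)"
  by (auto simp: nsimp_def sim_def sact_closed[OF K] sact_comp[OF K])

lemma wvert_sim: "wvert (sim K n x) i = vertex K n i x"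
  by (simp add: wvert_def sim_def vertex_pt)

lemma wsim_sim: "wsim (sim K n x) s t = sact K (t - s) n (seg s (t - s)) x"
  by (simp add: wsim_def sim_def)

lemma nsimp_sim2:
  assumes x: "x \<in> cells K k" and y: "y \<in> cells K (n - k)" and xy: "vertex K k k x = vertex K (n - k) 0 y"
    and k: "k \<in> U" "k \<le> n"
  shows "nsimp K U n (sim2 K k n x y)"
  unfolding nsimp_def
proof (intro allI ballI impI)
  fix l \<alpha> assume \<alpha>: "\<alpha> \<in> Delta l n" "inbead U l \<alpha>"
  have "k \<le> \<alpha> 0 \<or> \<alpha> l \<le> k" using \<alpha>(2) k by (auto simp: inbead_def)
  then consider "\<alpha> l \<le> k" | "k < \<alpha> l" "k \<le> \<alpha> 0" by linarith
  thus "sim2 K k n x y l \<alpha> \<in> cells K l \<and>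
    (\<forall>m. \<forall>\<beta>\<in>Delta m l. sact K m l \<beta> (sim2 K k n x y l \<alpha>) = sim2 K k n x y m (compose {..m} \<alpha> \<beta>))"
  proof cases
    case 1
    have d: "\<alpha> \<in> Delta l k"
      by (rule DeltaI) (use DeltaD[OF \<alpha>(1)] 1 in \<open>auto intro: order_trans[OF _ 1]\<close>)
    have "\<alpha> (\<beta> m) \<le> k" if "\<beta> \<in> Delta m l" for m \<beta>
      using DeltaD(1)[OF d] DeltaD(1)[OF that] by simp
    thus ?thesis using 1 d x sact_closed[OF K d x]
      by (auto simp: sim2_def sact_comp[OF K] compose_def)
  next
    case 2
    let ?\<alpha> = "\<lambda>i\<in>{..l}. \<alpha> i - k"
    have ge: "k \<le> \<alpha> i" if "i \<le> l" for i using 2(2) DeltaD(2)[OF \<alpha>(1), of 0 i] that by simp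
    have d: "?\<alpha> \<in> Delta l (n - k)"
      by (rule DeltaI) (use DeltaD[OF \<alpha>(1)] in \<open>auto intro: diff_le_mono\<close>)
    have "sact K m l \<beta> (sact K l (n - k) ?\<alpha> y) = sim2 K k n x y m (compose {..m} \<alpha> \<beta>)"
      if \<beta>: "\<beta> \<in> Delta m l" for m \<beta>
    proof (cases "\<alpha> (\<beta> m) \<le> k")
      case False
      have "compose {..m} ?\<alpha> \<beta> = (\<lambda>i\<in>{..m}. compose {..m} \<alpha> \<beta> i - k)"
        using DeltaD(1)[OF \<beta>] by (auto simp: compose_def)
      thus ?thesis using False sact_comp[OF K \<beta> d y] by (simp add: sim2_def compose_def)
    next
      case True
      \<comment> \<open>The simplex lies in the second bead but its restriction is constant at
        \<open>k\<close>, so the definition switches to \<open>x\<close>. Both branches give the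
        degenerate simplex on the shared vertex.\<close>
      have e: "\<alpha> (\<beta> i) = k" if "i \<le> m" for i
      proof (rule antisym)
        have "\<beta> i \<le> \<beta> m" "\<beta> m \<le> l" "\<beta> i \<le> l" using DeltaD(1,2)[OF \<beta>] that by auto
        thus "\<alpha> (\<beta> i) \<le> k" "k \<le> \<alpha> (\<beta> i)"
          using DeltaD(2)[OF \<alpha>(1), of "\<beta> i" "\<beta> m"] True ge by auto
      qed
      let ?c = "\<lambda>i\<in>{..m}. 0"
      have c: "?c \<in> Delta m 0" by (rule DeltaI) auto
      have c1: "compose {..m} \<alpha> \<beta> = compose {..m} (pt k) ?c"
        using e by (auto simp: compose_def pt_def)
      have c2: "compose {..m} ?\<alpha> \<beta> = compose {..m} (pt 0) ?c"
        using e DeltaD(1)[OF \<beta>] by (auto simp: compose_def pt_def)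
      have "sact K m l \<beta> (sact K l (n - k) ?\<alpha> y) = sact K m 0 ?c (vertex K (n - k) 0 y)"
        using sact_comp[OF K \<beta> d y] sact_comp[OF K c pt_Delta[of 0 "n - k"] y] by (simp add: c2 vertex_pt)
      also have "\<dots> = sact K m k (compose {..m} \<alpha> \<beta>) x"
        unfolding xy[symmetric] unfolding c1 vertex_pt using sact_comp[OF K c pt_Delta[of k k] x] by simp
      finally show ?thesis using True by (simp add: sim2_def compose_def)
    qed
    thus ?thesis using 2 d y sact_closed[OF K d y] by (simp add: sim2_def)
  qed
qed

lemma wsim_sim2:
  assumes "x \<in> cells K k" "y \<in> cells K (n - k)" "vertex K k k x = vertex K (n - k) 0 y" "k \<le> n"
  shows "s \<le> t \<Longrightarrow> t \<le> k \<Longrightarrow> wsim (sim2 K k n x y) s t = sact K (t - s) k (seg s (t - s)) x"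
    and "k < n \<Longrightarrow> wsim (sim2 K k n x y) k n = y"
    and "i \<le> k \<Longrightarrow> wvert (sim2 K k n x y) i = vertex K k i x"
    and "k < n \<Longrightarrow> wvert (sim2 K k n x y) n = vertex K (n - k) (n - k) y"
proof -
  show "s \<le> t \<Longrightarrow> t \<le> k \<Longrightarrow> wsim (sim2 K k n x y) s t = sact K (t - s) k (seg s (t - s)) x"
    by (simp add: wsim_def sim2_def) (simp add: seg_def)
  show "i \<le> k \<Longrightarrow> wvert (sim2 K k n x y) i = vertex K k i x"
    by (simp add: wvert_def sim2_def vertex_pt) (simp add: pt_def)
  have "(\<lambda>i\<in>{..n - k}. seg k (n - k) i - k) = seg 0 (n - k)" by (auto simp: seg_def)
  moreover have "\<not> seg k (n - k) (n - k) \<le> k" if "k < n" using that by (simp add: seg_def)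
  ultimately show "k < n \<Longrightarrow> wsim (sim2 K k n x y) k n = y"
    using sact_id[OF K assms(2)] by (simp add: wsim_def sim2_def)
  have "(\<lambda>i\<in>{..0}. pt n i - k) = pt (n - k)" by (auto simp: pt_def)
  moreover have "\<not> pt n 0 \<le> k" if "k < n" using that by (simp add: pt_def)
  ultimately show "k < n \<Longrightarrow> wvert (sim2 K k n x y) n = vertex K (n - k) (n - k) y"
    by (simp add: wvert_def sim2_def vertex_pt)
qed

text \<open>Off \<open>Delta l q\<close> the values of \<open>w\<close> are arbitrary, so agreement
  can only be asked on simplices.\<close>

lemma nelt_cong:
  assumes U: "is_necklace (U, q)" and e: "\<And>l \<alpha>. \<alpha> \<in> Delta l q \<Longrightarrow> w l \<alpha> = w' l \<alpha>"
  shows "nelt (U, q) w = nelt (U, q) w'"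
proof -
  have v: "wvert w i = wvert w' i" if "i \<le> q" for i
    unfolding wvert_def by (rule e[OF pt_Delta[OF that]])
  have "wsim w s t = wsim w' s t \<and> wvert w t = wvert w' t" if "(s, t) \<in> set (steps U)" for s t
    using steps_nec_gap[OF U that] v e[OF seg_Delta[of s "t - s" q]] by (simp add: wsim_def)
  hence "necl U w = necl U w'" unfolding necl_def by (intro map_cong) auto
  thus ?thesis using v by (simp add: nelt_def)
qed

lemma nec_basis_eqI:
  assumes "module R N" "a \<in> V" "is_necklace T"
    "h \<in> mod_hom R (nob (nec_fun R X a b) T) N" "h' \<in> mod_hom R (nob (nec_fun R X a b) T) N"
    "\<And>w. w \<in> bpaths V (gb (gaps (fst T))) a b \<Longrightarrow>
      h (bpure V (gb (gaps (fst T))) a b w) = h' (bpure V (gb (gaps (fst T))) a b w)"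
    "z \<in> carrier (nob (nec_fun R X a b) T)"
  shows "h z = h' z"
  using qtensor_basis_eqI[OF assms(1,2), of h "gb (gaps (fst T))" b h' z] assms(4-)
  by (cases T) (simp add: nob_nec_fun del: map_map)

lemma necl_two: "0 < n \<Longrightarrow> necl {0, n} w = [(wsim w 0 n, wvert w n)]"
  by (simp add: necl_def steps_two)

lemma necl_three: "0 < k \<Longrightarrow> k < n \<Longrightarrow> necl {0, k, n} w = [(wsim w 0 k, wvert w k), (wsim w k n, wvert w n)]"
  by (simp add: necl_def steps_three)

lemma necl_four: "0 < l \<Longrightarrow> l < k \<Longrightarrow> k < n \<Longrightarrow> necl {0, l, k, n} w =
    [(wsim w 0 l, wvert w l), (wsim w l k, wvert w k), (wsim w k n, wvert w n)]"
  by (simp add: necl_def steps_four)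

lemma gaps_two: "0 < n \<Longrightarrow> gaps {0, n} = [n]"
  by (simp add: gaps_def steps_two)

lemma gaps_three: "0 < k \<Longrightarrow> k < n \<Longrightarrow> gaps {0, k, n} = [k, n - k]"
  by (simp add: gaps_def steps_three)

lemma gaps_four: "0 < l \<Longrightarrow> l < k \<Longrightarrow> k < n \<Longrightarrow> gaps {0, l, k, n} = [l, k - l, n - k]"
  by (simp add: gaps_def steps_four)

lemma nelt_sim: "0 < n \<Longrightarrow> x \<in> cb n a b \<Longrightarrow> nelt ({0, n}, n) (sim K n x) = bpure V (gb [n]) a b [(x, b)]"
  by (simp add: nelt_def gaps_two necl_two wvert_sim wsim_sim sact_id[OF K] cells_between_def)

lemma nelt_sim2:
  assumes "0 < k" "k < n" "x \<in> cb k a c" "y \<in> cb (n - k) c b"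
  shows "nelt ({0, k, n}, n) (sim2 K k n x y) = bpure V (gb [k, n - k]) a b [(x, c), (y, b)]"
    "wvert (sim2 K k n x y) 0 = a" "wvert (sim2 K k n x y) n = b" "nsimp K {0, k, n} n (sim2 K k n x y)"
proof -
  have xy: "x \<in> cells K k" "y \<in> cells K (n - k)" "vertex K k k x = vertex K (n - k) 0 y"
    "vertex K k k x = c" "vertex K k 0 x = a" "vertex K (n - k) (n - k) y = b"
    using assms by (auto simp: cells_between_def)
  note ws = wsim_sim2[OF xy(1-3), OF less_imp_le, OF assms(2)]
  show v: "wvert (sim2 K k n x y) 0 = a" "wvert (sim2 K k n x y) n = b"
    using ws(3)[of 0] ws(4) xy assms by auto
  show "nelt ({0, k, n}, n) (sim2 K k n x y) = bpure V (gb [k, n - k]) a b [(x, c), (y, b)]"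
    using assms ws(1)[of 0 k] ws(2) ws(3)[of k] xy sact_id[OF K xy(1)]
    by (simp add: nelt_def gaps_three necl_three v)
  show "nsimp K {0, k, n} n (sim2 K k n x y)"
    by (rule nsimp_sim2[OF xy(1-3)]) (use assms in auto)
qed

text \<open>Functoriality for composites that end in the one-bead necklace, whose basis elements are
  simplices and hence of the form \<open>sim K n x\<close>. This is the form in which one element
  \<open>y\<close> is evaluated at all necklaces.\<close>

lemma nmap_comp:
  assumes n: "0 < n" and T: "is_necklace (T, p)" and U: "is_necklace (U, q)"
    and f: "f \<in> nec_hom (T, p) (U, q)" and g: "g \<in> nec_hom (U, q) ({0, n}, n)" and a: "a \<in> V"
    and z: "z \<in> carrier (nob (nec_fun R X a b) ({0, n}, n))"
  shows "nmap (nec_fun R X a b) (T, p) (U, q) f (nmap (nec_fun R X a b) (U, q) ({0, n}, n) g z) =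
    nmap (nec_fun R X a b) (T, p) ({0, n}, n) (compose {..p} g f) z"
proof -
  have Tp: "T \<subseteq> {..p}" and Uq: "U \<subseteq> {..q}" using T U by (auto simp: is_necklace_def)
  note gf = nec_hom_compose[OF f g Tp]
  show ?thesis
  proof (rule nec_basis_eqI[OF nob_module a is_necklace_insert(1) mod_hom_comp[OF
        nmap_hom[OF U is_necklace_insert(1) g a] nmap_hom[OF T U f a]]
        nmap_hom[OF T is_necklace_insert(1) gf a] _ z])
    fix w assume "w \<in> bpaths V (gb (gaps (fst ({0, n}, n)))) a b"
    then obtain x where x: "w = [(x, b)]" "x \<in> cb n a b"
      using n by (auto simp: gaps_two split: if_splits)
    have xc: "x \<in> cells K n" "vertex K n 0 x = a" "vertex K n n x = b" using x by (auto simp: cells_between_def)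
    let ?w = "sim K n x"
    note s = nsimp_sim[OF xc(1), of "{0, n}"]
    have v: "wvert ?w 0 = a" "wvert ?w n = b" using xc by (simp_all add: wvert_sim)
    have b: "bpure V (gb (gaps (fst ({0, n}, n)))) a b w = nelt ({0, n}, n) ?w"
      using nelt_sim[OF n x(2)] n by (simp add: x gaps_two)
    have g': "g \<in> Delta_f q n" using g by (simp add: nec_hom_def)
    have v': "wvert (wpull ?w g) 0 = a" "wvert (wpull ?w g) q = b"
      using v Delta_fD[OF g'] by (simp_all add: wvert_pull)
    have fD: "f \<in> Delta p q" using f by (simp add: nec_hom_def Delta_f_def)
    show "nmap (nec_fun R X a b) (T, p) (U, q) f (nmap (nec_fun R X a b) (U, q) ({0, n}, n) g
        (bpure V (gb (gaps (fst ({0, n}, n)))) a b w)) =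
      nmap (nec_fun R X a b) (T, p) ({0, n}, n) (compose {..p} g f) (bpure V (gb (gaps (fst ({0, n}, n)))) a b w)"
      unfolding b nmap_nelt[OF U is_necklace_insert(1) g s v] nmap_nelt[OF T is_necklace_insert(1) gf s v]
        nmap_nelt[OF T U f nsimp_pull[OF s g Uq] v']
    proof (rule nelt_cong[OF T])
      fix l \<alpha> assume "\<alpha> \<in> Delta l p"
      thus "wpull (wpull ?w g) f l \<alpha> = wpull ?w (compose {..p} g f) l \<alpha>"
        by (simp add: wpull_def compose_Delta_assoc)
    qed
  qed
qed

text \<open>\<open>\<zeta>\<close> is the linear extension of \<open>Zc\<close>. For the last
  property, \<open>Zc_suffix\<close> says that cutting at \<open>l\<close> after composing at
  \<open>k\<close> is the same as cutting at \<open>l\<close> first and composing the last two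
  beads; hence the left side factors through the restriction of \<open>e\<close> to the joints
  \<open>l\<close> and \<open>k\<close>.\<close>

lemma comp_hom:
  assumes Q: "quasi_category K" and k: "0 < k" "k < n" and ab: "a \<in> V" "b \<in> V"
  obtains \<zeta> where "\<zeta> \<in> mod_hom R (nob (nec_fun R X a b) ({0, k, n}, n)) (nob (nec_fun R X a b) ({0, n}, n))"
    "\<And>e. e \<in> carrier (nob (nec_fun R X a b) ({0, k, n}, n)) \<Longrightarrow>
      nmap (nec_fun R X a b) ({0, k, n}, n) ({0, n}, n) (seg 0 n) (\<zeta> e) = e"
    "\<And>e l. e \<in> carrier (nob (nec_fun R X a b) ({0, k, n}, n)) \<Longrightarrow> 0 < l \<Longrightarrow> l < k \<Longrightarrow>
      nmap (nec_fun R X a b) ({0, l, k, n}, n) ({0, k, n}, n) (seg 0 n) e =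
        \<zero>\<^bsub>nob (nec_fun R X a b) ({0, l, k, n}, n)\<^esub> \<Longrightarrow>
      nmap (nec_fun R X a b) ({0, l, n}, n) ({0, n}, n) (seg 0 n) (\<zeta> e) =
        \<zero>\<^bsub>nob (nec_fun R X a b) ({0, l, n}, n)\<^esub>"
proof -
  let ?Y = "nec_fun R X a b"
  have n: "0 < n" using k by simp
  have nk: "is_necklace ({0, n}, n)" "is_necklace ({0, k, n}, n)" using k by (auto simp: is_necklace_def)
  note nb = nob_nec_fun[of a b]
  have pth: "\<exists>x c y. p = [(x, c), (y, b)] \<and> c \<in> V \<and> x \<in> cb k a c \<and> y \<in> cb (n - k) c b \<and>
      Zc K k (n - k) x y \<in> cb n a b \<and>
      (\<forall>l\<le>k. vertex K n l (Zc K k (n - k) x y) = vertex K k l x) \<and>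
      (\<forall>l\<le>k. sact K l n (seg 0 l) (Zc K k (n - k) x y) = sact K l k (seg 0 l) x) \<and>
      (\<forall>l\<le>k. sact K (n - l) n (seg l (n - l)) (Zc K k (n - k) x y) =
        Zc K (k - l) (n - k) (sact K (k - l) k (seg l (k - l)) x) y) \<and>
      sact K (n - k) n (seg k (n - k)) (Zc K k (n - k) x y) = y"
    if p: "p \<in> bpaths V (gb [k, n - k]) a b" for p
  proof -
    from p obtain x c y where xy: "p = [(x, c), (y, b)]" "c \<in> V" "x \<in> cb k a c" "y \<in> cb (n - k) c b"
      by (auto split: if_splits)
    have x: "x \<in> cells K k" "y \<in> cells K (n - k)" "vertex K k k x = vertex K (n - k) 0 y"
      "vertex K k 0 x = a" "vertex K (n - k) (n - k) y = b"
      using xy by (auto simp: cells_between_def)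
    let ?Z = "Zc K k (n - k) x y"
    have Z: "?Z \<in> cells K n" using Zc_closed[OF Q x(1-3)] k by simp
    have L: "sact K k n (seg 0 k) ?Z = x" using Zc_left[OF Q x(1-3)] k by simp
    have Rt: "sact K (n - k) n (seg k (n - k)) ?Z = y" using Zc_right[OF Q x(1-3)] k by simp
    have sd: "seg 0 k \<in> Delta k n" "seg k (n - k) \<in> Delta (n - k) n" using k by (auto intro!: seg_Delta)
    have vl: "vertex K n l ?Z = vertex K k l x" if "l \<le> k" for l
      using vertex_sact[OF K sd(1) Z that] that unfolding L by (simp add: seg_def)
    have vr: "vertex K n n ?Z = b"
      using vertex_sact[OF K sd(2) Z, of "n - k"] x(5) k unfolding Rt by (simp add: seg_def)
    have s0: "sact K l n (seg 0 l) ?Z = sact K l k (seg 0 l) x" if "l \<le> k" for l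
    proof -
      have "seg 0 l \<in> Delta l k" using that by (intro seg_Delta) simp
      from sact_comp[OF K this sd(1) Z] show ?thesis unfolding L using that by (simp add: compose_seg_seg)
    qed
    have "sact K (n - l) n (seg l (n - l)) ?Z = Zc K (k - l) (n - k) (sact K (k - l) k (seg l (k - l)) x) y"
      if "l \<le> k" for l
      using Zc_suffix[OF Q x(1-3) that] k that by simp
    thus ?thesis using xy Z vl[of 0] vl vr s0 Rt x(4) by (auto simp: cells_between_def)
  qed
  let ?z = "\<lambda>p. bpure V (gb [n]) a b [(Zc K k (n - k) (fst (p ! 0)) (fst (p ! 1)), b)]"
  have zc: "?z p \<in> carrier (nob ?Y ({0, n}, n))" if "p \<in> bpaths V (gb [k, n - k]) a b" for p
    unfolding nb gaps_two[OF n] by (rule bpure_closed) (use pth[OF that] ab in auto)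
  obtain \<zeta> where \<zeta>: "\<zeta> \<in> mod_hom R (qtensor R V (map fquiv (gb [k, n - k])) a b) (nob ?Y ({0, n}, n))"
    "\<And>p. p \<in> bpaths V (gb [k, n - k]) a b \<Longrightarrow> \<zeta> (bpure V (gb [k, n - k]) a b p) = ?z p"
    using qtensor_basis_hom[where g = ?z and Bs = "gb [k, n - k]", OF nob_module zc ab(1)] by blast
  have \<zeta>h: "\<zeta> \<in> mod_hom R (nob ?Y ({0, k, n}, n)) (nob ?Y ({0, n}, n))"
    using \<zeta>(1) unfolding nb gaps_three[OF k] .
  have bk: "bpaths V (gb (gaps (fst ({0, k, n}, n)))) a b = bpaths V (gb [k, n - k]) a b"
    "bpure V (gb (gaps (fst ({0, k, n}, n)))) a b = bpure V (gb [k, n - k]) a b"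
    using k by (simp_all add: gaps_three)
  have mu: "nmap ?Y (U, n) ({0, n}, n) (seg 0 n) (?z p) = nelt (U, n) (wpull (sim K n (Zc K k (n - k) (fst (p ! 0)) (fst (p ! 1)))) (seg 0 n))"
    if p: "p \<in> bpaths V (gb [k, n - k]) a b" and U: "is_necklace (U, n)" for p U
  proof -
    obtain Z where Z: "Z = Zc K k (n - k) (fst (p ! 0)) (fst (p ! 1))" "Z \<in> cb n a b" using pth[OF p] by auto
    have Zc: "Z \<in> cells K n" "vertex K n 0 Z = a" "vertex K n n Z = b" using Z(2) by (auto simp: cells_between_def)
    have h: "seg 0 n \<in> nec_hom (U, n) ({0, n}, n)" by (rule seg_nec_hom) (use U in \<open>auto simp: is_necklace_def\<close>)
    show ?thesis unfolding Z(1)[symmetric] nelt_sim[OF n Z(2), symmetric]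
      by (rule nmap_nelt[OF U nk(1) h nsimp_sim[OF Zc(1)]]) (use Zc in \<open>simp_all add: wvert_sim\<close>)
  qed
  have c1: "nmap ?Y ({0, k, n}, n) ({0, n}, n) (seg 0 n) (\<zeta> e) = e"
    if e: "e \<in> carrier (nob ?Y ({0, k, n}, n))" for e
  proof (rule nec_basis_eqI[OF nob_module ab(1) nk(2) mod_hom_comp[OF \<zeta>h nmap_hom[OF nk(2,1) seg_nec_hom ab(1)]]
        mod_hom_id _ e])
    fix p assume p: "p \<in> bpaths V (gb (gaps (fst ({0, k, n}, n)))) a b"
    hence p: "p \<in> bpaths V (gb [k, n - k]) a b" unfolding bk .
    obtain x c y where xy: "p = [(x, c), (y, b)]" "c \<in> V" "x \<in> cb k a c" "y \<in> cb (n - k) c b"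
      "Zc K k (n - k) x y \<in> cb n a b"
      "vertex K n k (Zc K k (n - k) x y) = vertex K k k x"
      "sact K k n (seg 0 k) (Zc K k (n - k) x y) = sact K k k (seg 0 k) x"
      "sact K (n - k) n (seg k (n - k)) (Zc K k (n - k) x y) = y" using pth[OF p] by blast
    show "nmap ?Y ({0, k, n}, n) ({0, n}, n) (seg 0 n) (\<zeta> (bpure V (gb (gaps (fst ({0, k, n}, n)))) a b p)) =
      bpure V (gb (gaps (fst ({0, k, n}, n)))) a b p"
      unfolding bk \<zeta>(2)[OF p] mu[OF p nk(2)]
      using xy k sact_id[OF K] by (simp add: nelt_def gaps_three necl_three wsim_pull_seg wvert_pull_seg wsim_sim wvert_sim
        cells_between_def)
  qed (use k in auto)
  have c2: "nmap ?Y ({0, l, n}, n) ({0, n}, n) (seg 0 n) (\<zeta> e) = \<zero>\<^bsub>nob ?Y ({0, l, n}, n)\<^esub>"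
    if e: "e \<in> carrier (nob ?Y ({0, k, n}, n))" and l: "0 < l" "l < k"
      and z: "nmap ?Y ({0, l, k, n}, n) ({0, k, n}, n) (seg 0 n) e = \<zero>\<^bsub>nob ?Y ({0, l, k, n}, n)\<^esub>" for e l
  proof -
    have ln: "l < n" using l k by simp
    have nl: "is_necklace ({0, l, n}, n)" "is_necklace ({0, l, k, n}, n)" using k l by (auto simp: is_necklace_def)
    have hl: "seg 0 n \<in> nec_hom ({0, l, n}, n) ({0, n}, n)" "seg 0 n \<in> nec_hom ({0, l, k, n}, n) ({0, k, n}, n)"
      by (rule seg_nec_hom; use k l in auto)+
    \<comment> \<open>The map \<open>\<zeta>'\<close> built from these values keeps the bead up to
      \<open>l\<close> and composes the two beads behind it.\<close>
    let ?z' = "\<lambda>p. bpure V (gb [l, n - l]) a b [p ! 0, (Zc K (k - l) (n - k) (fst (p ! 1)) (fst (p ! 2)), b)]"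
    have z'c: "?z' p \<in> carrier (nob ?Y ({0, l, n}, n))" if p: "p \<in> bpaths V (gb [l, k - l, n - k]) a b" for p
    proof -
      from p obtain x' c' x c y where xy: "p = [(x', c'), (x, c), (y, b)]" "c' \<in> V" "c \<in> V" "x' \<in> cb l a c'"
        "x \<in> cb (k - l) c' c" "y \<in> cb (n - k) c b"
        by (auto split: if_splits)
      have x: "x \<in> cells K (k - l)" "y \<in> cells K (n - k)" "vertex K (k - l) (k - l) x = vertex K (n - k) 0 y"
        "vertex K (k - l) 0 x = c'" "vertex K (n - k) (n - k) y = b"
        using xy by (auto simp: cells_between_def)
      let ?Z = "Zc K (k - l) (n - k) x y"
      have nl': "k - l + (n - k) = n - l" using k l by simp
      have Z: "?Z \<in> cells K (n - l)" using Zc_closed[OF Q x(1-3)] nl' by simp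
      have sd: "seg 0 (k - l) \<in> Delta (k - l) (n - l)" "seg (k - l) (n - k) \<in> Delta (n - k) (n - l)"
        using k l by (auto intro!: seg_Delta)
      have "vertex K (n - l) 0 ?Z = c'"
        using vertex_sact[OF K sd(1) Z, of 0] Zc_left[OF Q x(1-3)] x(4) nl' by (simp add: seg_def)
      moreover have "vertex K (n - l) (n - l) ?Z = b"
        using vertex_sact[OF K sd(2) Z, of "n - k"] Zc_right[OF Q x(1-3)] x(5) nl' by (simp add: seg_def)
      ultimately have "?Z \<in> cb (n - l) c' b" using Z by (simp add: cells_between_def)
      thus ?thesis unfolding nb gaps_three[OF l(1) ln] by (intro bpure_closed) (use xy ab in auto)
    qed
    obtain \<zeta>' where \<zeta>': "\<zeta>' \<in> mod_hom R (qtensor R V (map fquiv (gb [l, k - l, n - k])) a b) (nob ?Y ({0, l, n}, n))"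
      "\<And>p. p \<in> bpaths V (gb [l, k - l, n - k]) a b \<Longrightarrow> \<zeta>' (bpure V (gb [l, k - l, n - k]) a b p) = ?z' p"
      using qtensor_basis_hom[where g = ?z' and Bs = "gb [l, k - l, n - k]", OF nob_module z'c ab(1)] by blast
    have \<zeta>'h: "\<zeta>' \<in> mod_hom R (nob ?Y ({0, l, k, n}, n)) (nob ?Y ({0, l, n}, n))"
      using \<zeta>'(1) unfolding nb gaps_four[OF l k(2)] .
    have "nmap ?Y ({0, l, n}, n) ({0, n}, n) (seg 0 n) (\<zeta> e) =
      \<zeta>' (nmap ?Y ({0, l, k, n}, n) ({0, k, n}, n) (seg 0 n) e)"
    proof (rule nec_basis_eqI[OF nob_module ab(1) nk(2) mod_hom_comp[OF \<zeta>h nmap_hom[OF nl(1) nk(1) hl(1) ab(1)]]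
          mod_hom_comp[OF nmap_hom[OF nl(2) nk(2) hl(2) ab(1)] \<zeta>'h] _ e])
      fix p assume p: "p \<in> bpaths V (gb (gaps (fst ({0, k, n}, n)))) a b"
      hence p: "p \<in> bpaths V (gb [k, n - k]) a b" unfolding bk .
      obtain x c y where xy: "p = [(x, c), (y, b)]" "c \<in> V" "x \<in> cb k a c" "y \<in> cb (n - k) c b"
        "Zc K k (n - k) x y \<in> cb n a b"
        "vertex K n l (Zc K k (n - k) x y) = vertex K k l x"
        "sact K l n (seg 0 l) (Zc K k (n - k) x y) = sact K l k (seg 0 l) x"
        "sact K (n - l) n (seg l (n - l)) (Zc K k (n - k) x y) =
          Zc K (k - l) (n - k) (sact K (k - l) k (seg l (k - l)) x) y" using pth[OF p] less_imp_le[OF l(2)] by blast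
      have x: "x \<in> cells K k" "y \<in> cells K (n - k)" "vertex K k k x = vertex K (n - k) 0 y"
        "vertex K k 0 x = a" "vertex K k k x = c" "vertex K (n - k) (n - k) y = b"
        using xy by (auto simp: cells_between_def)
      note s2 = nelt_sim2[OF k xy(3,4)]
      note ws = wsim_sim2[OF x(1-3) less_imp_le[OF k(2)]]
      let ?w = "wpull (sim2 K k n x y) (seg 0 n)"
      let ?p = "[(sact K l k (seg 0 l) x, vertex K k l x), (sact K (k - l) k (seg l (k - l)) x, c), (y, b)]"
      have "nmap ?Y ({0, l, k, n}, n) ({0, k, n}, n) (seg 0 n) (bpure V (gb [k, n - k]) a b p) =
        nelt ({0, l, k, n}, n) ?w"
        unfolding xy(1) s2(1)[symmetric] by (rule nmap_nelt[OF nl(2) nk(2) hl(2) s2(4,2,3)])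
      also have "\<dots> = bpure V (gb [l, k - l, n - k]) a b ?p"
        unfolding nelt_def fst_conv snd_conv gaps_four[OF l k(2)] necl_four[OF l k(2)]
        using k l ws x s2(2,3) by (simp add: wsim_pull_seg wvert_pull_seg)
      finally have nu: "nmap ?Y ({0, l, k, n}, n) ({0, k, n}, n) (seg 0 n) (bpure V (gb [k, n - k]) a b p) =
        bpure V (gb [l, k - l, n - k]) a b ?p" .
      have pc: "?p \<in> bpaths V (gb [l, k - l, n - k]) a b"
        using sact_seg_cells_between[OF K x(1), of 0 l] sact_seg_cells_between[OF K x(1), of l "k - l"]
          vertex_closed[OF K x(1), of l] xy l ab x by simp
      show "nmap ?Y ({0, l, n}, n) ({0, n}, n) (seg 0 n) (\<zeta> (bpure V (gb (gaps (fst ({0, k, n}, n)))) a b p)) =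
        \<zeta>' (nmap ?Y ({0, l, k, n}, n) ({0, k, n}, n) (seg 0 n) (bpure V (gb (gaps (fst ({0, k, n}, n)))) a b p))"
        unfolding bk \<zeta>(2)[OF p] mu[OF p nl(1)] nu \<zeta>'(2)[OF pc]
        using xy l ln by (simp add: nelt_def gaps_three necl_three wsim_pull_seg wvert_pull_seg wsim_sim wvert_sim
          cells_between_def)
    qed
    thus ?thesis unfolding z mod_hom_zero[OF nob_module nob_module \<zeta>'h] .
  qed
  show thesis by (rule that[OF \<zeta>h c1 c2])
qed

end


section \<open>Inclusions on paths, differences, and maps induced on paths\<close>

lemma bpaths_mono:
  assumes "S \<subseteq> S'" "\<And>n c d. B n c d \<subseteq> B' n c d"
  shows "bpaths S (map B ns) a b \<subseteq> bpaths S' (map B' ns) a b"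
proof (induction ns arbitrary: a)
  case (Cons n ns)
  thus ?case using assms by fastforce
qed simp

lemma mod_minus:
  assumes "module R N" "x \<in> carrier N" "y \<in> carrier N"
  shows "x \<ominus>\<^bsub>N\<^esub> y \<in> carrier N" "x \<ominus>\<^bsub>N\<^esub> (x \<ominus>\<^bsub>N\<^esub> y) = y" "x \<ominus>\<^bsub>N\<^esub> \<zero>\<^bsub>N\<^esub> = x" "x \<ominus>\<^bsub>N\<^esub> x = \<zero>\<^bsub>N\<^esub>"
proof -
  interpret module R N by fact
  show "x \<ominus>\<^bsub>N\<^esub> y \<in> carrier N" "x \<ominus>\<^bsub>N\<^esub> \<zero>\<^bsub>N\<^esub> = x" "x \<ominus>\<^bsub>N\<^esub> x = \<zero>\<^bsub>N\<^esub>"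
    using assms by (simp_all add: a_minus_def M.r_neg)
  show "x \<ominus>\<^bsub>N\<^esub> (x \<ominus>\<^bsub>N\<^esub> y) = y"
    using assms by (simp add: a_minus_def M.minus_add M.r_neg2)
qed

context cring
begin

lemma path_map_closed:
  assumes "S \<subseteq> S'" "\<And>m c d. c \<in> S \<Longrightarrow> d \<in> S \<Longrightarrow> \<alpha> m c d \<in> mod_hom R (Q m c d) (Q' m c d)" "a \<in> S"
  shows "p \<in> qpaths S (map Q ns) a b \<Longrightarrow> path_map (\<lambda>x. x) \<alpha> ns a p \<in> qpaths S' (map Q' ns) a b"
  using assms(3)
proof (induction ns arbitrary: a p)
  case (Cons m ns)
  then obtain x c p' where p: "p = (x, c) # p'" "c \<in> S" "x \<in> carrier (Q m a c)" "p' \<in> qpaths S (map Q ns) c b"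
    by auto
  thus ?case using Cons.IH[OF p(4,2)] mod_hom_closed[OF assms(2)[OF Cons.prems(2) p(2)] p(3)] assms(1) by auto
qed (auto split: if_splits)

lemma path_map_multilin:
  assumes "S \<subseteq> S'" "\<And>m c d. c \<in> S \<Longrightarrow> d \<in> S \<Longrightarrow> \<alpha> m c d \<in> mod_hom R (Q m c d) (Q' m c d)"
    "a \<in> S" "multilin S' N (map Q' ns) a b g"
  shows "multilin S N (map Q ns) a b (\<lambda>p. g (path_map (\<lambda>x. x) \<alpha> ns a p))"
  using assms(3,4)
proof (induction ns arbitrary: a g)
  case (Cons m ns)
  show ?case unfolding list.map multilin.simps path_map.simps
  proof (intro ballI conjI)
    fix c x assume c: "c \<in> S" "x \<in> carrier (Q m a c)"
    show "multilin S N (map Q ns) c b (\<lambda>p. g ((\<alpha> m a c x, c) # path_map (\<lambda>x. x) \<alpha> ns c p))"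
      by (rule Cons.IH[OF c(1)])
        (use Cons.prems(2) c assms(1) mod_hom_closed[OF assms(2)[OF Cons.prems(1) c(1)] c(2)] in auto)
  next
    fix c p assume c: "c \<in> S" "p \<in> qpaths S (map Q ns) c b"
    have "path_map (\<lambda>x. x) \<alpha> ns c p \<in> qpaths S' (map Q' ns) c b"
      by (rule path_map_closed[OF assms(1,2) c(1) c(2)])
    hence "(\<lambda>x. g ((x, c) # path_map (\<lambda>x. x) \<alpha> ns c p)) \<in> mod_hom R (Q' m a c) N"
      using Cons.prems(2) c(1) assms(1) by auto
    from mod_hom_comp[OF assms(2)[OF Cons.prems(1) c(1)] this]
    show "(\<lambda>x. g ((\<alpha> m a c x, c) # path_map (\<lambda>x. x) \<alpha> ns c p)) \<in> mod_hom R (Q m a c) N" .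
  qed
qed simp

lemma path_map_bas:
  assumes "\<And>m c d x. x \<in> B m c d \<Longrightarrow> \<alpha> m c d (single R x) = single R x"
  shows "w \<in> bpaths S (map B ns) a b \<Longrightarrow> path_map (\<lambda>x. x) \<alpha> ns a (bas w) = bas w"
proof (induction ns arbitrary: a w)
  case (Cons m ns)
  thus ?case using assms by auto
qed (auto split: if_splits)

end

section \<open>The lifting problem for one inner horn\<close>

locale horn_problem = simplicial_base R K
  for R (structure) and K :: "'x sset" +
  fixes n j :: nat and a b :: 'x
    and \<phi> :: "necklace \<Rightarrow> (nat \<Rightarrow> nat, 'a, (nat \<Rightarrow> nat) \<Rightarrow> 'a) tens \<Rightarrow> ('x, 'a, 'x \<Rightarrow> 'a) tens"
  assumes Q: "quasi_category K" and j: "0 < j" "j < n" and ab: "a \<in> cells K 0" "b \<in> cells K 0"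
    and \<phi>: "nec_nat_trans R (nec_fun R (ftilde R (horn n j)) (pt 0) (pt n)) (nec_fun R (ftilde R K) a b) \<phi>"
begin

sublocale H: simplicial_base R "horn n j"
  by unfold_locales (rule simplicial_set_horn)

sublocale D: simplicial_base R "simplex n"
  by unfold_locales (rule simplicial_set_simplex)

abbreviation (input) "Y \<equiv> nec_fun R X a b"
abbreviation (input) "YH \<equiv> nec_fun R (ftilde R (horn n j)) (pt 0) (pt n)"
abbreviation (input) "YD \<equiv> nec_fun R (ftilde R (simplex n)) (pt 0) (pt n)"
abbreviation (input) "I\<^sub>n \<equiv> ({0, n}, n)"

lemma n: "0 < n" using j by simp

lemma pt_horn: "pt 0 \<in> cells (horn n j) 0" "pt n \<in> cells (horn n j) 0"
proof -
  have "n \<notin> pt 0 ` {..0}" "0 \<notin> pt n ` {..0}" using n by (auto simp: pt_def)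
  thus "pt 0 \<in> cells (horn n j) 0" "pt n \<in> cells (horn n j) 0"
    using j by (auto simp: horn_sel pt_Delta)
qed

lemma pt_simplex: "pt 0 \<in> cells (simplex n) 0" "pt n \<in> cells (simplex n) 0"
  by (simp_all add: simplex_sel pt_Delta)

text \<open>The necklaces in \<open>\<Delta>^n\<close> that lie in the horn. Without a joint over an
  inner vertex, one bead runs from \<open>0\<close> to \<open>n\<close>, and the vertex that it
  misses must be inner and different from \<open>j\<close>. The two directions are
  \<open>nsimp_horn\<close> and \<open>horn_basis\<close>.\<close>

definition adm :: "nat set \<Rightarrow> nat \<Rightarrow> (nat \<Rightarrow> nat) \<Rightarrow> bool" where
  "adm T p g \<longleftrightarrow> g \<in> Delta_f p n \<and>
     ((\<exists>k\<in>g ` T. 0 < k \<and> k < n) \<or> (\<exists>i. 0 < i \<and> i < n \<and> i \<noteq> j \<and> i \<notin> g ` {..p}))"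

definition F :: "nat set \<Rightarrow> nat \<Rightarrow> (nat \<Rightarrow> nat) \<Rightarrow> ('x, 'a, 'x \<Rightarrow> 'a) tens" where
  "F T p g = \<phi> (T, p) (H.nelt (T, p) (gsimp g))"

text \<open>The value at \<open>g\<close> of the natural transformation that the Yoneda lemma
  attaches to an element of the one-bead module.\<close>

definition M :: "nat set \<Rightarrow> nat \<Rightarrow> (nat \<Rightarrow> nat) \<Rightarrow> ('x, 'a, 'x \<Rightarrow> 'a) tens \<Rightarrow> ('x, 'a, 'x \<Rightarrow> 'a) tens" where
  "M T p g = nmap Y (T, p) I\<^sub>n g"

lemma nec_hom_top:
  assumes "is_necklace (T, p)" "g \<in> Delta_f p n"
  shows "g \<in> nec_hom (T, p) I\<^sub>n"
proof -
  have "g 0 \<in> g ` T" "g p \<in> g ` T" using assms(1) by (auto simp: is_necklace_def)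
  thus ?thesis using assms(2) by (simp add: nec_hom_def Delta_fD)
qed

text \<open>If a joint \<open>u\<close> goes to an inner vertex, simplices after \<open>u\<close>
  miss the vertex \<open>0\<close> and simplices before it miss \<open>n\<close>; both differ from
  \<open>j\<close> because the horn is inner.\<close>

lemma nsimp_horn:
  assumes T: "is_necklace (T, p)" and g: "adm T p g"
  shows "nsimp (horn n j) T p (gsimp g)"
  unfolding nsimp_def
proof (intro allI ballI impI)
  fix l \<alpha> assume \<alpha>: "\<alpha> \<in> Delta l p" "inbead T l \<alpha>"
  have gD: "g \<in> Delta_f p n" "g \<in> Delta p n" using g by (auto simp: adm_def Delta_fD)
  have "\<exists>i\<in>{..n}. i \<noteq> j \<and> i \<notin> compose {..l} g \<alpha> ` {..l}"
  proof (cases "\<exists>k\<in>g ` T. 0 < k \<and> k < n")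
    case True
    then obtain u where u: "u \<in> T" "0 < g u" "g u < n" by auto
    have up: "u \<le> p" using u(1) T by (auto simp: is_necklace_def)
    from \<alpha>(2) u(1) consider "u \<le> \<alpha> 0" | "\<alpha> l \<le> u" by (auto simp: inbead_def)
    thus ?thesis
    proof cases
      case 1
      have ne: "g (\<alpha> i) \<noteq> 0" if "i \<le> l" for i
      proof -
        have "u \<le> \<alpha> i" "\<alpha> i \<le> p" using DeltaD(2)[OF \<alpha>(1), of 0 i] DeltaD(1)[OF \<alpha>(1) that] 1 that by auto
        thus ?thesis using DeltaD(2)[OF gD(2), of u "\<alpha> i"] u by simp
      qed
      have "0 \<notin> compose {..l} g \<alpha> ` {..l}"
      proof
        assume "0 \<in> compose {..l} g \<alpha> ` {..l}"
        then obtain i where "i \<le> l" "0 = g (\<alpha> i)" by (auto simp: compose_def)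
        thus False using ne[of i] by simp
      qed
      thus ?thesis using j by (intro bexI[of _ 0]) auto
    next
      case 2
      have ne: "g (\<alpha> i) \<noteq> n" if "i \<le> l" for i
      proof -
        have "\<alpha> i \<le> u" using DeltaD(2)[OF \<alpha>(1), of i l] 2 that by auto
        thus ?thesis using DeltaD(2)[OF gD(2), of "\<alpha> i" u] u up by simp
      qed
      have "n \<notin> compose {..l} g \<alpha> ` {..l}"
      proof
        assume "n \<in> compose {..l} g \<alpha> ` {..l}"
        then obtain i where "i \<le> l" "n = g (\<alpha> i)" by (auto simp: compose_def)
        thus False using ne[of i] by simp
      qed
      thus ?thesis using j by (intro bexI[of _ n]) auto
    qed
  next
    case False
    then obtain i where i: "0 < i" "i < n" "i \<noteq> j" "i \<notin> g ` {..p}" using g by (auto simp: adm_def)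
    have "i \<notin> compose {..l} g \<alpha> ` {..l}" using i(4) DeltaD(1)[OF \<alpha>(1)] by (auto simp: compose_def)
    thus ?thesis using i by (intro bexI[of _ i]) auto
  qed
  thus "gsimp g l \<alpha> \<in> cells (horn n j) l \<and>
    (\<forall>m. \<forall>\<beta>\<in>Delta m l. sact (horn n j) m l \<beta> (gsimp g l \<alpha>) = gsimp g m (compose {..m} \<alpha> \<beta>))"
    using compose_Delta[OF \<alpha>(1) gD(2)] by (simp add: horn_sel gsimp_def compose_Delta_assoc)
qed

lemma wvert_gsimp_ends: "g \<in> Delta_f p n \<Longrightarrow> wvert (gsimp g) 0 = pt 0 \<and> wvert (gsimp g) p = pt n"
  by (simp add: wvert_gsimp Delta_fD)

lemma nelt_horn_closed:
  assumes "is_necklace (T, p)" "adm T p g"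
  shows "H.nelt (T, p) (gsimp g) \<in> carrier (nob YH (T, p))"
  by (rule H.nelt_closed[OF assms(1) nsimp_horn[OF assms]])
    (use assms(2) wvert_gsimp_ends in \<open>auto simp: adm_def\<close>)

lemma \<phi>_hom: "is_necklace T \<Longrightarrow> \<phi> T \<in> mod_hom R (nob YH T) (nob Y T)"
  using \<phi> unfolding nec_nat_trans_def by blast

lemma F_closed:
  assumes "is_necklace (T, p)" "adm T p g"
  shows "F T p g \<in> carrier (nob Y (T, p))"
  unfolding F_def by (rule mod_hom_closed[OF \<phi>_hom[OF assms(1)] nelt_horn_closed[OF assms]])

text \<open>Precomposition with a map of necklaces keeps all joint values of \<open>g\<close> and
  reaches no new vertices, so either witness for \<open>g\<close> remains one.\<close>

lemma adm_compose:
  assumes T: "is_necklace (T, p)" and g: "adm U q g" and f: "f \<in> nec_hom (T, p) (U, q)"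
  shows "adm T p (compose {..p} g f)"
proof -
  have Tp: "T \<subseteq> {..p}" using T by (auto simp: is_necklace_def)
  have f': "f \<in> Delta_f p q" "U \<subseteq> f ` T" using f by (auto simp: nec_hom_def)
  have "compose {..p} g f ` T = g ` f ` T" using Tp by (force simp: compose_def image_image)
  hence "g ` U \<subseteq> compose {..p} g f ` T" using f'(2) by auto
  moreover have "compose {..p} g f ` {..p} \<subseteq> g ` {..q}"
    using DeltaD(1)[OF Delta_fD(1)[OF f'(1)]] by (auto simp: compose_def)
  moreover have "compose {..p} g f \<in> Delta_f p n"
    by (rule compose_Delta_f[OF f'(1)]) (use g in \<open>simp add: adm_def\<close>)
  moreover have "(\<exists>k\<in>g ` U. 0 < k \<and> k < n) \<or> (\<exists>i. 0 < i \<and> i < n \<and> i \<noteq> j \<and> i \<notin> g ` {..q})"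
    using g by (simp add: adm_def)
  ultimately show ?thesis unfolding adm_def by (meson subsetD)
qed

lemma F_natural:
  assumes T: "is_necklace (T, p)" and U: "is_necklace (U, q)" and g: "adm U q g" and f: "f \<in> nec_hom (T, p) (U, q)"
  shows "nmap Y (T, p) (U, q) f (F U q g) = F T p (compose {..p} g f)"
proof -
  have gD: "g \<in> Delta_f q n" using g by (simp add: adm_def)
  have fD: "f \<in> Delta p q" using f by (simp add: nec_hom_def Delta_f_def)
  have "nmap Y (T, p) (U, q) f (F U q g) = \<phi> (T, p) (nmap YH (T, p) (U, q) f (H.nelt (U, q) (gsimp g)))"
    unfolding F_def using \<phi> T U f nelt_horn_closed[OF U g] unfolding nec_nat_trans_def by simp
  also have "nmap YH (T, p) (U, q) f (H.nelt (U, q) (gsimp g)) = H.nelt (T, p) (wpull (gsimp g) f)"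
    by (rule H.nmap_nelt[OF T U f nsimp_horn[OF U g]]) (use wvert_gsimp_ends[OF gD] in auto)
  also have "\<dots> = H.nelt (T, p) (gsimp (compose {..p} g f))"
    by (rule H.nelt_cong[OF T wpull_gsimp[OF fD]])
  finally show ?thesis by (simp add: F_def)
qed

lemma M_hom: "is_necklace (T, p) \<Longrightarrow> g \<in> Delta_f p n \<Longrightarrow> M T p g \<in> mod_hom R (nob Y I\<^sub>n) (nob Y (T, p))"
  unfolding M_def by (rule nmap_hom[OF _ is_necklace_insert(1) nec_hom_top ab(1)])

lemma M_minus:
  assumes "is_necklace (T, p)" "g \<in> Delta_f p n" "u \<in> carrier (nob Y I\<^sub>n)" "v \<in> carrier (nob Y I\<^sub>n)"
  shows "M T p g (u \<ominus>\<^bsub>nob Y I\<^sub>n\<^esub> v) = M T p g u \<ominus>\<^bsub>nob Y (T, p)\<^esub> M T p g v"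
  by (rule mod_hom_minus[OF nob_module nob_module M_hom[OF assms(1,2)] assms(3,4)])

lemma nmap_M:
  assumes "is_necklace (T, p)" "is_necklace (U, q)" "f \<in> nec_hom (T, p) (U, q)" "g \<in> Delta_f q n"
    "u \<in> carrier (nob Y I\<^sub>n)"
  shows "nmap Y (T, p) (U, q) f (M U q g u) = M T p (compose {..p} g f) u"
  unfolding M_def by (rule nmap_comp[OF n assms(1-3) nec_hom_top[OF assms(2,4)] ab(1) assms(5)])

text \<open>The natural transformation \<open>\<phi>\<close> is a compatible family of values \<open>F T p g\<close>, where \<open>g\<close> runs
  over the maps of necklaces to \<open>\<Delta>\<^sup>n\<close> that land in the horn. A filler is an element \<open>y\<close> whose
  images are these values; \<open>good I y\<close> demands this for all \<open>g\<close> that have a joint mapped to an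
  inner vertex or that avoid a vertex in \<open>I\<close>.\<close>

definition good :: "nat set \<Rightarrow> ('x, 'a, 'x \<Rightarrow> 'a) tens \<Rightarrow> bool" where
  "good I y \<longleftrightarrow> y \<in> carrier (nob Y I\<^sub>n) \<and> (\<forall>T p g. is_necklace (T, p) \<longrightarrow> g \<in> Delta_f p n \<longrightarrow>
     (\<exists>k\<in>g ` T. 0 < k \<and> k < n) \<or> (\<exists>i\<in>I. i \<notin> g ` {..p}) \<longrightarrow> M T p g y = F T p g)"

lemma adm_id: "0 < k \<Longrightarrow> k < n \<Longrightarrow> k \<in> T \<Longrightarrow> adm T n (seg 0 n)"
proof -
  assume k: "0 < k" "k < n" "k \<in> T"
  hence "seg 0 n k = k" by (simp add: seg_def)
  hence "k \<in> seg 0 n ` T" using k(3) by (metis imageI)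
  thus ?thesis unfolding adm_def using seg_id_Delta_f k by blast
qed

section \<open>Correcting the comultiplications and then the inner faces\<close>

lemma split_solution:
  "m < n \<Longrightarrow> \<exists>y\<in>carrier (nob Y I\<^sub>n). \<forall>k. 0 < k \<longrightarrow> k \<le> m \<longrightarrow>
    M {0, k, n} n (seg 0 n) y = F {0, k, n} n (seg 0 n)"
proof (induction m)
  case 0
  have "\<zero>\<^bsub>nob Y I\<^sub>n\<^esub> \<in> carrier (nob Y I\<^sub>n)"
  proof -
    interpret N: module R "nob Y I\<^sub>n" by (rule nob_module)
    show ?thesis by simp
  qed
  thus ?case by auto
next
  case (Suc m)
  then obtain y where y: "y \<in> carrier (nob Y I\<^sub>n)"
    "\<And>k. 0 < k \<Longrightarrow> k \<le> m \<Longrightarrow> M {0, k, n} n (seg 0 n) y = F {0, k, n} n (seg 0 n)" by auto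
  let ?k = "Suc m"
  have k: "0 < ?k" "?k < n" using Suc by auto
  have nk: "is_necklace ({0, ?k, n}, n)" using k by (intro is_necklace_insert) auto
  note id = seg_id_Delta_f[of n]
  have ad: "adm {0, ?k, n} n (seg 0 n)" by (rule adm_id[OF k]) simp
  obtain \<zeta> where \<zeta>: "\<zeta> \<in> mod_hom R (nob Y ({0, ?k, n}, n)) (nob Y I\<^sub>n)"
    "\<And>e. e \<in> carrier (nob Y ({0, ?k, n}, n)) \<Longrightarrow> nmap Y ({0, ?k, n}, n) I\<^sub>n (seg 0 n) (\<zeta> e) = e"
    "\<And>e l. e \<in> carrier (nob Y ({0, ?k, n}, n)) \<Longrightarrow> 0 < l \<Longrightarrow> l < ?k \<Longrightarrow>
      nmap Y ({0, l, ?k, n}, n) ({0, ?k, n}, n) (seg 0 n) e = \<zero>\<^bsub>nob Y ({0, l, ?k, n}, n)\<^esub> \<Longrightarrow>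
      nmap Y ({0, l, n}, n) I\<^sub>n (seg 0 n) (\<zeta> e) = \<zero>\<^bsub>nob Y ({0, l, n}, n)\<^esub>"
    using comp_hom[OF Q k ab] by metis
  let ?N = "nob Y ({0, ?k, n}, n)"
  define e where "e = M {0, ?k, n} n (seg 0 n) y \<ominus>\<^bsub>?N\<^esub> F {0, ?k, n} n (seg 0 n)"
  note Mc = mod_hom_closed[OF M_hom[OF nk id] y(1)] and Fc = F_closed[OF nk ad]
  have ec: "e \<in> carrier ?N" unfolding e_def by (rule mod_minus(1)[OF nob_module Mc Fc])
  note zc = mod_hom_closed[OF \<zeta>(1) ec]
  let ?y = "y \<ominus>\<^bsub>nob Y I\<^sub>n\<^esub> \<zeta> e"
  have yc: "?y \<in> carrier (nob Y I\<^sub>n)" by (rule mod_minus(1)[OF nob_module y(1) zc])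
  have "M {0, l, n} n (seg 0 n) ?y = F {0, l, n} n (seg 0 n)" if l: "0 < l" "l \<le> ?k" for l
  proof (cases "l = ?k")
    case True
    have "M {0, ?k, n} n (seg 0 n) (\<zeta> e) = e" unfolding M_def by (rule \<zeta>(2)[OF ec])
    hence "M {0, ?k, n} n (seg 0 n) ?y = M {0, ?k, n} n (seg 0 n) y \<ominus>\<^bsub>?N\<^esub> e"
      by (simp add: M_minus[OF nk id y(1) zc])
    thus ?thesis unfolding e_def mod_minus(2)[OF nob_module Mc Fc] True .
  next
    case False
    hence lk: "l < ?k" "l \<le> m" "l < n" using l k by auto
    have nl: "is_necklace ({0, l, n}, n)" "is_necklace ({0, l, ?k, n}, n)"
      using k lk by (auto simp: is_necklace_def)
    have h: "seg 0 n \<in> nec_hom ({0, l, ?k, n}, n) ({0, ?k, n}, n)"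
      "seg 0 n \<in> nec_hom ({0, l, ?k, n}, n) ({0, l, n}, n)"
      by (rule seg_nec_hom; use k lk in auto)+
    have c: "compose {..n} (seg 0 n) (seg 0 n) = seg 0 n" by (simp add: compose_seg_seg)
    have al: "adm {0, l, n} n (seg 0 n)" by (rule adm_id[OF l(1) lk(3)]) simp
    have al': "adm {0, l, ?k, n} n (seg 0 n)" by (rule adm_id[OF l(1) lk(3)]) simp
    \<comment> \<open>Restricted to the joints \<open>l\<close> and \<open>?k\<close>, both terms of
      \<open>e\<close> become the prescribed value: \<open>F\<close> by naturality, and
      \<open>y\<close> because it is already right at \<open>l\<close>. So the error restricts to
      zero there.\<close>
    have "M {0, l, ?k, n} n (seg 0 n) y = nmap Y ({0, l, ?k, n}, n) ({0, l, n}, n) (seg 0 n) (F {0, l, n} n (seg 0 n))"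
      using nmap_M[OF nl(2,1) h(2) id y(1)] y(2)[OF l(1) lk(2)] c by simp
    also have "\<dots> = F {0, l, ?k, n} n (seg 0 n)" using F_natural[OF nl(2,1) al h(2)] c by simp
    finally have "nmap Y ({0, l, ?k, n}, n) ({0, ?k, n}, n) (seg 0 n) e = \<zero>\<^bsub>nob Y ({0, l, ?k, n}, n)\<^esub>"
      unfolding e_def
      using mod_hom_minus[OF nob_module nob_module nmap_hom[OF nl(2) nk h(1) ab(1)] Mc Fc]
        nmap_M[OF nl(2) nk h(1) id y(1)] F_natural[OF nl(2) nk ad h(1)] c
        mod_minus(4)[OF nob_module F_closed[OF nl(2) al'] F_closed[OF nl(2) al']] by simp
    from \<zeta>(3)[OF ec l(1) lk(1) this]
    have z: "M {0, l, n} n (seg 0 n) (\<zeta> e) = \<zero>\<^bsub>nob Y ({0, l, n}, n)\<^esub>" unfolding M_def .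
    show ?thesis
      unfolding M_minus[OF nl(1) id y(1) zc] z y(2)[OF l(1) lk(2)]
      by (rule mod_minus(3)[OF nob_module F_closed[OF nl(1) al] F_closed[OF nl(1) al]])
  qed
  thus ?case using yc by blast
qed

text \<open>A \<open>g\<close> that sends a joint to an inner vertex \<open>k\<close> is also a map
  of necklaces to \<open>({0, k, n}, n)\<close>. Its value is therefore a restriction of the value
  at the split \<open>k\<close>, which is already correct.\<close>

lemma good_empty: "\<exists>y. good {} y"
proof -
  have m: "n - 1 < n" using n by simp
  obtain y where y: "y \<in> carrier (nob Y I\<^sub>n)"
    "\<And>k. 0 < k \<Longrightarrow> k \<le> n - 1 \<Longrightarrow> M {0, k, n} n (seg 0 n) y = F {0, k, n} n (seg 0 n)"
    using split_solution[OF m] by blast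
  have "M T p g y = F T p g" if T: "is_necklace (T, p)" and g: "g \<in> Delta_f p n"
    and k: "k \<in> g ` T" "0 < k" "k < n" for T p g k
  proof -
    have nk: "is_necklace ({0, k, n}, n)" using k by (intro is_necklace_insert) auto
    have "{0, n} \<subseteq> g ` T" using nec_hom_top[OF T g] by (simp add: nec_hom_def)
    hence h: "g \<in> nec_hom (T, p) ({0, k, n}, n)" using g k by (simp add: nec_hom_def)
    have ad: "adm {0, k, n} n (seg 0 n)" by (rule adm_id[OF k(2,3)]) simp
    have c: "compose {..p} (seg 0 n) g = g" by (rule compose_seg_left[OF Delta_fD(1)[OF g]])
    have "M T p g y = nmap Y (T, p) ({0, k, n}, n) g (M {0, k, n} n (seg 0 n) y)"
      using nmap_M[OF T nk h seg_id_Delta_f y(1)] c by simp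
    also have "\<dots> = F T p g" using F_natural[OF T nk ad h] y(2)[of k] k c by simp
    finally show ?thesis .
  qed
  hence "good {} y" using y(1) unfolding good_def by blast
  thus ?thesis by blast
qed

text \<open>The endomap of \<open>[n]\<close> that moves only \<open>i\<close>, to a neighbour \<open>i'\<close>, factors through the face
  opposite to \<open>i\<close>. Subtracting the error of \<open>y\<close> at this map corrects \<open>y\<close> on everything that
  avoids \<open>i\<close>.\<close>

lemma good_insert:
  assumes y: "good I y" and i: "0 < i" "i < n" "i \<noteq> j" and i': "0 < i'" "i' < n" "i' \<notin> I"
    "i' = Suc i \<or> i = Suc i'"
  shows "\<exists>y. good (insert i I) y"
proof -
  define r where "r = (\<lambda>k\<in>{..n}. if k = i then i' else k)"
  have yc: "y \<in> carrier (nob Y I\<^sub>n)" using y by (simp add: good_def)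
  have "r \<in> Delta n n" by (rule DeltaI) (use i i' in \<open>auto simp: r_def\<close>)
  hence rD: "r \<in> Delta_f n n" using i by (simp add: Delta_f_def r_def)
  have In: "is_necklace I\<^sub>n" by (rule is_necklace_insert)
  have ri: "i \<notin> r ` {..n}" using i' by (auto simp: r_def)
  have ar: "adm {0, n} n r" unfolding adm_def using rD ri i by blast
  note Mc = mod_hom_closed[OF M_hom[OF In rD] yc] and Fc = F_closed[OF In ar]
  let ?e = "M {0, n} n r y \<ominus>\<^bsub>nob Y I\<^sub>n\<^esub> F {0, n} n r"
  have ec: "?e \<in> carrier (nob Y I\<^sub>n)" by (rule mod_minus(1)[OF nob_module Mc Fc])
  let ?y = "y \<ominus>\<^bsub>nob Y I\<^sub>n\<^esub> ?e"
  have y'c: "?y \<in> carrier (nob Y I\<^sub>n)" by (rule mod_minus(1)[OF nob_module yc ec])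
  have "M T p g ?y = F T p g" if T: "is_necklace (T, p)" and g: "g \<in> Delta_f p n"
    and or: "(\<exists>k\<in>g ` T. 0 < k \<and> k < n) \<or> (\<exists>l\<in>insert i I. l \<notin> g ` {..p})" for T p g
  proof -
    let ?rg = "compose {..p} r g"
    have rg: "?rg \<in> Delta_f p n" by (rule compose_Delta_f[OF g rD])
    have h: "g \<in> nec_hom (T, p) I\<^sub>n" by (rule nec_hom_top[OF T g])
    have arg: "adm T p ?rg" by (rule adm_compose[OF T ar h])
    have Tp: "T \<subseteq> {..p}" using T by (auto simp: is_necklace_def)
    have gn: "g u \<le> n" if "u \<le> p" for u using DeltaD(1)[OF Delta_fD(1)[OF g] that] .
    note Myc = mod_hom_closed[OF M_hom[OF T g] yc] and MRc = mod_hom_closed[OF M_hom[OF T rg] yc]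
      and Frc = F_closed[OF T arg]
    have "M T p g ?e = M T p g (M {0, n} n r y) \<ominus>\<^bsub>nob Y (T, p)\<^esub> M T p g (F {0, n} n r)"
      by (rule M_minus[OF T g Mc Fc])
    also have "M T p g (M {0, n} n r y) = M T p ?rg y"
      using nmap_M[OF T In h rD yc] unfolding M_def .
    also have "M T p g (F {0, n} n r) = F T p ?rg"
      using F_natural[OF T In ar h] unfolding M_def .
    finally have e: "M T p g ?y = M T p g y \<ominus>\<^bsub>nob Y (T, p)\<^esub> (M T p ?rg y \<ominus>\<^bsub>nob Y (T, p)\<^esub> F T p ?rg)"
      unfolding M_minus[OF T g yc ec] by simp
    show ?thesis
    proof (cases "i \<in> g ` {..p}")
      case False
      \<comment> \<open>Moving \<open>i\<close> does not affect a map that avoids \<open>i\<close>,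
        so the correction is the full error of \<open>y\<close> at \<open>g\<close>.\<close>
      have "?rg = g"
        using False gn DeltaD(3)[OF Delta_fD(1)[OF g]] by (auto simp: r_def compose_def extensional_def fun_eq_iff)
      thus ?thesis using e mod_minus(2)[OF nob_module Myc Frc] by simp
    next
      case True
      hence or': "(\<exists>k\<in>g ` T. 0 < k \<and> k < n) \<or> (\<exists>l\<in>I. l \<notin> g ` {..p})" using or by auto
      \<comment> \<open>Now the correction must vanish at \<open>g\<close>. Since \<open>i'\<close>
        is inner, inner joint values stay inner; since \<open>i'\<close> is not in \<open>I\<close>,
        an avoided vertex of \<open>I\<close> stays avoided. So \<open>y\<close> is already right at
        \<open>?rg\<close>.\<close>
      have "(\<exists>k\<in>?rg ` T. 0 < k \<and> k < n) \<or> (\<exists>l\<in>I. l \<notin> ?rg ` {..p})"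
        using or'
      proof
        assume "\<exists>k\<in>g ` T. 0 < k \<and> k < n"
        then obtain u where u: "u \<in> T" "0 < g u" "g u < n" by auto
        have "0 < ?rg u \<and> ?rg u < n" using u Tp i' gn by (auto simp: r_def compose_def)
        thus ?thesis using u(1) by blast
      next
        assume "\<exists>l\<in>I. l \<notin> g ` {..p}"
        then obtain l where l: "l \<in> I" "l \<notin> g ` {..p}" by blast
        have "l \<notin> ?rg ` {..p}" using l i'(3) gn by (auto simp: r_def compose_def split: if_splits)
        thus ?thesis using l(1) by blast
      qed
      hence "M T p ?rg y = F T p ?rg" using y T rg unfolding good_def by blast
      moreover have "M T p g y = F T p g" using y T g or' unfolding good_def by blast
      ultimately show ?thesis
        using e mod_minus(4)[OF nob_module Frc Frc] mod_minus(3)[OF nob_module Myc Myc] by simp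
    qed
  qed
  hence "good (insert i I) ?y" using y'c unfolding good_def by blast
  thus ?thesis by blast
qed

text \<open>The vertices are treated upwards, each moved to its right neighbour, which is at most
  \<open>j\<close> and therefore inner and untreated.\<close>

lemma good_left: "m < j \<Longrightarrow> \<exists>y. good {1..m} y"
proof (induction m)
  case 0
  thus ?case using good_empty by simp
next
  case (Suc m)
  then obtain y where "good {1..m} y" by auto
  from good_insert[OF this, of "Suc m" "Suc (Suc m)"] Suc.prems j
  show ?case by (simp add: atLeastAtMostSuc_conv)
qed

text \<open>The mirror image: vertices are treated downwards from \<open>n - 1\<close>, each moved
  to its left neighbour, which is at least \<open>j\<close> and hence not treated in either
  round.\<close>

lemma good_right: "m < n - j \<Longrightarrow> \<exists>y. good ({1..<j} \<union> {n - m..<n}) y"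
proof (induction m)
  case 0
  have "{1..j - 1} = {1..<j}" using j by auto
  thus ?case using good_left[of "j - 1"] j by simp
next
  case (Suc m)
  then obtain y where "good ({1..<j} \<union> {n - m..<n}) y" by auto
  hence "\<exists>y. good (insert (n - Suc m) ({1..<j} \<union> {n - m..<n})) y"
  proof (rule good_insert)
    have "j \<le> n - Suc (Suc m)" "n - Suc (Suc m) < n - m" using Suc.prems by linarith+
    thus "n - Suc (Suc m) \<notin> {1..<j} \<union> {n - m..<n}" by simp
    show "n - Suc (Suc m) = Suc (n - Suc m) \<or> n - Suc m = Suc (n - Suc (Suc m))" using Suc.prems by linarith
  qed (use Suc.prems j in linarith)+
  moreover have "insert (n - Suc m) ({1..<j} \<union> {n - m..<n}) = {1..<j} \<union> {n - Suc m..<n}"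
    using Suc.prems by auto
  ultimately show ?case by simp
qed

lemma solution:
  "\<exists>y\<in>carrier (nob Y I\<^sub>n). \<forall>T p g. is_necklace (T, p) \<longrightarrow> adm T p g \<longrightarrow> M T p g y = F T p g"
proof -
  \<comment> \<open>With this number of steps the second round ends at \<open>j + 1\<close>, so
    every inner vertex except \<open>j\<close> has been treated.\<close>
  have "n - (n - Suc j) = Suc j" "n - Suc j < n - j" using j by linarith+
  then obtain y where y: "good ({1..<j} \<union> {Suc j..<n}) y" using good_right[of "n - Suc j"] by auto
  have "M T p g y = F T p g" if T: "is_necklace (T, p)" and g: "adm T p g" for T p g
  proof -
    have "(\<exists>k\<in>g ` T. 0 < k \<and> k < n) \<or> (\<exists>i\<in>{1..<j} \<union> {Suc j..<n}. i \<notin> g ` {..p})"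
    proof (cases "\<exists>k\<in>g ` T. 0 < k \<and> k < n")
      case False
      then obtain i where i: "0 < i" "i < n" "i \<noteq> j" "i \<notin> g ` {..p}" using g unfolding adm_def by blast
      have "i \<in> {1..<j} \<union> {Suc j..<n}" using i by auto
      thus ?thesis using i(4) by blast
    qed blast
    thus ?thesis using y T g unfolding good_def adm_def by blast
  qed
  thus ?thesis using y unfolding good_def by blast
qed

section \<open>Bases of the functors of the simplex and of the horn\<close>

lemma simplex_basis:
  assumes T: "is_necklace (T, p)" and w: "w \<in> bpaths (cells (simplex n) 0) (map (cells_between (simplex n)) (gaps T)) (pt 0) (pt n)"
  shows "\<exists>g\<in>Delta_f p n. w = necl T (gsimp g)"
proof -
  note st = steps_nec[OF T]
  have "w \<in> bpaths (cells (simplex n) 0) (map (\<lambda>(s, t). cells_between (simplex n) (t - s)) (steps T)) (pt 0) (pt n)"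
    using w by (simp add: gaps_def o_def case_prod_beta')
  from simplex_path[OF st(1,2) this] obtain g where g: "g 0 = 0" "g p = n"
    "\<forall>i k. i \<le> k \<longrightarrow> k \<le> p \<longrightarrow> g i \<le> g k" "\<forall>i. i \<le> p \<longrightarrow> g i \<le> n"
    "w = map (\<lambda>(s, t). (wsim (gsimp g) s t, wvert (gsimp g) t)) (steps T)" by auto
  have d: "restrict g {..p} \<in> Delta_f p n"
    unfolding Delta_f_def using g by (auto intro!: DeltaI)
  have "w = necl T (gsimp (restrict g {..p}))"
    unfolding g(5) necl_def
  proof (intro map_cong refl, clarify)
    fix s t assume "(s, t) \<in> set (steps T)"
    from steps_nec_gap[OF T this] have "s \<le> t" "t \<le> p" by auto
    thus "wsim (gsimp g) s t = wsim (gsimp (restrict g {..p})) s t \<and>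
      wvert (gsimp g) t = wvert (gsimp (restrict g {..p})) t"
      by (auto simp: wsim_gsimp wvert_gsimp fun_eq_iff)
  qed
  thus ?thesis using d by blast
qed

text \<open>Every vertex of \<open>[p]\<close> lies in some bead, whose simplex shows the value of
  \<open>g\<close> there. Together with \<open>simplex_basis\<close>, the maps in
  \<open>Delta_f p n\<close> index a basis, which is the freeness behind the Yoneda
  argument.\<close>

lemma necl_inject:
  assumes T: "is_necklace (T, p)" and g: "g \<in> Delta_f p n" "g' \<in> Delta_f p n"
    and e: "necl T (gsimp g) = necl T (gsimp g')"
  shows "g = g'"
proof
  fix i
  show "g i = g' i"
  proof (cases "i \<le> p")
    case True
    \<comment> \<open>A necklace of length \<open>0\<close> has no beads; it is excluded because
      \<open>g\<close> goes from \<open>0\<close> to \<open>n > 0\<close>.\<close>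
    have p: "0 < p" using Delta_fD(2,3)[OF g(1)] n by (cases p) auto
    obtain s t where st: "(s, t) \<in> set (steps T)" "s \<le> i" "i \<le> t"
      using linked_cover[OF steps_nec(1,2)[OF T] _ True p] by auto
    have "wsim (gsimp g) s t = wsim (gsimp g') s t" using e st(1) by (auto simp: necl_def)
    hence "wsim (gsimp g) s t (i - s) = wsim (gsimp g') s t (i - s)" by simp
    moreover have "i - s \<le> t - s" using st by simp
    ultimately show ?thesis using st by (simp add: wsim_gsimp)
  next
    case False
    thus ?thesis using DeltaD(3)[OF Delta_fD(1)[OF g(1)]] DeltaD(3)[OF Delta_fD(1)[OF g(2)]]
      by (simp add: extensional_def)
  qed
qed

lemma nelt_simplex:
  "g \<in> Delta_f p n \<Longrightarrow> D.nelt (T, p) (gsimp g) =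
    bpure (cells (simplex n) 0) (map (cells_between (simplex n)) (gaps T)) (pt 0) (pt n) (necl T (gsimp g))"
  using wvert_gsimp_ends by (simp add: D.nelt_def)

lemma necl_simplex:
  assumes "is_necklace (T, p)" "g \<in> Delta_f p n"
  shows "necl T (gsimp g) \<in> bpaths (cells (simplex n) 0) (map (cells_between (simplex n)) (gaps T)) (pt 0) (pt n)"
  using D.necl_closed[OF nsimp_gsimp_simplex[OF Delta_fD(1)[OF assms(2)]] assms(1)] wvert_gsimp_ends[OF assms(2)]
  by simp

text \<open>If all joints go to \<open>0\<close> or \<open>n\<close>, some bead jumps from
  \<open>0\<close> to \<open>n\<close>. Being a simplex of the horn, it misses some
  \<open>i \<noteq> j\<close>, which is inner as the ends are hit. By monotonicity \<open>g\<close>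
  is constantly \<open>0\<close> before this bead and constantly \<open>n\<close> after it, so
  \<open>i\<close> is missed altogether.\<close>

lemma horn_basis:
  assumes T: "is_necklace (T, p)" and w: "w \<in> bpaths (cells (horn n j) 0) (map (cells_between (horn n j)) (gaps T)) (pt 0) (pt n)"
  shows "\<exists>g. adm T p g \<and> w = necl T (gsimp g)"
proof -
  have SS: "cells (horn n j) 0 \<subseteq> cells (simplex n) 0" by (auto simp: horn_sel simplex_sel)
  have "w \<in> bpaths (cells (simplex n) 0) (map (cells_between (simplex n)) (gaps T)) (pt 0) (pt n)"
    by (rule subsetD[OF bpaths_mono[OF SS horn_cells_between] w])
  from simplex_basis[OF T this] obtain g where g: "g \<in> Delta_f p n" "w = necl T (gsimp g)" by blast
  note st = steps_nec[OF T]
  have "map (\<lambda>(s, t). (wsim (gsimp g) s t, wvert (gsimp g) t)) L \<in>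
      bpaths S (map (\<lambda>(s, t). cells_between (horn n j) (t - s)) L) c d \<Longrightarrow> (s, t) \<in> set L \<Longrightarrow>
    wsim (gsimp g) s t \<in> cells (horn n j) (t - s)" for L S c d s t
    by (induction L arbitrary: c) (auto simp: cells_between_def)
  hence hc: "wsim (gsimp g) s t \<in> cells (horn n j) (t - s)" if "(s, t) \<in> set (steps T)" for s t
    using w that unfolding g(2) necl_def gaps_def by (force simp: o_def case_prod_beta')
  have gm: "g u \<le> g v" if "u \<le> v" "v \<le> p" for u v using DeltaD(2)[OF Delta_fD(1)[OF g(1)] that] .
  have "adm T p g"
  proof (cases "\<exists>k\<in>g ` T. 0 < k \<and> k < n")
    case True
    thus ?thesis using g(1) by (simp add: adm_def)
  next
    case False
    have ends: "g u = 0 \<or> g u = n" if "u \<in> T" for u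
      using False that DeltaD(1)[OF Delta_fD(1)[OF g(1)], of u] T by (force simp: is_necklace_def)
    have "linked L x y \<Longrightarrow> g x = 0 \<Longrightarrow> g y = n \<Longrightarrow> set L \<subseteq> set (steps T) \<Longrightarrow>
      \<exists>(s, t)\<in>set L. g s = 0 \<and> g t = n" for L x y
    proof (induction L x y rule: linked.induct)
      case (1 x y)
      thus ?case using n by simp
    next
      case (2 s t L x y)
      have "t \<in> T" using 2(5) steps_nec_gap[OF T, of s t] by simp
      thus ?case using ends[of t] 2 by auto
    qed
    from this[OF st(1) Delta_fD(2,3)[OF g(1)]] obtain s t where s: "(s, t) \<in> set (steps T)" "g s = 0" "g t = n"
      by auto
    note gp = steps_nec_gap[OF T s(1)]
    obtain i where i: "i \<le> n" "i \<noteq> j" "i \<notin> wsim (gsimp g) s t ` {..t - s}"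
      using hc[OF s(1)] by (auto simp: horn_sel)
    have miss: "g u \<noteq> i" if "s \<le> u" "u \<le> t" for u
    proof
      assume "g u = i"
      moreover have us: "u - s \<le> t - s" using that by simp
      ultimately have "i = wsim (gsimp g) s t (u - s)" using that by (simp add: wsim_gsimp)
      thus False using i(3) us by blast
    qed
    have i0: "0 < i" "i < n" using miss[of s] miss[of t] s i(1) gp(1) by auto
    have "g u \<noteq> i" if "u \<le> p" for u
      using miss[of u] gm[of u s] gm[of t u] s i0 that gp by (cases "u < s"; cases "t < u") auto
    hence "i \<notin> g ` {..p}" by auto
    thus ?thesis unfolding adm_def using g(1) i0 i(2) by blast
  qed
  thus ?thesis using g(2) by blast
qed

lemma ftilde_map_incl:
  "ftilde_map R (simplex n) (\<lambda>m x. x) m c d \<in>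
    mod_hom R (fquiv (cells_between (horn n j) m) c d) (fquiv (cells_between (simplex n) m) c d)"
  "x \<in> cells_between (horn n j) m c d \<Longrightarrow> ftilde_map R (simplex n) (\<lambda>m x. x) m c d (single R x) = single R x"
proof -
  have s: "single R x \<in> carrier (free_mod R (cells_between (simplex n) m c d))"
    if "x \<in> cells_between (horn n j) m c d" for x
    using that horn_cells_between by (intro single_closed) blast
  show "ftilde_map R (simplex n) (\<lambda>m x. x) m c d \<in>
    mod_hom R (fquiv (cells_between (horn n j) m) c d) (fquiv (cells_between (simplex n) m) c d)"
    unfolding ftilde_map_def fquiv_def by (rule free_lift_hom[OF free_mod_module s])
  show "x \<in> cells_between (horn n j) m c d \<Longrightarrow> ftilde_map R (simplex n) (\<lambda>m x. x) m c d (single R x) = single R x"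
    unfolding ftilde_map_def by (rule free_lift_single[OF free_mod_module]) (rule s)
qed

text \<open>The inclusion fixes the vertices of each simplex, so it takes the basis element of
  \<open>g\<close> over the horn to that of the same \<open>g\<close> over the simplex.\<close>

lemma horn_incl_hom:
  "horn_incl R n (pt 0) (pt n) T \<in> mod_hom R (nob YH T) (nob YD T)" (is ?h)
  and horn_incl_nelt: "is_necklace (T', p) \<Longrightarrow> adm T' p g \<Longrightarrow>
    horn_incl R n (pt 0) (pt n) (T', p) (H.nelt (T', p) (gsimp g)) = D.nelt (T', p) (gsimp g)"
proof -
  let ?S = "cells (horn n j) 0" and ?S' = "cells (simplex n) 0"
  let ?B = "cells_between (horn n j)" and ?B' = "cells_between (simplex n)"
  let ?\<alpha> = "ftilde_map R (simplex n) (\<lambda>m x. x)"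
  have SS: "?S \<subseteq> ?S'" by (auto simp: horn_sel simplex_sel)
  have alt: "horn_incl R n (pt 0) (pt n) (T, p) =
    tens_lift R (qtensor R ?S' (map fquiv (map ?B' (gaps T))) (pt 0) (pt n))
      (\<lambda>w. pure R ?S' (map fquiv (map ?B' (gaps T))) (pt 0) (pt n) (path_map (\<lambda>x. x) ?\<alpha> (gaps T) (pt 0) w))" for T p
    unfolding horn_incl_def nec_induced_def split_conv nec_mod_def D.map_tmod ftilde_sel(1) ..
  have ml: "multilin ?S (qtensor R ?S' (map fquiv (map ?B' ns)) (pt 0) (pt n)) (map fquiv (map ?B ns)) (pt 0) (pt n)
      (\<lambda>w. pure R ?S' (map fquiv (map ?B' ns)) (pt 0) (pt n) (path_map (\<lambda>x. x) ?\<alpha> ns (pt 0) w))" for ns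
    using path_map_multilin[where Q = "\<lambda>m. fquiv (?B m)" and Q' = "\<lambda>m. fquiv (?B' m)" and \<alpha> = ?\<alpha>,
        OF SS ftilde_map_incl(1) pt_horn(1), of _ ns] pure_multilin[OF qmods_fquiv pt_simplex(1), of "map ?B' ns" "pt n"]
    by (simp add: o_def)
  show "horn_incl R n (pt 0) (pt n) T \<in> mod_hom R (nob YH T) (nob YD T)"
  proof (cases T)
    case (Pair T p)
    show ?thesis unfolding Pair alt H.nob_nec_fun D.nob_nec_fun
      by (rule tens_lift_hom[OF qmods_fquiv qtensor_module[OF qmods_fquiv] ml])
  qed
  show "horn_incl R n (pt 0) (pt n) (T', p) (H.nelt (T', p) (gsimp g)) = D.nelt (T', p) (gsimp g)"
    if T: "is_necklace (T', p)" and g: "adm T' p g"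
  proof -
    have gD: "g \<in> Delta_f p n" using g by (simp add: adm_def)
    note ve = wvert_gsimp_ends[OF gD]
    have w: "necl T' (gsimp g) \<in> bpaths ?S (map ?B (gaps T')) (pt 0) (pt n)"
      using H.necl_closed[OF nsimp_horn[OF T g] T] ve by simp
    have "horn_incl R n (pt 0) (pt n) (T', p) (bpure ?S (map ?B (gaps T')) (pt 0) (pt n) (necl T' (gsimp g))) =
      pure R ?S' (map fquiv (map ?B' (gaps T'))) (pt 0) (pt n)
        (path_map (\<lambda>x. x) ?\<alpha> (gaps T') (pt 0) (bas (necl T' (gsimp g))))"
      unfolding alt bpure_def
      by (rule tens_lift_pure[OF qmods_fquiv qtensor_module[OF qmods_fquiv] ml bas_closed[OF w]])
    also have "path_map (\<lambda>x. x) ?\<alpha> (gaps T') (pt 0) (bas (necl T' (gsimp g))) = bas (necl T' (gsimp g))"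
      by (rule path_map_bas[OF ftilde_map_incl(2) w])
    finally show ?thesis
      using ve by (simp add: H.nelt_def nelt_simplex[OF gD] bpure_def)
  qed
qed

text \<open>The lift sends the basis element of \<open>g\<close> to \<open>M T p g y\<close>. It is
  natural by functoriality in \<open>g\<close>, and it extends \<open>\<phi>\<close> because
  \<open>y\<close> has the prescribed values at all necklaces in the horn.\<close>

lemma extension:
  "\<exists>\<psi>. nec_nat_trans R YD Y \<psi> \<and>
    (\<forall>T. is_necklace T \<longrightarrow> (\<forall>z\<in>carrier (nec_mod R (ftilde R (horn n j)) T (pt 0) (pt n)).
       \<psi> T (horn_incl R n (pt 0) (pt n) T z) = \<phi> T z))"
proof -
  obtain y where y: "y \<in> carrier (nob Y I\<^sub>n)"
    "\<forall>T p g. is_necklace (T, p) \<longrightarrow> adm T p g \<longrightarrow> M T p g y = F T p g" using solution by blast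
  have ex: "\<exists>h. h \<in> mod_hom R (nob YD (T, p)) (nob Y (T, p)) \<and>
      (\<forall>g\<in>Delta_f p n. h (D.nelt (T, p) (gsimp g)) = M T p g y)" if T: "is_necklace (T, p)" for T p
  proof -
    let ?P = "\<lambda>w g. g \<in> Delta_f p n \<and> w = necl T (gsimp g)"
    \<comment> \<open>The map \<open>g\<close> is read back from its path by choice;
      \<open>necl_inject\<close> makes it unique.\<close>
    define G where "G w = M T p (SOME g. ?P w g) y" for w
    have G: "G (necl T (gsimp g)) = M T p g y" if g: "g \<in> Delta_f p n" for g
    proof -
      have "?P (necl T (gsimp g)) (SOME g'. ?P (necl T (gsimp g)) g')" by (rule someI[of _ g]) (simp add: g)
      hence "(SOME g'. ?P (necl T (gsimp g)) g') = g" using necl_inject[OF T _ g] by metis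
      thus ?thesis by (simp add: G_def)
    qed
    have Gc: "G w \<in> carrier (nob Y (T, p))"
      if "w \<in> bpaths (cells (simplex n) 0) (map (cells_between (simplex n)) (gaps T)) (pt 0) (pt n)" for w
      using simplex_basis[OF T that] G mod_hom_closed[OF M_hom[OF T] y(1)] by auto
    obtain h where h: "h \<in> mod_hom R (nob YD (T, p)) (nob Y (T, p))"
      "\<And>w. w \<in> bpaths (cells (simplex n) 0) (map (cells_between (simplex n)) (gaps T)) (pt 0) (pt n) \<Longrightarrow>
        h (bpure (cells (simplex n) 0) (map (cells_between (simplex n)) (gaps T)) (pt 0) (pt n) w) = G w"
      using qtensor_basis_hom[where g = G and Bs = "map (cells_between (simplex n)) (gaps T)",
          OF nob_module Gc pt_simplex(1)] unfolding D.nob_nec_fun[where T = T and p = p, symmetric] by blast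
    have "h (D.nelt (T, p) (gsimp g)) = M T p g y" if "g \<in> Delta_f p n" for g
      unfolding nelt_simplex[OF that] h(2)[OF necl_simplex[OF T that]] by (rule G[OF that])
    thus ?thesis using h(1) by blast
  qed
  define \<psi> where "\<psi> = (\<lambda>(T, p). SOME h. h \<in> mod_hom R (nob YD (T, p)) (nob Y (T, p)) \<and>
      (\<forall>g\<in>Delta_f p n. h (D.nelt (T, p) (gsimp g)) = M T p g y))"
  have \<psi>: "\<psi> (T, p) \<in> mod_hom R (nob YD (T, p)) (nob Y (T, p)) \<and>
      (\<forall>g\<in>Delta_f p n. \<psi> (T, p) (D.nelt (T, p) (gsimp g)) = M T p g y)" if "is_necklace (T, p)" for T p
    unfolding \<psi>_def split_conv by (rule someI_ex[OF ex[OF that]])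
  have nat: "\<psi> (T, p) (nmap YD (T, p) (U, q) f z) = nmap Y (T, p) (U, q) f (\<psi> (U, q) z)"
    if T: "is_necklace (T, p)" and U: "is_necklace (U, q)" and f: "f \<in> nec_hom (T, p) (U, q)"
      and z: "z \<in> carrier (nob YD (U, q))" for T p U q f z
  proof (rule D.nec_basis_eqI[OF nob_module pt_simplex(1) U
        mod_hom_comp[OF D.nmap_hom[OF T U f pt_simplex(1)] conjunct1[OF \<psi>[OF T]]]
        mod_hom_comp[OF conjunct1[OF \<psi>[OF U]] nmap_hom[OF T U f ab(1)]] _ z])
    fix w assume "w \<in> bpaths (cells (simplex n) 0) (map (cells_between (simplex n)) (gaps (fst (U, q)))) (pt 0) (pt n)"
    then obtain g where g: "g \<in> Delta_f q n" "w = necl U (gsimp g)" using simplex_basis[OF U] by auto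
    have fD: "f \<in> Delta_f p q" using f by (simp add: nec_hom_def)
    have gf: "compose {..p} g f \<in> Delta_f p n" by (rule compose_Delta_f[OF fD g(1)])
    have b: "bpure (cells (simplex n) 0) (map (cells_between (simplex n)) (gaps (fst (U, q)))) (pt 0) (pt n) w =
      D.nelt (U, q) (gsimp g)" using nelt_simplex[OF g(1)] g(2) by simp
    have "nmap YD (T, p) (U, q) f (D.nelt (U, q) (gsimp g)) = D.nelt (T, p) (wpull (gsimp g) f)"
      by (rule D.nmap_nelt[OF T U f nsimp_gsimp_simplex[OF Delta_fD(1)[OF g(1)]]])
        (use wvert_gsimp_ends[OF g(1)] in auto)
    also have "\<dots> = D.nelt (T, p) (gsimp (compose {..p} g f))"
      by (rule D.nelt_cong[OF T wpull_gsimp[OF Delta_fD(1)[OF fD]]])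
    finally show "\<psi> (T, p) (nmap YD (T, p) (U, q) f
        (bpure (cells (simplex n) 0) (map (cells_between (simplex n)) (gaps (fst (U, q)))) (pt 0) (pt n) w)) =
      nmap Y (T, p) (U, q) f (\<psi> (U, q)
        (bpure (cells (simplex n) 0) (map (cells_between (simplex n)) (gaps (fst (U, q)))) (pt 0) (pt n) w))"
      unfolding b using \<psi>[OF T] \<psi>[OF U] gf g(1) nmap_M[OF T U f g(1) y(1)] by simp
  qed
  have nt: "nec_nat_trans R YD Y \<psi>"
    unfolding nec_nat_trans_def using \<psi> nat by (simp add: split_paired_all)
  have "\<psi> (T, p) (horn_incl R n (pt 0) (pt n) (T, p) z) = \<phi> (T, p) z"
    if T: "is_necklace (T, p)" and z: "z \<in> carrier (nob YH (T, p))" for T p z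
  proof (rule H.nec_basis_eqI[OF nob_module pt_horn(1) T mod_hom_comp[OF horn_incl_hom conjunct1[OF \<psi>[OF T]]]
        \<phi>_hom[OF T] _ z])
    fix w assume "w \<in> bpaths (cells (horn n j) 0) (map (cells_between (horn n j)) (gaps (fst (T, p)))) (pt 0) (pt n)"
    then obtain g where g: "adm T p g" "w = necl T (gsimp g)" using horn_basis[OF T] by auto
    have gD: "g \<in> Delta_f p n" using g(1) by (simp add: adm_def)
    have b: "bpure (cells (horn n j) 0) (map (cells_between (horn n j)) (gaps (fst (T, p)))) (pt 0) (pt n) w =
      H.nelt (T, p) (gsimp g)" using wvert_gsimp_ends[OF gD] g(2) by (simp add: H.nelt_def)
    show "\<psi> (T, p) (horn_incl R n (pt 0) (pt n) (T, p)
        (bpure (cells (horn n j) 0) (map (cells_between (horn n j)) (gaps (fst (T, p)))) (pt 0) (pt n) w)) =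
      \<phi> (T, p) (bpure (cells (horn n j) 0) (map (cells_between (horn n j)) (gaps (fst (T, p)))) (pt 0) (pt n) w)"
      unfolding b horn_incl_nelt[OF T g(1)] using \<psi>[OF T] gD y(2)[rule_format, OF T g(1)] by (simp add: F_def)
  qed
  moreover have "nec_mod R (ftilde R (horn n j)) T (pt 0) (pt n) = nob YH T" for T
    by (simp add: nec_fun_def)
  ultimately show ?thesis using nt by (intro exI[of _ \<psi>]) (simp add: split_paired_all)
qed

end

theorem corollary4p15:
  fixes R :: "('r, 'e) ring_scheme" and C :: "'x sset"
  assumes "cring R" and "quasi_category C"
  shows "quasi_category_in_modules R (ftilde R C)"
proof -
  have C: "simplicial_set C" using assms(2) by (simp add: quasi_category_def)
  interpret simplicial_base R C
    by (intro simplicial_base.intro simplicial_base_axioms.intro assms(1) C)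
  have "lifts_inner_horns R (nec_fun R (ftilde R C) a b)" if "a \<in> cells C 0" "b \<in> cells C 0" for a b
    unfolding lifts_inner_horns_def
  proof (intro allI impI, elim conjE)
    fix n j \<phi>
    assume nj: "0 < j" "j < n"
      and \<phi>: "nec_nat_trans R (nec_fun R (ftilde R (horn n j)) (pt 0) (pt n)) (nec_fun R (ftilde R C) a b) \<phi>"
    interpret horn_problem R C n j a b \<phi>
      by unfold_locales (use assms(2) nj that \<phi> in auto)
    show "\<exists>\<psi>. nec_nat_trans R (nec_fun R (ftilde R (simplex n)) (pt 0) (pt n)) (nec_fun R (ftilde R C) a b) \<psi> \<and>
      (\<forall>T. is_necklace T \<longrightarrow> (\<forall>z\<in>carrier (nec_mod R (ftilde R (horn n j)) T (pt 0) (pt n)).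
         \<psi> T (horn_incl R n (pt 0) (pt n) T z) = \<phi> T z))"
      by (rule extension)
  qed
  thus ?thesis
    using templicial_module_ftilde by (simp add: quasi_category_in_modules_def ftilde_sel(1))
qed

end
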